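(* For every prime $p$ the following identities of formal power series in two variables $t,u$ (with real coefficients) hold: $$\sum_{d\ge0}\mathcal{A}_d(pt)u^d=\Big(\sum_{d\ge0}\mathcal{B}_d(t)u^d\Big)^p,$$ $$\sum_{d\ge0}\mathcal{R}_d(t)u^d=\Big(\sum_{d\ge0}\mathcal{A}_d(pt)u^d\Big)\Big(\sum_{d\ge0}\mathcal{B}_d(t)u^d\Big)=\Big(\sum_{d\ge0}\mathcal{B}_d(t)u^d\Big)^{p+1},$$ and, for every $d\ge0$, $$\mathcal{B}_d(t)-t\,\mathcal{B}_d(t/p)=\Phi\big(\mathcal{A}_d(t)-t\,\mathcal{A}_d(pt)\big),$$ where $\Phi$ is the linear operator on power series in $t$ sending $\sum_n c_nt^n$ to $\sum_n p^{-\binom{n}{2}}c_nt^n$.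
   Context: Fix a prime $p$ and let $\mathbb{Z}_p,\mathbb{Q}_p$ be the $p$-adic integers and numbers. Random polynomials: (i) a random polynomial of degree $n$ over $\mathbb{Z}_p$ is $f=c_nx^n+\dots+c_0$ with $(c_0,\dots,c_n)\in\mathbb{Z}_p^{n+1}$ distributed according to the Haar measure normalized to total mass $1$; (ii) a random monic polynomial of degree $n$ is $f=x^n+a_{n-1}x^{n-1}+\dots+a_0$ with $(a_0,\dots,a_{n-1})\in\mathbb{Z}_p^n$ Haar-distributed with total mass $1$; (iii) a random monic polynomial of degree $n$ reducing to $x^n$ mod $p$ is $f=x^n+a_{n-1}x^{n-1}+\dots+a_0$ with $(a_0,\dots,a_{n-1})$ Haar-distributed on $(p\mathbb{Z}_p)^n$ normalized to total mass $1$. For $f\neq0$ let $X(f)$ be the number of distinct roots of $f$ in $\mathbb{Q}_p$. Define $\rho(n,d)=\mathbb{E}\binom{X}{d}$ for model (i), $\alpha(n,d)=\mathbb{E}\binom{X}{d}$ for model (ii), $\beta(n,d)=\mathbb{E}\binom{X}{d}$ for model (iii), for all integers $n,d\ge0$ (so these vanish when $d>n$). Generating functions: $\mathcal{A}_d(t)=(1-t)\sum_{n\ge0}\alpha(n,d)t^n$, $\mathcal{B}_d(t)=(1-t)\sum_{n\ge0}\beta(n,d)t^n$, $\mathcal{R}_d(t)=(1-t)(1-pt)\sum_{n\ge0}(p^n+p^{n-1}+\dots+1)\rho(n,d)t^n$. *)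

theory Defs
  imports "HOL-Probability.Probability" "HOL-Computational_Algebra.Formal_Power_Series"
begin

text \<open>An element of Z_p is represented by its digit sequence a :: nat \<Rightarrow> nat with
  all digits < p (a j is the coefficient of p^j). Distinct such sequences are distinct
  p-adic integers. The residue of a modulo p^k is its truncation.\<close>

definition padic_digits :: "nat \<Rightarrow> (nat \<Rightarrow> nat) \<Rightarrow> bool" where
  "padic_digits p a \<longleftrightarrow> (\<forall>j. a j < p)"

definition ptrunc :: "nat \<Rightarrow> (nat \<Rightarrow> nat) \<Rightarrow> nat \<Rightarrow> int" where
  "ptrunc p a k = (\<Sum>j<k. int (a j) * int p ^ j)"

definition padic_one :: "nat \<Rightarrow> nat" where
  "padic_one j = (if j = 0 then 1 else 0)"

text \<open>Elements of Q_p are represented canonically as a / p^e with a in Z_p and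
  either e = 0 or a a unit (first digit nonzero); this representation is unique.
  For the polynomial f = \<Sum>i\<le>n. c i * x^i (coefficients c i in Z_p),
  f(a/p^e) = 0 iff p^(e n) f(a/p^e) = \<Sum>i\<le>n. c_i a^i p^(e(n-i)) = 0 in Z_p,
  i.e. iff this element vanishes modulo every p^k.\<close>

definition qp_root :: "nat \<Rightarrow> nat \<Rightarrow> (nat \<Rightarrow> nat \<Rightarrow> nat) \<Rightarrow> (nat \<Rightarrow> nat) \<Rightarrow> nat \<Rightarrow> bool" where
  "qp_root p n c a e \<longleftrightarrow>
     (\<forall>k. (\<Sum>i\<le>n. ptrunc p (c i) k * ptrunc p a k ^ i * int p ^ (e * (n - i))) mod (int p ^ k) = 0)"

definition qp_roots :: "nat \<Rightarrow> nat \<Rightarrow> (nat \<Rightarrow> nat \<Rightarrow> nat) \<Rightarrow> ((nat \<Rightarrow> nat) \<times> nat) set" where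
  "qp_roots p n c = {(a, e). padic_digits p a \<and> (e = 0 \<or> a 0 \<noteq> 0) \<and> qp_root p n c a e}"

text \<open>Number of distinct roots in Q_p of \<Sum>i\<le>n. c i x^i (the zero polynomial, which
  has infinitely many roots, gets card = 0; it occurs only with probability 0).\<close>
definition num_roots :: "nat \<Rightarrow> nat \<Rightarrow> (nat \<Rightarrow> nat \<Rightarrow> nat) \<Rightarrow> nat" where
  "num_roots p n c = card (qp_roots p n c)"

text \<open>Independent uniform digits \<omega>(i,j) \<in> {0..<p}; the p-adic integer with digits
  \<omega>(i,0), \<omega>(i,1), ... is Haar distributed on Z_p, independently for different i.\<close>
definition digit_measure :: "nat \<Rightarrow> (nat \<times> nat \<Rightarrow> nat) measure" where
  "digit_measure p = PiM UNIV (\<lambda>_. measure_pmf (pmf_of_set {0..<p}))"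

definition coef_full :: "(nat \<times> nat \<Rightarrow> nat) \<Rightarrow> nat \<Rightarrow> nat \<Rightarrow> nat" where
  "coef_full \<omega> i = (\<lambda>j. \<omega> (i, j))"

definition coef_monic :: "nat \<Rightarrow> (nat \<times> nat \<Rightarrow> nat) \<Rightarrow> nat \<Rightarrow> nat \<Rightarrow> nat" where
  "coef_monic n \<omega> i = (if i = n then padic_one else (\<lambda>j. \<omega> (i, j)))"

text \<open>Coefficient p * (Haar element): digits shifted by one place, i.e. Haar on p Z_p.\<close>
definition coef_eis :: "nat \<Rightarrow> (nat \<times> nat \<Rightarrow> nat) \<Rightarrow> nat \<Rightarrow> nat \<Rightarrow> nat" where
  "coef_eis n \<omega> i = (if i = n then padic_one else (\<lambda>j. if j = 0 then 0 else \<omega> (i, j - 1)))"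

definition rho :: "nat \<Rightarrow> nat \<Rightarrow> nat \<Rightarrow> real" where
  "rho p n d = (\<integral>\<omega>. real (num_roots p n (coef_full \<omega>) choose d) \<partial>digit_measure p)"

definition alpha :: "nat \<Rightarrow> nat \<Rightarrow> nat \<Rightarrow> real" where
  "alpha p n d = (\<integral>\<omega>. real (num_roots p n (coef_monic n \<omega>) choose d) \<partial>digit_measure p)"

definition beta :: "nat \<Rightarrow> nat \<Rightarrow> nat \<Rightarrow> real" where
  "beta p n d = (\<integral>\<omega>. real (num_roots p n (coef_eis n \<omega>) choose d) \<partial>digit_measure p)"

definition fps_scale :: "real \<Rightarrow> real fps \<Rightarrow> real fps" where
  "fps_scale c F = Abs_fps (\<lambda>n. c ^ n * fps_nth F n)"

definition Phi :: "nat \<Rightarrow> real fps \<Rightarrow> real fps" where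
  "Phi p F = Abs_fps (\<lambda>n. fps_nth F n / real p ^ (n choose 2))"

definition Agf :: "nat \<Rightarrow> nat \<Rightarrow> real fps" where
  "Agf p d = (1 - fps_X) * Abs_fps (\<lambda>n. alpha p n d)"

definition Bgf :: "nat \<Rightarrow> nat \<Rightarrow> real fps" where
  "Bgf p d = (1 - fps_X) * Abs_fps (\<lambda>n. beta p n d)"

definition Rgf :: "nat \<Rightarrow> nat \<Rightarrow> real fps" where
  "Rgf p d = (1 - fps_X) * (1 - fps_const (real p) * fps_X) *
             Abs_fps (\<lambda>n. (\<Sum>j\<le>n. real p ^ j) * rho p n d)"

end

theory Submission
  imports Defs
begin

text \<open>Put \<open>z = 1 + u\<close>, so that the expectation of \<open>z ^ X\<close> generates the expectations of the binomials
  in \<open>X\<close>. The number \<open>X\<close> is approximated by the number of residue classes modulo \<open>p ^ K\<close> that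
  contain a root of \<open>f\<close> modulo \<open>p ^ k\<close>; letting first \<open>k\<close> and then \<open>K\<close> tend to infinity recovers \<open>X\<close>
  by compactness, and at each finite level the expectation is a mean over coefficients
  modulo \<open>p ^ k\<close>. There, if the reduction of \<open>f\<close> modulo \<open>p\<close> splits into coprime factors, one monic, then
  \<open>f\<close> splits uniquely with independent uniformly distributed factors (injectivity is the
  uniqueness part of Hensel's lemma, surjectivity is counting), and the numbers of root classes of
  the factors add up. Splitting off the powers of \<open>x - a\<close> for one residue \<open>a\<close> after the other gives the
  first identity; separating the roots in \<open>Z_p\<close> from the others gives the second.
  For the third, \<open>f (p x)\<close> is divided by \<open>p\<close> repeatedly as long as its reduction vanishes. If after
  \<open>r\<close> divisions the reduction is nonzero of degree \<open>s < r\<close>, then the roots in \<open>Z_p\<close> are those of a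
  random monic factor of degree \<open>s\<close>. This expresses \<open>\<beta>\<close> through \<open>\<alpha>\<close>.\<close>

section \<open>Means over boxes of coefficients\<close>

text \<open>However large \<open>k\<close> is, roots modulo \<open>p ^ k\<close> need not match
  p-adic roots: one p-adic root may be surrounded by many of them. Only their traces modulo a fixed
  \<open>p ^ K\<close> settle down as \<open>k\<close> grows, hence two precisions and an iterated
  limit. A division by \<open>p\<close> lowers \<open>k\<close> by one and the substitution of
  \<open>p x\<close> lowers \<open>K\<close> as well; both shifts vanish in the limit, which turns
  recursions between levels into equations. The constants are probabilities. The reduction of a
  monic f of degree n has order exactly m at a given residue with probability (1 - 1/p) p^(-m) for m
  < n and p^(-n) for m = n. Times p^n this depends on n - m only, whence the argument p t and
  convolutions, that is, products of series. A polynomial with n + 1 free coefficients reduces to 0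
  with probability p^(-(n+1)); solving for the expectation yields the weights p^n + ... + 1. After r
  divisions of f(p x), 1 <= r < n, a further one is possible with probability p^(-r); the product of
  these numbers is p^(-binom(n,2)), the factor in \<Phi>.\<close>

definition polys :: "(nat \<Rightarrow> int set) \<Rightarrow> int poly set" where
  "polys C = {f. \<forall>i. coeff f i \<in> C i}"

definition mean :: "'a set \<Rightarrow> ('a \<Rightarrow> real) \<Rightarrow> real" where
  "mean S \<psi> = (\<Sum>f\<in>S. \<psi> f) / real (card S)"

definition poly_upto :: "nat \<Rightarrow> (nat \<Rightarrow> int) \<Rightarrow> int poly" where
  "poly_upto n c = (\<Sum>i<n. monom (c i) i)"

lemma coeff_poly_upto: "coeff (poly_upto n c) i = (if i < n then c i else 0)"
proof -
  have "coeff (poly_upto n c) i = (\<Sum>j<n. if j = i then c j else 0)"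
    by (simp add: poly_upto_def coeff_sum)
  then show ?thesis by (simp add: sum.delta)
qed

lemma polys_bij:
  assumes "\<And>i. i \<ge> n \<Longrightarrow> C i = {0}"
  shows "bij_betw (poly_upto n) (PiE {..<n} C) (polys C)"
proof (rule bij_betwI[where g = "\<lambda>f. restrict (coeff f) {..<n}"])
  show "poly_upto n \<in> PiE {..<n} C \<rightarrow> polys C"
    using assms by (auto simp: polys_def coeff_poly_upto not_less)
  show "(\<lambda>f. restrict (coeff f) {..<n}) \<in> polys C \<rightarrow> PiE {..<n} C"
    by (auto simp: polys_def)
  show "restrict (coeff (poly_upto n c)) {..<n} = c" if "c \<in> PiE {..<n} C" for c
    using that by (auto simp: coeff_poly_upto PiE_def extensional_def restrict_def fun_eq_iff)
  show "poly_upto n (restrict (coeff f) {..<n}) = f" if "f \<in> polys C" for f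
  proof (rule poly_eqI)
    fix i
    show "coeff (poly_upto n (restrict (coeff f) {..<n})) i = coeff f i"
    proof (cases "i < n")
      case False
      then have "coeff f i \<in> {0}" using that assms[of i] by (auto simp: polys_def)
      then show ?thesis using False by (simp add: coeff_poly_upto)
    qed (simp add: coeff_poly_upto)
  qed
qed

lemma card_polys:
  assumes "\<And>i. i \<ge> n \<Longrightarrow> C i = {0}"
  shows "card (polys C) = (\<Prod>i<n. card (C i))"
  using bij_betw_same_card[OF polys_bij[OF assms]] by (simp add: card_PiE)

lemma finite_polys:
  assumes "\<And>i. i \<ge> n \<Longrightarrow> C i = {0}" "\<And>i. finite (C i)"
  shows "finite (polys C)"
  using bij_betw_finite[OF polys_bij[OF assms(1)]] assms(2) by (simp add: finite_PiE)

lemma polys_nonempty: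
  assumes "\<And>i. i \<ge> n \<Longrightarrow> C i = {0}" "\<And>i. C i \<noteq> {}"
  shows "polys C \<noteq> {}"
proof -
  have "PiE {..<n} C \<noteq> {}" using assms(2) by (simp add: PiE_eq_empty_iff)
  then show ?thesis using bij_betw_imp_surj_on[OF polys_bij[OF assms(1)]] by force
qed

lemma mean_cong: "(\<And>f. f \<in> S \<Longrightarrow> \<psi> f = \<phi> f) \<Longrightarrow> mean S \<psi> = mean S \<phi>"
  by (simp add: mean_def cong: sum.cong)

lemma mean_one: "finite S \<Longrightarrow> S \<noteq> {} \<Longrightarrow> mean S (\<lambda>_. 1) = 1"
  by (simp add: mean_def)

lemma mean_image:
  assumes "inj_on \<theta> S" "\<theta> ` S = T"
  shows "mean S (\<lambda>x. \<psi> (\<theta> x)) = mean T \<psi>"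
proof -
  have "card T = card S" using assms card_image by blast
  then show ?thesis using sum.reindex[OF assms(1), of \<psi>] assms(2) by (simp add: mean_def)
qed

text \<open>The fibres of a coordinatewise map of boxes are boxes, so it preserves
  means as soon as each coordinate has fibres of constant size.\<close>

lemma mean_polys_map:
  fixes \<theta> :: "nat \<Rightarrow> int \<Rightarrow> int"
  assumes C0: "\<And>i. i \<ge> n \<Longrightarrow> C i = {0}" and D0: "\<And>i. i \<ge> n \<Longrightarrow> D i = {0}"
    and fC: "\<And>i. finite (C i)" and fD: "\<And>i. finite (D i)"
    and \<theta>: "\<And>i x. i < n \<Longrightarrow> x \<in> C i \<Longrightarrow> \<theta> i x \<in> D i"
    and m: "\<And>i y. i < n \<Longrightarrow> y \<in> D i \<Longrightarrow> card {x \<in> C i. \<theta> i x = y} = m i"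
    and mpos: "\<And>i. i < n \<Longrightarrow> m i > 0"
  shows "mean (polys C) (\<lambda>f. \<psi> (poly_upto n (\<lambda>i. \<theta> i (coeff f i)))) = mean (polys D) \<psi>"
proof -
  define T where "T f = poly_upto n (\<lambda>i. \<theta> i (coeff f i))" for f
  define M where "M = (\<Prod>i<n. m i)"
  have Mpos: "M > 0" unfolding M_def using mpos by (intro prod_pos) auto
  have finC: "finite (polys C)" using finite_polys[OF C0 fC] by auto
  have finD: "finite (polys D)" using finite_polys[OF D0 fD] by auto
  have T: "T ` polys C \<subseteq> polys D"
    using \<theta> D0 by (auto simp: T_def polys_def coeff_poly_upto not_less)
  have fib: "card {f \<in> polys C. T f = g} = M" if g: "g \<in> polys D" for g
  proof -
    define B where "B i = (if i < n then {x \<in> C i. \<theta> i x = coeff g i} else {0})" for i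
    have "{f \<in> polys C. T f = g} = polys B"
    proof (intro set_eqI iffI)
      fix f assume f: "f \<in> {f \<in> polys C. T f = g}"
      have "coeff f i \<in> B i" for i
        using f C0[of i] arg_cong[of "T f" g "\<lambda>h. coeff h i"]
        by (auto simp: B_def T_def polys_def coeff_poly_upto not_less)
      then show "f \<in> polys B" by (simp add: polys_def)
    next
      fix f assume f: "f \<in> polys B"
      have B: "coeff f i \<in> B i" for i using f by (simp add: polys_def)
      have "coeff f i \<in> C i" for i using B[of i] C0[of i] by (auto simp: B_def split: if_splits)
      moreover have "coeff (T f) i = coeff g i" for i
        using B[of i] g D0[of i] by (auto simp: B_def T_def polys_def coeff_poly_upto not_less split: if_splits)
      ultimately show "f \<in> {f \<in> polys C. T f = g}" by (auto simp: polys_def intro: poly_eqI)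
    qed
    moreover have "card (polys B) = (\<Prod>i<n. card (B i))" by (rule card_polys) (simp add: B_def)
    moreover have "(\<Prod>i<n. card (B i)) = M"
      unfolding M_def using g m by (intro prod.cong) (auto simp: B_def polys_def)
    ultimately show ?thesis by simp
  qed
  have main: "(\<Sum>f\<in>polys C. \<phi> (T f)) = real M * (\<Sum>g\<in>polys D. \<phi> g)" for \<phi> :: "int poly \<Rightarrow> real"
  proof -
    have "(\<Sum>f\<in>polys C. \<phi> (T f)) = (\<Sum>g\<in>polys D. \<Sum>f\<in>{f \<in> polys C. T f = g}. \<phi> (T f))"
      using sum.group[OF finC finD T, of "\<lambda>f. \<phi> (T f)"] by simp
    also have "\<dots> = (\<Sum>g\<in>polys D. \<Sum>f\<in>{f \<in> polys C. T f = g}. \<phi> g)"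
      by (intro sum.cong) auto
    also have "\<dots> = (\<Sum>g\<in>polys D. real M * \<phi> g)" using fib by (intro sum.cong) auto
    finally show ?thesis by (simp add: sum_distrib_left)
  qed
  have "real (card (polys C)) = real M * real (card (polys D))" using main[of "\<lambda>_. 1"] by simp
  then show ?thesis using main[of \<psi>] Mpos by (simp add: mean_def T_def)
qed

lemma mean_split:
  assumes "finite S" "S = S1 \<union> S2" "S1 \<inter> S2 = {}"
  shows "mean S \<psi> = real (card S1) / real (card S) * mean S1 \<psi> + real (card S2) / real (card S) * mean S2 \<psi>"
proof -
  have f: "finite S1" "finite S2" using assms by auto
  \<comment> \<open>An empty part has mean 0 / 0 = 0, and both sides are 0.\<close>
  have e: "real (card T) / c * mean T \<psi> = sum \<psi> T / c" if "finite T" for T c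
    using that by (cases "T = {}") (auto simp: mean_def)
  show ?thesis unfolding e[OF f(1)] e[OF f(2)]
    using assms f by (simp add: mean_def sum.union_disjoint add_divide_distrib)
qed

text \<open>The size of a box is the product of the sizes of its sides, so restricting one side to a
  subset changes it by the proportion within that side.\<close>

lemma mean_split_coord:
  assumes C0: "\<And>i. i \<ge> n \<Longrightarrow> C i = {0}" and fC: "\<And>i. finite (C i)" and ne: "\<And>i. C i \<noteq> {}"
    and s: "s < n" and DE: "C s = D \<union> E" "D \<inter> E = {}"
  shows "mean (polys C) \<psi> = real (card D) / real (card (C s)) * mean (polys (C(s := D))) \<psi>
      + real (card E) / real (card (C s)) * mean (polys (C(s := E))) \<psi>"
proof -
  have cd: "real (card (polys (C(s := X)))) / real (card (polys C)) = real (card X) / real (card (C s))" for X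
  proof -
    have "card (polys (C(s := X))) = (\<Prod>i<n. card ((C(s := X)) i))"
      by (rule card_polys) (use C0 s in auto)
    also have "\<dots> = card X * (\<Prod>i\<in>{..<n}-{s}. card (C i))"
      using s by (subst prod.remove[of _ s]) (auto intro!: prod.cong)
    finally have 1: "card (polys (C(s := X))) = card X * (\<Prod>i\<in>{..<n}-{s}. card (C i))" .
    have "card (polys C) = (\<Prod>i<n. card (C i))" by (rule card_polys) (use C0 in auto)
    also have "\<dots> = card (C s) * (\<Prod>i\<in>{..<n}-{s}. card (C i))"
      using s by (subst prod.remove[of _ s]) auto
    finally have 2: "card (polys C) = card (C s) * (\<Prod>i\<in>{..<n}-{s}. card (C i))" .
    have "(\<Prod>i\<in>{..<n}-{s}. card (C i)) \<noteq> 0" using fC ne by auto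
    then show ?thesis unfolding 1 2 by simp
  qed
  have "polys C = polys (C(s := D)) \<union> polys (C(s := E))"
    "polys (C(s := D)) \<inter> polys (C(s := E)) = {}"
  proof -
    show "polys (C(s := D)) \<inter> polys (C(s := E)) = {}" using DE by (auto simp: polys_def)
    have "f \<in> polys (C(s := D)) \<or> f \<in> polys (C(s := E))" if "f \<in> polys C" for f
    proof -
      have f: "coeff f i \<in> C i" for i using that by (simp add: polys_def)
      with f[of s] DE show ?thesis by (auto simp: polys_def)
    qed
    moreover have "polys (C(s := D)) \<subseteq> polys C" "polys (C(s := E)) \<subseteq> polys C"
      using DE by (auto simp: polys_def split: if_splits)
    ultimately show "polys C = polys (C(s := D)) \<union> polys (C(s := E))" by blast
  qed
  from mean_split[OF _ this] finite_polys[OF C0 fC] show ?thesis by (simp add: cd)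
qed

section \<open>Uniqueness of coprime factorizations modulo prime powers\<close>

definition redq :: "int \<Rightarrow> int poly \<Rightarrow> int poly" where
  "redq q f = map_poly (\<lambda>x. x mod q) f"

lemma coeff_redq: "coeff (redq q f) i = coeff f i mod q"
  by (simp add: redq_def coeff_map_poly)

text \<open>Induction on the exponent. If the factorizations agree modulo P^j, the quotients
  \<delta>, \<epsilon> of the differences by P^j satisfy \<delta> h + \<epsilon> g' = 0 modulo P,
  and \<delta> has degree below m because g and g' are both monic of degree m. \<open>cop\<close> is
  the coprimality of h and g' modulo P in the form that makes \<delta> vanish; then \<epsilon>
  vanishes as well, since P is prime in Z[x] and does not divide g'.\<close>

lemma hensel_unique:
  fixes g h g' h' :: "int poly" and P :: int
  assumes P: "prime P"
    and g: "coeff g m = 1" "\<And>i. i > m \<Longrightarrow> coeff g i = 0"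
    and g': "coeff g' m = 1" "\<And>i. i > m \<Longrightarrow> coeff g' i = 0"
    and gh: "[:P ^ k:] dvd g' * h' - g * h"
    and cop: "\<And>\<delta> \<epsilon>. (\<And>i. i \<ge> m \<Longrightarrow> coeff \<delta> i = 0) \<Longrightarrow> [:P:] dvd \<delta> * h + \<epsilon> * g' \<Longrightarrow> [:P:] dvd \<delta>"
  shows "[:P ^ k:] dvd g' - g \<and> [:P ^ k:] dvd h' - h"
proof -
  have pp: "prime_elem [:P:]" by (subst prime_elem_const_poly_iff) (rule prime_imp_prime_elem[OF P])
  have ng': "\<not> [:P:] dvd g'"
  proof
    assume "[:P:] dvd g'"
    then have "P dvd coeff g' m" by (simp add: const_poly_dvd_iff)
    then show False using g' P by (simp add: not_prime_unit)
  qed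
  have "j \<le> k \<Longrightarrow> [:P ^ j:] dvd g' - g \<and> [:P ^ j:] dvd h' - h" for j
  proof (induction j)
    case 0
    show ?case by (simp add: const_poly_dvd_iff)
  next
    case (Suc j)
    then obtain \<delta> \<epsilon> where d: "g' - g = [:P ^ j:] * \<delta>" and e: "h' - h = [:P ^ j:] * \<epsilon>"
      by (metis dvdE Suc_leD)
    have nz: "[:P ^ j:] \<noteq> 0" using P by auto
    have "g' * h' - g * h = (g' - g) * h + g' * (h' - h)" by (simp add: algebra_simps)
    also have "\<dots> = [:P ^ j:] * (\<delta> * h + \<epsilon> * g')" unfolding d e by (simp add: algebra_simps)
    finally have eq: "g' * h' - g * h = [:P ^ j:] * (\<delta> * h + \<epsilon> * g')" .
    have dv: "[:P ^ Suc j:] dvd g' * h' - g * h"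
      using gh Suc.prems by (metis const_poly_dvd_const_poly_iff dvd_trans le_imp_power_dvd)
    have pj: "[:P ^ Suc j:] = [:P ^ j:] * [:P:]" by simp
    have D: "[:P:] dvd \<delta> * h + \<epsilon> * g'"
      using dv nz unfolding eq pj by (simp only: dvd_mult_cancel_left) simp
    have "coeff \<delta> i = 0" if "i \<ge> m" for i
    proof -
      have "P ^ j * coeff \<delta> i = coeff (g' - g) i" unfolding d by simp
      also have "\<dots> = 0" using that g g' by (cases "i = m") auto
      finally show ?thesis using P by auto
    qed
    from cop[OF this D] have d1: "[:P:] dvd \<delta>" .
    then have "[:P:] dvd \<epsilon> * g'" using D dvd_add_right_iff dvd_mult2 by blast
    then have e1: "[:P:] dvd \<epsilon>" using pp ng' prime_elem_dvd_mult_iff by blast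
    show ?case unfolding d e pj by (intro conjI mult_dvd_mono dvd_refl d1 e1)
  qed
  then show ?thesis by auto
qed

text \<open>Modulo P the factor h is a nonzero constant, so \<delta> h has no terms from x^m on,
  whereas \<epsilon> g' has degree m + deg \<epsilon> unless \<epsilon> vanishes. Hence \<epsilon>
  and then \<delta> vanish modulo P.\<close>

lemma coprime_unit_const:
  fixes P :: int
  assumes P: "prime P" and h0: "\<not> P dvd coeff h 0" and h: "\<And>i. i > 0 \<Longrightarrow> P dvd coeff h i"
    and g': "coeff g' m = 1" "\<And>i. i > m \<Longrightarrow> coeff g' i = 0"
    and \<delta>: "\<And>i. i \<ge> m \<Longrightarrow> coeff \<delta> i = 0" and D: "[:P:] dvd \<delta> * h + \<epsilon> * g'"
  shows "[:P:] dvd \<delta>"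
proof -
  have D': "P dvd coeff (\<delta> * h) i + coeff (\<epsilon> * g') i" for i
    using D by (simp add: const_poly_dvd_iff)
  have dh: "P dvd coeff (\<delta> * h) i - coeff \<delta> i * coeff h 0" for i
  proof -
    have "coeff (\<delta> * h) i = coeff \<delta> i * coeff h 0 + (\<Sum>j<i. coeff \<delta> j * coeff h (i - j))"
      by (simp add: coeff_mult lessThan_Suc_atMost[symmetric] add.commute)
    moreover have "P dvd (\<Sum>j<i. coeff \<delta> j * coeff h (i - j))"
      using h by (intro dvd_sum dvd_mult) auto
    ultimately show ?thesis by simp
  qed
  have eps: "P dvd coeff \<epsilon> i" for i
  proof (rule ccontr)
    assume "\<not> P dvd coeff \<epsilon> i"
    define S where "S = {i. \<not> P dvd coeff \<epsilon> i}"
    have "S \<subseteq> {..degree \<epsilon>}" by (auto simp: S_def intro: le_degree)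
    then have fS: "finite S" by (rule finite_subset) auto
    have "S \<noteq> {}" using \<open>\<not> P dvd coeff \<epsilon> i\<close> by (auto simp: S_def)
    \<comment> \<open>\<open>t\<close> is the degree of \<epsilon> modulo P. As g' is monic of
      degree m, the coefficient of \<epsilon> g' at t + m is congruent to that of \<epsilon> at
      t.\<close>
    define t where "t = Max S"
    have tS: "t \<in> S" using fS \<open>S \<noteq> {}\<close> by (simp add: t_def)
    have tmax: "P dvd coeff \<epsilon> j" if "j > t" for j
      using that fS by (metis (mono_tags, lifting) Max_ge S_def mem_Collect_eq not_less t_def)
    have "coeff (\<epsilon> * g') (t + m) = coeff \<epsilon> t * coeff g' m
        + (\<Sum>j\<in>{..t+m}-{t}. coeff \<epsilon> j * coeff g' (t + m - j))"
      by (simp add: coeff_mult sum.remove[of "{..t+m}" t])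
    moreover have "P dvd (\<Sum>j\<in>{..t+m}-{t}. coeff \<epsilon> j * coeff g' (t + m - j))"
    proof (rule dvd_sum)
      fix j assume "j \<in> {..t+m}-{t}"
      then consider "j < t" | "j > t" by fastforce
      then show "P dvd coeff \<epsilon> j * coeff g' (t + m - j)"
        by cases (use g'(2)[of "t + m - j"] tmax in auto)
    qed
    moreover have "P dvd coeff (\<delta> * h) (t + m)"
      using dh[of "t + m"] \<delta>[of "t + m"] by simp
    then have "P dvd coeff (\<epsilon> * g') (t + m)" using D'[of "t + m"] by (simp add: dvd_add_right_iff)
    ultimately have "P dvd coeff \<epsilon> t" using g' by (simp add: dvd_add_left_iff)
    with tS show False by (simp add: S_def)
  qed
  have "P dvd coeff \<delta> i" for i
  proof -
    have "P dvd coeff (\<epsilon> * g') i" unfolding coeff_mult using eps by (intro dvd_sum dvd_mult2) auto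
    then have "P dvd coeff (\<delta> * h) i" using D'[of i] by (simp add: dvd_add_left_iff)
    then have "P dvd coeff \<delta> i * coeff h 0" using dh[of i] by (simp add: dvd_diff_right_iff)
    then show ?thesis using P h0 prime_dvd_mult_iff by blast
  qed
  then show ?thesis by (simp add: const_poly_dvd_iff)
qed

text \<open>Modulo P the product \<epsilon> g' is a multiple of x^m and h has a nonzero constant
  term, so the coefficients of \<delta> below m vanish one after the other, from the lowest
  up.\<close>

lemma coprime_power_X:
  fixes P :: int
  assumes P: "prime P" and h0: "\<not> P dvd coeff h 0"
    and g': "\<And>i. i < m \<Longrightarrow> P dvd coeff g' i"
    and \<delta>: "\<And>i. i \<ge> m \<Longrightarrow> coeff \<delta> i = 0" and D: "[:P:] dvd \<delta> * h + \<epsilon> * g'"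
  shows "[:P:] dvd \<delta>"
proof -
  have "P dvd coeff \<delta> i" for i
  proof (induction i rule: less_induct)
    case (less i)
    show ?case
    proof (cases "i < m")
      case True
      have "P dvd coeff (\<epsilon> * g') i" unfolding coeff_mult using g' True by (intro dvd_sum dvd_mult) auto
      moreover have "P dvd coeff (\<delta> * h) i + coeff (\<epsilon> * g') i"
        using D by (simp add: const_poly_dvd_iff)
      ultimately have 1: "P dvd coeff (\<delta> * h) i" by (simp add: dvd_add_left_iff)
      have "coeff (\<delta> * h) i = coeff \<delta> i * coeff h 0 + (\<Sum>j<i. coeff \<delta> j * coeff h (i - j))"
        by (simp add: coeff_mult lessThan_Suc_atMost[symmetric] add.commute)
      moreover have "P dvd (\<Sum>j<i. coeff \<delta> j * coeff h (i - j))"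
        using less by (intro dvd_sum dvd_mult2) auto
      ultimately have "P dvd coeff \<delta> i * coeff h 0" using 1 by (simp add: dvd_add_left_iff)
      then show ?thesis using P h0 prime_dvd_mult_iff by blast
    qed (use \<delta> in auto)
  qed
  then show ?thesis by (simp add: const_poly_dvd_iff)
qed

section \<open>Factorizations modulo prime powers\<close>

lemma prod_lessThan_add:
  fixes f :: "nat \<Rightarrow> 'a::comm_monoid_mult"
  shows "(\<Prod>i<m + n. f i) = (\<Prod>i<m. f i) * (\<Prod>i<n. f (m + i))"
  by (induction n) (simp_all add: mult.assoc)

text \<open>The base \<open>z\<close> is a real number rather than a formal 1 + u, so that weights
  can be averaged and integrated. In the end it runs through x + 1 for all real x, and polynomials
  in u are compared by their values.\<close>

locale prime_weight =
  fixes p :: nat and z :: real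
  assumes prime_p: "prime p"
begin

abbreviation P :: int where "P \<equiv> int p"

lemma prime_P: "prime P" using prime_p by simp

lemma P_gt_1: "P > 1" using prime_P by (rule prime_gt_1_int)

definition res :: "nat \<Rightarrow> int set" where "res k = {0..<P ^ k}"

definition mults :: "nat \<Rightarrow> nat \<Rightarrow> int set" where "mults e k = {x \<in> res k. P ^ e dvd x}"

definition units :: "nat \<Rightarrow> int set" where "units k = {x \<in> res k. \<not> P dvd x}"

text \<open>\<open>A\<close> selects roots by their reduction modulo p, which allows one residue to
  be split off at a time.\<close>

definition root_classes :: "int set \<Rightarrow> nat \<Rightarrow> nat \<Rightarrow> int poly \<Rightarrow> int set" where
  "root_classes A K k f = {r \<in> res K. r mod P \<in> A \<and> (\<exists>a. a mod P ^ K = r \<and> P ^ k dvd poly f a)}"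

definition wt :: "int set \<Rightarrow> nat \<Rightarrow> nat \<Rightarrow> int poly \<Rightarrow> real" where
  "wt A K k f = z ^ card (root_classes A K k f)"

text \<open>Modulo P^k, b = 0 gives the random monic model and b = 1 the one reducing to
  x^m.\<close>

definition monics :: "nat \<Rightarrow> nat \<Rightarrow> nat \<Rightarrow> int poly set" where
  "monics b m k = polys (\<lambda>i. if i < m then mults b k else if i = m then {1} else {0})"

lemma finite_res [simp]: "finite (res k)" by (simp add: res_def)

lemma finite_mults [simp]: "finite (mults e k)" by (simp add: mults_def)

lemma finite_units [simp]: "finite (units k)" by (simp add: units_def)

lemma zero_in_mults [simp]: "0 \<in> mults e k" using P_gt_1 by (simp add: mults_def res_def)

lemma one_in_units: "k \<ge> 1 \<Longrightarrow> 1 \<in> units k"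
  using P_gt_1 by (auto simp: units_def res_def)

lemma mults_0 [simp]: "mults 0 k = res k" by (simp add: mults_def)

lemma res_split: "res k = mults 1 k \<union> units k" "mults 1 k \<inter> units k = {}"
  by (auto simp: mults_def units_def)

lemma card_res: "card (res k) = p ^ k" by (simp add: res_def nat_power_eq)

text \<open>Modulo P^K the product P^c x depends on x modulo P^(K - c) only, so a fibre is one
  residue class of that modulus inside an interval of length P^K.\<close>

lemma card_fibre:
  assumes "c \<le> K" "y \<in> mults c K"
  shows "card {x \<in> res K. (P ^ c * x) mod P ^ K = y} = p ^ c"
proof -
  define Q where "Q = P ^ (K - c)"
  have Q: "P ^ K = P ^ c * Q" using assms(1) by (simp add: Q_def flip: power_add)
  have Q0: "Q > 0" "P ^ c > 0" using P_gt_1 by (auto simp: Q_def)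
  have mm: "(P ^ c * x) mod P ^ K = P ^ c * (x mod Q)" for x by (simp only: Q mult_mod_right)
  obtain y' where y: "y = P ^ c * y'" using assms(2) by (auto simp: mults_def)
  have y': "0 \<le> y'" "y' < Q" using assms(2) Q0
    by (auto simp: mults_def res_def y Q zero_le_mult_iff)
  have "{x \<in> res K. (P ^ c * x) mod P ^ K = y} = (\<lambda>t. y' + t * Q) ` {0..<P ^ c}"
  proof (intro set_eqI iffI)
    fix x assume x: "x \<in> {x \<in> res K. (P ^ c * x) mod P ^ K = y}"
    then have "P ^ c * (x mod Q) = P ^ c * y'" by (simp only: mem_Collect_eq mm y)
    moreover have "P ^ c \<noteq> 0" using P_gt_1 by simp
    ultimately have "x mod Q = y'" by (rule mult_left_cancel[THEN iffD1, rotated])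
    then have "x = y' + (x div Q) * Q" by (metis mod_mult_div_eq add.commute mult.commute)
    moreover have "x div Q \<ge> 0" using x Q0 by (simp add: res_def pos_imp_zdiv_nonneg_iff)
    moreover have "x div Q < P ^ c"
    proof (rule ccontr)
      assume "\<not> x div Q < P ^ c"
      then have "P ^ c * Q \<le> x div Q * Q" using Q0(1) by (intro mult_right_mono) auto
      also have "\<dots> \<le> x" using Q0(1) div_mult_mod_eq[of x Q] pos_mod_sign[of Q x] by linarith
      finally show False using x unfolding res_def Q by auto
    qed
    ultimately show "x \<in> (\<lambda>t. y' + t * Q) ` {0..<P ^ c}" by (intro image_eqI[of _ _ "x div Q"]) auto
  next
    fix x assume "x \<in> (\<lambda>t. y' + t * Q) ` {0..<P ^ c}"
    then obtain t where t: "x = y' + t * Q" "0 \<le> t" "t < P ^ c" by (elim imageE) auto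
    have "t * Q \<le> (P ^ c - 1) * Q" using t Q0 by (intro mult_right_mono) auto
    then have "x < P ^ K" using y' t by (simp add: Q algebra_simps)
    moreover have "x \<ge> 0" using t y' Q0 by simp
    moreover have "x mod Q = y'" using t y' by simp
    ultimately show "x \<in> {x \<in> res K. (P ^ c * x) mod P ^ K = y}"
      by (simp only: res_def mm y mem_Collect_eq atLeastLessThan_iff)
  qed
  moreover have "inj_on (\<lambda>t. y' + t * Q) {0..<P ^ c}" using Q0 by (auto simp: inj_on_def)
  ultimately show ?thesis by (simp add: card_image nat_power_eq)
qed

lemma card_mults:
  assumes "e \<le> k"
  shows "card (mults e k) = p ^ (k - e)"
proof -
  have "mults e k = (\<lambda>x. P ^ e * x) ` res (k - e)"
  proof (intro set_eqI iffI)
    fix x assume "x \<in> mults e k"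
    then obtain y where y: "x = P ^ e * y" "0 \<le> P ^ e * y" "P ^ e * y < P ^ k"
      by (auto simp: mults_def res_def)
    have "P ^ k = P ^ e * P ^ (k - e)" using assms by (simp flip: power_add)
    moreover have pos: "P ^ e > 0" using P_gt_1 by simp
    ultimately have "0 \<le> y" "y < P ^ (k - e)"
      using y(2) y(3) mult_less_cancel_left_pos[OF pos] by (metis mult_pos_neg not_less, metis)
    then show "x \<in> (\<lambda>x. P ^ e * x) ` res (k - e)" using y by (auto simp: res_def)
  next
    fix x assume "x \<in> (\<lambda>x. P ^ e * x) ` res (k - e)"
    then obtain y where y: "x = P ^ e * y" "0 \<le> y" "y < P ^ (k - e)" by (elim imageE) (auto simp: res_def)
    have "P ^ k = P ^ e * P ^ (k - e)" using assms by (simp flip: power_add)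
    then show "x \<in> mults e k" using y P_gt_1 by (auto simp: mults_def res_def)
  qed
  moreover have "inj_on (\<lambda>x. P ^ e * x) (res (k - e))" using P_gt_1 by (auto simp: inj_on_def)
  ultimately show ?thesis by (simp add: card_image card_res)
qed

lemma card_units:
  assumes "k \<ge> 1"
  shows "real (card (units k)) = real p ^ k * (1 - 1 / real p)"
proof -
  have "card (res k) = card (mults 1 k) + card (units k)"
    using res_split[of k] by (metis card_Un_disjoint finite_mults finite_units)
  then have "real (card (units k)) = real p ^ k - real p ^ (k - 1)"
    using card_mults[OF assms] by (simp add: card_res flip: of_nat_power)
  moreover have "real p ^ k = real p * real p ^ (k - 1)" using assms by (cases k) auto
  moreover have "p > 0" using prime_p by (simp add: prime_gt_0_nat)
  ultimately show ?thesis by (simp add: right_diff_distrib)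
qed

lemma root_classes_subset: "root_classes A K k f \<subseteq> res K" by (auto simp: root_classes_def)

lemma finite_root_classes [simp]: "finite (root_classes A K k f)"
  by (rule finite_subset[OF root_classes_subset finite_res])

lemma poly_dvd_cong:
  assumes "\<And>i. m dvd coeff f i - coeff g i"
  shows "(m::int) dvd poly f a - poly g a"
proof -
  have "m dvd (\<Sum>i\<le>degree (f - g). coeff (f - g) i * a ^ i)"
    using assms by (intro dvd_sum dvd_mult2) simp
  then show ?thesis by (simp add: poly_altdef[of "f - g"] flip: poly_diff)
qed

lemma root_classes_cong:
  assumes "\<And>i. P ^ k dvd coeff f i - coeff g i"
  shows "root_classes A K k f = root_classes A K k g"
proof -
  have "P ^ k dvd poly f a \<longleftrightarrow> P ^ k dvd poly g a" for a
    using poly_dvd_cong[OF assms, of a] by (metis dvd_diff_commute dvd_diff_left_iff dvd_diff_right_iff)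
  then show ?thesis by (simp add: root_classes_def)
qed

lemma dvd_diff_redq: "m dvd coeff (redq m f) i - coeff f i"
  by (simp add: coeff_redq) (metis dvd_minus_mod dvd_diff_commute)

lemma wt_redq: "wt A K k (redq (P ^ k) f) = wt A K k f"
  unfolding wt_def by (subst root_classes_cong[OF dvd_diff_redq]) simp

text \<open>At arguments reducing into A the factor h has values prime to P, which do not affect
  divisibility by P^k. With K >= 1 a class modulo P^K determines the residue modulo P.\<close>

lemma root_classes_mult:
  assumes "K \<ge> 1" and "\<And>a. a mod P \<in> A \<Longrightarrow> \<not> P dvd poly h a"
  shows "root_classes A K k (g * h) = root_classes A K k g"
proof -
  have "P ^ k dvd poly (g * h) a \<longleftrightarrow> P ^ k dvd poly g a" if "(a mod P ^ K) mod P \<in> A" for a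
  proof -
    have "a mod P \<in> A" using that assms(1) by (metis dvd_power less_le_trans mod_mod_cancel zero_less_one)
    then have "coprime (P ^ k) (poly h a)"
      using assms(2) prime_P prime_imp_coprime by (intro coprime_power_left_iff[THEN iffD2]) blast
    then show ?thesis by (simp add: coprime_dvd_mult_left_iff)
  qed
  then show ?thesis unfolding root_classes_def by blast
qed

lemma card_root_classes_Un:
  assumes "A \<inter> B = {}"
  shows "card (root_classes (A \<union> B) K k f) = card (root_classes A K k f) + card (root_classes B K k f)"
proof -
  have "root_classes (A \<union> B) K k f = root_classes A K k f \<union> root_classes B K k f"
    by (auto simp: root_classes_def)
  moreover have "root_classes A K k f \<inter> root_classes B K k f = {}"
    using assms by (auto simp: root_classes_def)
  ultimately show ?thesis by (simp add: card_Un_disjoint)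
qed

text \<open>Multiplication followed by reduction is a bijection from the pairs (g, h) onto the box
  on the left, so the mean of a multiplicative \<psi> is a product. Coefficient m + j of g h is
  \<open>coeff h j\<close> plus products of lower coefficients of g with coefficients of h of index
  above j. The monotone e bounds the valuations of the latter from below, so these products are
  multiples of P^(b + e (j + 1)), and \<open>closed\<close> keeps the sum in D j. The condition b +
  e j >= 1 for j >= 1 says that modulo P either g is x^m or h is constant: the two coprime
  situations treated above.\<close>

lemma mean_factor:
  assumes k: "k \<ge> 1"
    and D: "\<And>j. D j \<subseteq> res k" "\<And>j. j > L \<Longrightarrow> D j = {0}" "D 0 \<subseteq> units k"
    and e: "\<And>j x. x \<in> D j \<Longrightarrow> P ^ e j dvd x" "mono e" "\<And>j. j \<ge> 1 \<Longrightarrow> b + e j \<ge> 1"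
    and closed: "\<And>j x y. j < L \<Longrightarrow> x \<in> D j \<Longrightarrow> P ^ (b + e (Suc j)) dvd y \<Longrightarrow> (x + y) mod P ^ k \<in> D j"
    and b: "b \<le> 1"
    and \<psi>: "\<And>f. \<psi> (redq (P ^ k) f) = \<psi> f"
    and \<psi>12: "\<And>g h. g \<in> monics b m k \<Longrightarrow> h \<in> polys D \<Longrightarrow> \<psi> (g * h) = \<psi>1 g * \<psi>2 h"
  shows "mean (polys (\<lambda>i. if i < m then mults b k else D (i - m))) \<psi>
    = mean (monics b m k) \<psi>1 * mean (polys D) \<psi>2"
proof -
  define q where "q = P ^ k"
  have q1: "q > 1" using k P_gt_1 unfolding q_def by (metis one_less_power less_le_trans zero_less_one)
  define CG where "CG i = (if i < m then mults b k else if i = m then {1} else {0})" for i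
  define CF where "CF i = (if i < m then mults b k else D (i - m))" for i
  define G where "G = polys CG"
  define H where "H = polys D"
  define F where "F = polys CF"
  have G_eq: "monics b m k = G" by (simp add: G_def CG_def[abs_def] monics_def)
  define \<mu> where "\<mu> = (\<lambda>(g, h). redq q (g * h))"
  have finD: "finite (D j)" for j by (rule finite_subset[OF D(1) finite_res])
  have finG: "finite G" unfolding G_def by (rule finite_polys[of "Suc m"]) (auto simp: CG_def)
  have finH: "finite H" unfolding H_def by (rule finite_polys[of "Suc L"]) (use D(2) finD in auto)
  have finF: "finite F" unfolding F_def
    by (rule finite_polys[of "m + Suc L"]) (use D(2) finD in \<open>auto simp: CF_def\<close>)
  have g: "coeff g m = 1" "\<And>i. i > m \<Longrightarrow> coeff g i = 0" "\<And>i. i < m \<Longrightarrow> P ^ b dvd coeff g i" if "g \<in> G" for g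
  proof -
    have c: "coeff g i \<in> CG i" for i using that by (simp add: G_def polys_def)
    show "coeff g m = 1" using c[of m] by (simp add: CG_def)
    show "coeff g i = 0" if "i > m" for i using c[of i] that by (simp add: CG_def)
    show "P ^ b dvd coeff g i" if "i < m" for i using c[of i] that by (simp add: CG_def mults_def)
  qed
  have h: "coeff h j \<in> D j" if "h \<in> H" for h j using that by (simp add: H_def polys_def)
  have h_dvd: "P ^ e j dvd coeff h j" if "h \<in> H" for h j using e(1) h[OF that] by blast
  have "card F = card G * card H"
  proof -
    have "card F = (\<Prod>i<m + Suc L. card (CF i))"
      unfolding F_def by (rule card_polys) (use D(2) in \<open>auto simp: CF_def\<close>)
    also have "\<dots> = (\<Prod>i<m. card (CF i)) * (\<Prod>i<Suc L. card (CF (m + i)))"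
      by (rule prod_lessThan_add)
    finally have F: "card F = (\<Prod>i<m. card (mults b k)) * (\<Prod>i<Suc L. card (D i))" by (simp add: CF_def)
    have "card G = (\<Prod>i<Suc m. card (CG i))"
      unfolding G_def by (rule card_polys) (auto simp: CG_def)
    then have G: "card G = (\<Prod>i<m. card (mults b k))" by (simp add: CG_def)
    have "card H = (\<Prod>i<Suc L. card (D i))"
      unfolding H_def by (rule card_polys) (use D(2) in auto)
    then show ?thesis using F G by simp
  qed
  have maps: "\<mu> ` (G \<times> H) \<subseteq> F"
  proof clarify
    fix g h assume gG: "g \<in> G" and hH: "h \<in> H"
    have "coeff (g * h) i mod q \<in> CF i" for i
    proof (cases "i < m")
      case True
      have "P ^ b dvd coeff (g * h) i"
        unfolding coeff_mult using g(3)[OF gG] True by (intro dvd_sum dvd_mult2) auto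
      moreover have "P ^ b dvd q" using b k by (simp add: q_def le_imp_power_dvd)
      moreover have "coeff (g * h) i mod q \<in> res k"
        using q1 by (auto simp: res_def q_def[symmetric])
      ultimately show ?thesis using True by (simp add: CF_def mults_def q_def dvd_mod_iff)
    next
      case False
      then obtain j where i: "i = m + j" using le_Suc_ex not_less by blast
      define y where "y = (\<Sum>t\<in>{..m+j}-{m}. coeff g t * coeff h (m + j - t))"
      have split: "coeff (g * h) i = coeff h j + y"
        using g(1)[OF gG] by (simp add: i y_def coeff_mult sum.remove[of "{..m+j}" m])
      have y: "P ^ (b + e (Suc j)) dvd y" unfolding y_def
      proof (rule dvd_sum)
        fix t assume "t \<in> {..m+j}-{m}"
        then consider "t < m" | "t > m" by fastforce
        then show "P ^ (b + e (Suc j)) dvd coeff g t * coeff h (m + j - t)"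
        proof cases
          case 1
          then have "e (Suc j) \<le> e (m + j - t)" using e(2) by (intro monoD[OF e(2)]) auto
          then have "P ^ e (Suc j) dvd coeff h (m + j - t)"
            using h_dvd[OF hH] by (meson dvd_trans le_imp_power_dvd)
          then show ?thesis using g(3)[OF gG 1] by (simp add: power_add mult_dvd_mono)
        qed (use g(2)[OF gG] in auto)
      qed
      have "coeff (g * h) i mod q \<in> D j"
      proof (cases "j < L")
        case True
        then show ?thesis using closed[OF True h[OF hH] y] by (simp add: split q_def)
      next
        case False
        \<comment> \<open>From the top index L of h on, nothing is added to
          \<open>coeff h j\<close>; this is why \<open>closed\<close> speaks of j < L.\<close>
        have "coeff g t * coeff h (m + j - t) = 0" if "t \<in> {..m+j}-{m}" for t
        proof (cases "t < m")
          case True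
          then have "m + j - t > L" using False by auto
          then have "coeff h (m + j - t) = 0" using h[OF hH, of "m + j - t"] D(2) by auto
          then show ?thesis by simp
        next
          case False
          then show ?thesis using that g(2)[OF gG, of t] by auto
        qed
        then have "y = 0" unfolding y_def by (intro sum.neutral) blast
        moreover have "coeff h j mod q = coeff h j"
          using h[OF hH, of j] D(1)[of j] by (force simp: res_def q_def)
        ultimately show ?thesis using h[OF hH, of j] by (simp add: split)
      qed
      then show ?thesis by (simp add: CF_def i)
    qed
    then show "\<mu> (g, h) \<in> F" by (simp add: F_def polys_def coeff_redq \<mu>_def)
  qed
  have inj: "inj_on \<mu> (G \<times> H)"
  proof (rule inj_onI, clarify)
    fix g h g' h' assume gG: "g \<in> G" and hH: "h \<in> H" and g'G: "g' \<in> G" and h'H: "h' \<in> H"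
      and eq: "\<mu> (g, h) = \<mu> (g', h')"
    have "q dvd coeff (g' * h' - g * h) i" for i
    proof -
      have "coeff (g' * h') i mod q = coeff (g * h) i mod q"
        using arg_cong[OF eq, of "\<lambda>f. coeff f i"] by (simp add: \<mu>_def coeff_redq)
      then show ?thesis by (simp add: mod_eq_dvd_iff)
    qed
    then have dv: "[:P ^ k:] dvd g' * h' - g * h" by (simp add: const_poly_dvd_iff q_def)
    have h0: "\<not> P dvd coeff h 0" using h[OF hH, of 0] D(3) by (auto simp: units_def)
    have "[:P ^ k:] dvd g' - g \<and> [:P ^ k:] dvd h' - h"
    proof (rule hensel_unique[OF prime_P g(1,2)[OF gG] g(1,2)[OF g'G] dv])
      fix \<delta> \<epsilon> assume *: "\<And>i. i \<ge> m \<Longrightarrow> coeff \<delta> i = 0" "[:P:] dvd \<delta> * h + \<epsilon> * g'"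
      show "[:P:] dvd \<delta>"
      \<comment> \<open>For b = 0 the factor h reduces to a unit constant, for b = 1 the factor g'
        reduces to x^m.\<close>
      proof (cases "b = 0")
        case True
        have "P dvd coeff h i" if "i > 0" for i
        proof -
          have "e i \<ge> 1" using e(3)[of i] that True by simp
          then show ?thesis using h_dvd[OF hH, of i] by (metis dvd_power_le dvd_refl dvd_trans le_imp_power_dvd power_one_right)
        qed
        then show ?thesis using coprime_unit_const[OF prime_P h0 _ g(1,2)[OF g'G] *] by blast
      next
        case False
        then have "b = 1" using b by simp
        then show ?thesis using coprime_power_X[OF prime_P h0, of m g' \<delta> \<epsilon>] * g(3)[OF g'G] by simp
      qed
    qed
    then have c: "q dvd coeff g' i - coeff g i" "q dvd coeff h' i - coeff h i" for i
      by (auto simp: const_poly_dvd_iff q_def)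
    have small: "x = y" if "q dvd x - y" "x \<in> res k" "y \<in> res k" for x y
      using that by (auto simp: res_def q_def mod_eq_dvd_iff[symmetric])
    have gres: "coeff g i \<in> res k" if "g \<in> G" for g i
    proof -
      have "coeff g i \<in> CG i" using that by (simp add: G_def polys_def)
      then show ?thesis using q1 P_gt_1 by (auto simp: CG_def mults_def res_def q_def split: if_splits)
    qed
    have "coeff g' i = coeff g i" "coeff h' i = coeff h i" for i
      using small[OF c(1)] small[OF c(2)] gres[OF gG] gres[OF g'G] h[OF hH] h[OF h'H] D(1) by blast+
    then show "g = g' \<and> h = h'" by (auto intro: poly_eqI)
  qed
  have im: "\<mu> ` (G \<times> H) = F"
    using maps finF \<open>card F = card G * card H\<close> card_image[OF inj]
    by (intro card_subset_eq) (auto simp: card_cartesian_product)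
  have "mean F \<psi> = mean (G \<times> H) (\<lambda>x. \<psi> (\<mu> x))" using mean_image[OF inj im] by simp
  also have "\<dots> = mean (G \<times> H) (\<lambda>(g, h). \<psi>1 g * \<psi>2 h)"
    using \<psi> \<psi>12 by (intro mean_cong) (auto simp: \<mu>_def q_def G_eq H_def)
  also have "\<dots> = mean G \<psi>1 * mean H \<psi>2"
    by (simp add: mean_def card_cartesian_product sum_product sum.cartesian_product)
  finally show ?thesis by (simp add: F_def CF_def[abs_def] G_eq H_def)
qed

end

section \<open>Monic polynomials\<close>

text \<open>This is x^n f(1/x) for the nominal degree n. \<open>reflect_poly\<close> refers to the
  actual degree, which varies with the coefficients of a random polynomial.\<close>

definition rev_at :: "nat \<Rightarrow> int poly \<Rightarrow> int poly" where
  "rev_at n f = poly_upto (Suc n) (\<lambda>i. coeff f (n - i))"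

lemma coeff_rev_at: "coeff (rev_at n f) i = (if i \<le> n then coeff f (n - i) else 0)"
  by (simp add: rev_at_def coeff_poly_upto less_Suc_eq_le)

lemma rev_at_eq_reflect_poly:
  assumes "degree f \<le> n"
  shows "rev_at n f = monom 1 (n - degree f) * reflect_poly f"
proof (rule poly_eqI)
  fix i
  show "coeff (rev_at n f) i = coeff (monom 1 (n - degree f) * reflect_poly f) i"
    using assms by (auto simp: coeff_rev_at coeff_monom_mult coeff_reflect_poly coeff_eq_0
        intro!: arg_cong[of _ _ "coeff f"])
qed

lemma rev_at_mult:
  assumes "degree g \<le> s" "degree h \<le> t"
  shows "rev_at (s + t) (g * h) = rev_at s g * rev_at t h"
proof (cases "g = 0 \<or> h = 0")
  case True
  have "rev_at m 0 = 0" for m by (simp add: poly_eq_iff coeff_rev_at)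
  then show ?thesis using True by auto
next
  case False
  then have d: "degree (g * h) = degree g + degree h" by (simp add: degree_mult_eq)
  have "s + t - (degree g + degree h) = (s - degree g) + (t - degree h)" using assms by simp
  then have "monom (1::int) (s + t - (degree g + degree h)) = monom 1 (s - degree g) * monom 1 (t - degree h)"
    by (simp add: mult_monom)
  then show ?thesis using assms by (simp add: rev_at_eq_reflect_poly d reflect_poly_mult)
qed

lemma rev_at_rev_at:
  assumes "degree f \<le> n"
  shows "rev_at n (rev_at n f) = f"
  using assms by (auto simp: poly_eq_iff coeff_rev_at coeff_eq_0)

lemma poly_dvd_coeff_0:
  fixes h :: "int poly"
  assumes "c dvd a"
  shows "c dvd poly h a - coeff h 0"
  using assms by (cases h) auto

context prime_weight
begin

definition monic_mean :: "int set \<Rightarrow> nat \<Rightarrow> nat \<Rightarrow> nat \<Rightarrow> real" where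
  "monic_mean A n K k = mean (monics 0 n k) (wt A K k)"

text \<open>Roots of a polynomial reducing to x^n reduce to 0, so the residue 0 carries them
  all.\<close>

definition eis_mean :: "nat \<Rightarrow> nat \<Rightarrow> nat \<Rightarrow> real" where
  "eis_mean n K k = mean (monics 1 n k) (wt {0} K k)"

lemma p_pos: "p > 0" using prime_p by (simp add: prime_gt_0_nat)

lemma res_nonempty [simp]: "res k \<noteq> {}" using P_gt_1 by (auto simp: res_def)

lemma mults_nonempty [simp]: "mults e k \<noteq> {}" using zero_in_mults by blast

lemma units_nonempty: "k \<ge> 1 \<Longrightarrow> units k \<noteq> {}" using one_in_units by blast

lemma mod_in_res: "x mod P ^ k \<in> res k" using P_gt_1 by (simp add: res_def)

lemma units_closed:
  assumes "k \<ge> 1" "x \<in> units k" "P dvd y"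
  shows "(x + y) mod P ^ k \<in> units k"
proof -
  have "P dvd P ^ k" using assms(1) by simp
  then have "P dvd (x + y) mod P ^ k \<longleftrightarrow> P dvd x" using assms(3) by (simp add: dvd_mod_iff dvd_add_left_iff)
  then show ?thesis using assms mod_in_res by (simp add: units_def)
qed

lemma mults_closed:
  assumes "e \<le> k" "x \<in> mults e k" "P ^ e dvd y"
  shows "(x + y) mod P ^ k \<in> mults e k"
proof -
  have "P ^ e dvd P ^ k" using assms(1) by (simp add: le_imp_power_dvd)
  then show ?thesis using assms mod_in_res by (simp add: mults_def dvd_mod_iff)
qed

lemma mean_split_res:
  assumes "k \<ge> 1" and C0: "\<And>i. i \<ge> n \<Longrightarrow> C i = {0}" and fC: "\<And>i. finite (C i)" and ne: "\<And>i. C i \<noteq> {}"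
    and s: "s < n" "C s = res k"
  shows "mean (polys C) \<psi> = 1 / p * mean (polys (C(s := mults 1 k))) \<psi>
      + (1 - 1 / p) * mean (polys (C(s := units k))) \<psi>"
proof -
  have "real p ^ k = real p * real p ^ (k - 1)" using assms(1) by (cases k) auto
  then have "real (card (mults 1 k)) / card (C s) = 1 / p" using assms(1) p_pos
    by (simp add: card_mults card_res s del: One_nat_def)
  moreover have "real (card (units k)) / card (C s) = 1 - 1 / p"
    using card_units[OF assms(1)] p_pos by (simp add: card_res s)
  ultimately show ?thesis
    using mean_split_coord[OF C0 fC ne s(1), where D = "mults 1 k" and E = "units k"] res_split[of k] s(2) by simp
qed

text \<open>The cofactors left once the exact power of x in the reduction has been split
  off.\<close>

definition unit_monics :: "nat \<Rightarrow> nat \<Rightarrow> int poly set" where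
  "unit_monics j k = polys (\<lambda>i. if i < j then (if i = 0 then units k else res k) else if i = j then {1} else {0})"

lemma monics_mod:
  assumes "g \<in> monics 1 m k"
  shows "P dvd poly g a - a ^ m"
proof -
  have c: "coeff g i \<in> (if i < m then mults 1 k else if i = m then {1} else {0})" for i
    using assms unfolding monics_def polys_def by blast
  have "P dvd coeff g i - coeff (monom 1 m) i" for i
    using c[of i] by (auto simp: mults_def split: if_splits)
  then have "P dvd poly g a - poly (monom 1 m) a" by (rule poly_dvd_cong)
  then show ?thesis by (simp add: poly_monom)
qed

lemma prime_dvd_mod_cong: "P dvd x - y \<Longrightarrow> P dvd x \<longleftrightarrow> P dvd y"
  by (metis dvd_diff_left_iff dvd_diff_right_iff)

lemma monics_unit_outside_0:
  assumes "g \<in> monics 1 m k" "A \<subseteq> {0<..<P}" "a mod P \<in> A"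
  shows "\<not> P dvd poly g a"
proof -
  have "\<not> P dvd a" using assms by (auto simp: dvd_eq_mod_eq_0)
  then have "\<not> P dvd a ^ m" using prime_P prime_dvd_power by blast
  then show ?thesis using prime_dvd_mod_cong[OF monics_mod[OF assms(1)]] by blast
qed

lemma unit_at_0:
  assumes "\<not> P dvd coeff h 0" "a mod P \<in> {0}"
  shows "\<not> P dvd poly h a"
proof -
  have "P dvd a" using assms(2) by auto
  then show ?thesis using prime_dvd_mod_cong[OF poly_dvd_coeff_0] assms(1) by blast
qed

lemma unit_monics_coeff_0:
  assumes "h \<in> unit_monics j k" "k \<ge> 1"
  shows "\<not> P dvd coeff h 0"
proof -
  have "coeff h 0 \<in> (if 0 < j then units k else {1})"
    using assms(1) by (auto simp: unit_monics_def polys_def dest: spec[of _ 0] split: if_splits)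
  then show ?thesis using one_in_units[OF assms(2)] by (auto simp: units_def split: if_splits)
qed

text \<open>The box on the left holds the monic polynomials whose reduction has order exactly m at
  0. They factor as g h with g reducing to x^m and h a unit at 0. This is \<open>mean_factor\<close>
  with b = 1, where g supplies the divisibility and e is 0.\<close>

lemma mean_order:
  assumes k: "k \<ge> 1" and m: "m \<le> n"
    and \<psi>: "\<And>f. \<psi> (redq (P ^ k) f) = \<psi> f"
    and \<psi>12: "\<And>g h. g \<in> monics 1 m k \<Longrightarrow> h \<in> unit_monics (n - m) k \<Longrightarrow> \<psi> (g * h) = \<psi>1 g * \<psi>2 h"
  shows "mean (polys (\<lambda>i. if i < m then mults 1 k else if i < n then (if i = m then units k else res k)
      else if i = n then {1} else {0})) \<psi> = mean (monics 1 m k) \<psi>1 * mean (unit_monics (n - m) k) \<psi>2"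
proof -
  define D where "D j = (if j < n - m then (if j = 0 then units k else res k) else if j = n - m then {1} else {0})" for j
  have H: "unit_monics (n - m) k = polys D" by (simp add: unit_monics_def D_def[abs_def])
  have "mean (polys (\<lambda>i. if i < m then mults 1 k else D (i - m))) \<psi>
      = mean (monics 1 m k) \<psi>1 * mean (polys D) \<psi>2"
  proof (rule mean_factor[where L = "n - m" and e = "\<lambda>_. 0"])
    show "D j \<subseteq> res k" for j using one_in_units[OF k] P_gt_1 by (auto simp: D_def units_def res_def)
    show "D 0 \<subseteq> units k" using one_in_units[OF k] by (auto simp: D_def)
    show "(x + y) mod P ^ k \<in> D j" if "j < n - m" "x \<in> D j" "P ^ (1 + 0) dvd y" for j x y
      using that units_closed[OF k] mod_in_res by (auto simp: D_def)
    show "\<psi> (g * h) = \<psi>1 g * \<psi>2 h" if "g \<in> monics 1 m k" "h \<in> polys D" for g h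
      using \<psi>12 that by (simp add: H)
  qed (use k \<psi> in \<open>auto simp: D_def mono_def\<close>)
  moreover have "(\<lambda>i. if i < m then mults 1 k else if i < n then (if i = m then units k else res k)
      else if i = n then {1} else {0}) = (\<lambda>i. if i < m then mults 1 k else D (i - m))"
    using m by (auto simp: D_def fun_eq_iff)
  ultimately show ?thesis by (simp add: H)
qed

lemma finite_monics [simp]: "finite (monics b n k)"
  unfolding monics_def by (rule finite_polys[of "Suc n"]) auto

lemma monics_nonempty [simp]: "monics b n k \<noteq> {}"
  unfolding monics_def by (rule polys_nonempty[of "Suc n"]) auto

text \<open>The coefficients are tested for divisibility by P from the constant one upwards, and the
  first unit among them gives the order m. For m = n the leading 1 ends the test, hence no factor 1
  - 1/p.\<close>

lemma mean_monics_order_split: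
  assumes k: "k \<ge> 1"
    and \<psi>: "\<And>f. \<psi> (redq (P ^ k) f) = \<psi> f"
    and \<psi>12: "\<And>m g h. g \<in> monics 1 m k \<Longrightarrow> h \<in> unit_monics (n - m) k \<Longrightarrow> \<psi> (g * h) = \<psi>1 m g * \<psi>2 h"
  shows "mean (monics 0 n k) \<psi> = (\<Sum>m\<le>n. (1 / p) ^ m * (if m < n then 1 - 1 / p else 1) *
      (mean (monics 1 m k) (\<psi>1 m) * mean (unit_monics (n - m) k) \<psi>2))"
proof -
  define X where "X t = polys (\<lambda>i. if i < t then mults 1 k else if i < n then res k
      else if i = n then {1} else {0})" for t
  define Y where "Y m = mean (monics 1 m k) (\<psi>1 m) * mean (unit_monics (n - m) k) \<psi>2" for m
  have "mean (X 0) \<psi> = (1 / p) ^ t * mean (X t) \<psi> + (\<Sum>m<t. (1 / p) ^ m * (1 - 1 / p) * Y m)"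
    if "t \<le> n" for t using that
  proof (induction t)
    case (Suc t)
    define C where "C i = (if i < t then mults 1 k else if i < n then res k
      else if i = n then {1} else {0})" for i
    have 1: "C(t := mults 1 k) = (\<lambda>i. if i < Suc t then mults 1 k else if i < n then res k
      else if i = n then {1} else {0})" using Suc.prems by (auto simp: C_def fun_eq_iff)
    have 2: "C(t := units k) = (\<lambda>i. if i < t then mults 1 k else if i < n then (if i = t then units k else res k)
      else if i = n then {1} else {0})" using Suc.prems by (auto simp: C_def fun_eq_iff)
    have "mean (polys C) \<psi> = 1 / p * mean (polys (C(t := mults 1 k))) \<psi>
      + (1 - 1 / p) * mean (polys (C(t := units k))) \<psi>"
      by (rule mean_split_res[of _ "Suc n"]) (use k Suc.prems in \<open>auto simp: C_def\<close>)
    moreover have "mean (polys (C(t := units k))) \<psi> = Y t"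
      unfolding 2 Y_def by (rule mean_order) (use k Suc.prems \<psi> \<psi>12 in auto)
    moreover have "polys C = X t" by (simp add: X_def C_def[abs_def])
    moreover have "polys (C(t := mults 1 k)) = X (Suc t)" unfolding 1 X_def by simp
    ultimately have "mean (X t) \<psi> = 1 / p * mean (X (Suc t)) \<psi> + (1 - 1 / p) * Y t" by simp
    then have "mean (X 0) \<psi> = (1 / p) ^ t * (1 / p * mean (X (Suc t)) \<psi> + (1 - 1 / p) * Y t)
      + (\<Sum>m<t. (1 / p) ^ m * (1 - 1 / p) * Y m)" using Suc.IH Suc.prems by simp
    then show ?case by (simp add: distrib_left mult_ac)
  qed simp
  from this[of n] have "mean (X 0) \<psi> = (1 / p) ^ n * mean (X n) \<psi> + (\<Sum>m<n. (1 / p) ^ m * (1 - 1 / p) * Y m)"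
    by simp
  moreover have "X 0 = monics 0 n k" unfolding X_def monics_def mults_0 by simp
  moreover have "mean (X n) \<psi> = Y n"
  proof -
    have "(\<lambda>i. if i < n then mults 1 k else if i < n then res k else if i = n then {1} else {0})
      = (\<lambda>i. if i < n then mults 1 k else if i < n then (if i = n then units k else res k) else if i = n then {1} else {0})"
      by (auto simp: fun_eq_iff)
    then show ?thesis using mean_order[OF k order.refl, of \<psi> n "\<psi>1 n" \<psi>2] \<psi> \<psi>12 by (simp add: X_def Y_def)
  qed
  ultimately show ?thesis
    by (simp only: lessThan_Suc_atMost[symmetric] Y_def[symmetric] sum.lessThan_Suc)
      (simp cong: sum.cong_simp)
qed

text \<open>The factor g reducing to x^m has no roots over A, and its cofactor has none over 0. So
  the residue 0 contributes \<open>eis_mean m\<close> if it is counted and 1 if it is not, while the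
  same \<gamma> describes the cofactor in both cases.\<close>

lemma p_monic_mean_order:
  assumes k: "k \<ge> 1" and K: "K \<ge> 1" and A: "A \<subseteq> {0<..<P}"
  defines "\<gamma> \<equiv> \<lambda>j. real p ^ j * (if j > 0 then 1 - 1 / p else 1) * mean (unit_monics j k) (wt A K k)"
  shows "real p ^ n * monic_mean A n K k = (\<Sum>m\<le>n. \<gamma> (n - m))"
    and "real p ^ n * monic_mean (insert 0 A) n K k = (\<Sum>m\<le>n. eis_mean m K k * \<gamma> (n - m))"
proof -
  have pw: "real p ^ n * ((1 / p) ^ m * c * d) = real p ^ (n - m) * c * d" if "m \<le> n" for m c d
    using that p_pos by (simp add: power_diff power_divide field_simps)
  have A_g: "root_classes A K k (g * h) = root_classes A K k h"
    if "g \<in> monics 1 m k" for g h m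
    using root_classes_mult[OF K, where A = A and g = h and h = g] monics_unit_outside_0[OF that A] by (simp add: mult.commute)
  have 0: "root_classes {0} K k (g * h) = root_classes {0} K k g" if "h \<in> unit_monics j k" for g h j
    by (rule root_classes_mult[OF K]) (rule unit_at_0[OF unit_monics_coeff_0[OF that k]])
  have "monic_mean A n K k = (\<Sum>m\<le>n. (1 / p) ^ m * (if m < n then 1 - 1 / p else 1) *
      (mean (monics 1 m k) (\<lambda>_. 1) * mean (unit_monics (n - m) k) (wt A K k)))"
    unfolding monic_mean_def
    by (rule mean_monics_order_split[OF k]) (rule wt_redq, simp add: wt_def A_g)
  then show "real p ^ n * monic_mean A n K k = (\<Sum>m\<le>n. \<gamma> (n - m))"
    unfolding \<gamma>_def
    by (simp only: mean_one finite_monics monics_nonempty not_False_eq_True mult_1_left sum_distrib_left)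
      (intro sum.cong refl, subst pw, auto)
  have "monic_mean (insert 0 A) n K k = (\<Sum>m\<le>n. (1 / p) ^ m * (if m < n then 1 - 1 / p else 1) *
      (mean (monics 1 m k) (wt {0} K k) * mean (unit_monics (n - m) k) (wt A K k)))"
    unfolding monic_mean_def
  proof (rule mean_monics_order_split[OF k])
    show "wt (insert 0 A) K k (redq (P ^ k) f) = wt (insert 0 A) K k f" for f by (rule wt_redq)
    fix m g h assume g: "g \<in> monics 1 m k" and h: "h \<in> unit_monics (n - m) k"
    have "{0} \<inter> A = {}" using A by auto
    from card_root_classes_Un[OF this] show "wt (insert 0 A) K k (g * h) = wt {0} K k g * wt A K k h"
      by (simp add: wt_def 0[OF h] A_g[OF g] power_add)
  qed
  then show "real p ^ n * monic_mean (insert 0 A) n K k = (\<Sum>m\<le>n. eis_mean m K k * \<gamma> (n - m))"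
    unfolding \<gamma>_def eis_mean_def[symmetric]
    by (simp only: sum_distrib_left) (intro sum.cong refl, subst pw, auto)
qed

section \<open>Translation of the variable\<close>

lemma card_root_classes_shift_le:
  assumes K: "K \<ge> 1"
  shows "card (root_classes A K k (pcompose f [:c, 1:])) \<le> card (root_classes ((\<lambda>x. (x + c) mod P) ` A) K k f)"
proof (rule card_inj_on_le[where f = "\<lambda>r. (r + c) mod P ^ K"])
  have PK: "P dvd P ^ K" using K by simp
  show "inj_on (\<lambda>r. (r + c) mod P ^ K) (root_classes A K k (pcompose f [:c, 1:]))"
  proof (rule inj_onI)
    fix r s assume "r \<in> root_classes A K k (pcompose f [:c, 1:])" "s \<in> root_classes A K k (pcompose f [:c, 1:])"
      and eq: "(r + c) mod P ^ K = (s + c) mod P ^ K"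
    then have "r \<in> res K" "s \<in> res K" by (auto simp: root_classes_def)
    moreover have "r mod P ^ K = s mod P ^ K" using eq by (simp add: mod_eq_dvd_iff)
    ultimately show "r = s" by (simp add: res_def)
  qed
  show "(\<lambda>r. (r + c) mod P ^ K) ` root_classes A K k (pcompose f [:c, 1:])
    \<subseteq> root_classes ((\<lambda>x. (x + c) mod P) ` A) K k f"
  proof clarify
    fix r assume "r \<in> root_classes A K k (pcompose f [:c, 1:])"
    then obtain a where a: "r mod P \<in> A" "a mod P ^ K = r" "P ^ k dvd poly (pcompose f [:c, 1:]) a"
      by (auto simp: root_classes_def)
    have "(r + c) mod P ^ K mod P = (r mod P + c) mod P" using PK by (simp add: mod_mod_cancel mod_add_left_eq)
    moreover have "P ^ k dvd poly f (a + c)" using a(3) by (simp add: poly_pcompose add.commute)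
    moreover have "(a + c) mod P ^ K = (r + c) mod P ^ K" using a(2) by (metis mod_add_left_eq)
    ultimately show "(r + c) mod P ^ K \<in> root_classes ((\<lambda>x. (x + c) mod P) ` A) K k f"
      using a(1) mod_in_res unfolding root_classes_def by blast
  qed
qed simp

text \<open>Translations by c and by - c both inject classes into classes and undo each other, so
  the inequality holds in both directions.\<close>

lemma card_root_classes_shift:
  assumes K: "K \<ge> 1" and A: "A \<subseteq> {0..<P}"
  shows "card (root_classes A K k (pcompose f [:c, 1:])) = card (root_classes ((\<lambda>x. (x + c) mod P) ` A) K k f)"
proof (rule antisym[OF card_root_classes_shift_le[OF K]])
  have "(\<lambda>x. (x + - c) mod P) ` (\<lambda>x. (x + c) mod P) ` A = (\<lambda>x. x) ` A"
    unfolding image_image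
  proof (rule image_cong[OF refl])
    fix x assume "x \<in> A"
    then have "x mod P = x" using A by auto
    then show "((x + c) mod P + - c) mod P = x" by (metis mod_add_left_eq add.assoc add.right_neutral add.right_inverse)
  qed
  then have A': "(\<lambda>x. (x + - c) mod P) ` (\<lambda>x. (x + c) mod P) ` A = A" by simp
  have "pcompose (pcompose f [:c, 1:]) [:- c, 1:] = f"
    by (simp add: pcompose_assoc[symmetric] pcompose_pCons)
  then show "card (root_classes ((\<lambda>x. (x + c) mod P) ` A) K k f) \<le> card (root_classes A K k (pcompose f [:c, 1:]))"
    using card_root_classes_shift_le[OF K, of "(\<lambda>x. (x + c) mod P) ` A" k "pcompose f [:c, 1:]" "- c"] A' by simp
qed

lemma monics_res: "k \<ge> 1 \<Longrightarrow> f \<in> monics b n k \<Longrightarrow> coeff f i \<in> res k"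
  using one_in_units[of k] P_gt_1
  by (auto simp: monics_def polys_def units_def mults_def res_def dest!: spec[of _ i] split: if_splits)

lemma res_eqI: "x \<in> res k \<Longrightarrow> y \<in> res k \<Longrightarrow> P ^ k dvd x - y \<Longrightarrow> x = y"
  by (auto simp: res_def mod_eq_dvd_iff[symmetric])

text \<open>Substituting x + c permutes the monic polynomials of degree n modulo P^k. Thus any
  residue can be moved to 0, where \<open>p_monic_mean_order\<close> applies.\<close>

lemma monic_mean_shift:
  assumes k: "k \<ge> 1" and K: "K \<ge> 1" and A: "A \<subseteq> {0..<P}"
  shows "monic_mean ((\<lambda>x. (x + c) mod P) ` A) n K k = monic_mean A n K k"
proof -
  define \<sigma> where "\<sigma> f = redq (P ^ k) (pcompose f [:c, 1:])" for f
  have inj: "inj_on \<sigma> (monics 0 n k)"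
  proof (rule inj_onI)
    fix f g assume f: "f \<in> monics 0 n k" and g: "g \<in> monics 0 n k" and "\<sigma> f = \<sigma> g"
    then have "coeff (\<sigma> f) i = coeff (\<sigma> g) i" for i by simp
    then have "P ^ k dvd coeff (pcompose (f - g) [:c, 1:]) i" for i
      by (simp add: \<sigma>_def coeff_redq mod_eq_dvd_iff pcompose_diff)
    then have "[:P ^ k:] dvd pcompose (f - g) [:c, 1:]" by (simp add: const_poly_dvd_iff)
    then obtain u where "pcompose (f - g) [:c, 1:] = [:P ^ k:] * u" by (elim dvdE)
    then have "pcompose (pcompose (f - g) [:c, 1:]) [:- c, 1:] = [:P ^ k:] * pcompose u [:- c, 1:]"
      by (simp add: pcompose_smult)
    moreover have "pcompose (pcompose (f - g) [:c, 1:]) [:- c, 1:] = f - g"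
      by (simp add: pcompose_assoc[symmetric] pcompose_pCons)
    ultimately have "P ^ k dvd coeff f i - coeff g i" for i
      by (metis coeff_diff const_poly_dvd_iff dvd_triv_left)
    then show "f = g" by (intro poly_eqI res_eqI[OF monics_res[OF k f] monics_res[OF k g]])
  qed
  have maps: "\<sigma> ` monics 0 n k \<subseteq> monics 0 n k"
  proof clarify
    fix f assume "f \<in> monics 0 n k"
    then have "coeff f i \<in> (if i < n then res k else if i = n then {1} else {0})" for i
      unfolding monics_def polys_def mults_0 by blast
    then have n: "coeff f n = 1" "\<And>i. i > n \<Longrightarrow> coeff f i = 0"
      by (metis less_irrefl singletonD, metis less_irrefl less_not_sym singletonD)
    then have d: "degree f = n" by (metis degree_le le_antisym le_degree zero_neq_one)
    define g where "g = pcompose f [:c, 1:]"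
    have "degree g = n" by (simp add: g_def degree_pcompose d)
    moreover have "lead_coeff g = 1" using n d by (simp add: g_def lead_coeff_comp)
    ultimately have "coeff g n = 1" "\<And>i. i > n \<Longrightarrow> coeff g i = 0" by (auto simp: coeff_eq_0)
    moreover have "1 mod P ^ k = 1" using one_in_units[OF k] by (auto simp: units_def res_def)
    ultimately show "\<sigma> f \<in> monics 0 n k"
      unfolding \<sigma>_def g_def[symmetric] using mod_in_res
      by (auto simp: monics_def polys_def coeff_redq)
  qed
  have im: "\<sigma> ` monics 0 n k = monics 0 n k"
    using endo_inj_surj[OF finite_monics maps inj] .
  have "monic_mean ((\<lambda>x. (x + c) mod P) ` A) n K k = mean (monics 0 n k) (\<lambda>f. wt A K k (\<sigma> f))"
    unfolding monic_mean_def \<sigma>_def by (rule mean_cong) (simp only: wt_redq, simp add: wt_def card_root_classes_shift[OF K A])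
  also have "\<dots> = monic_mean A n K k" unfolding monic_mean_def by (rule mean_image[OF inj im])
  finally show ?thesis .
qed

text \<open>The series \<Gamma> of the cofactors is eliminated between the two convolutions. An
  uncounted residue contributes 1 + t + t^2 + ..., whence the factor 1 - t.\<close>

lemma monic_mean_fps_insert_0:
  assumes k: "k \<ge> 1" and K: "K \<ge> 1" and A: "A \<subseteq> {0<..<P}"
  shows "Abs_fps (\<lambda>n. real p ^ n * monic_mean (insert 0 A) n K k)
    = (1 - fps_X) * Abs_fps (\<lambda>n. eis_mean n K k) * Abs_fps (\<lambda>n. real p ^ n * monic_mean A n K k)"
proof -
  define \<gamma> where "\<gamma> j = real p ^ j * (if j > 0 then 1 - 1 / p else 1) * mean (unit_monics j k) (wt A K k)" for j
  have \<gamma>: "\<And>n. real p ^ n * monic_mean A n K k = (\<Sum>m\<le>n. \<gamma> (n - m))"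
    "\<And>n. real p ^ n * monic_mean (insert 0 A) n K k = (\<Sum>m\<le>n. eis_mean m K k * \<gamma> (n - m))"
    unfolding \<gamma>_def by (rule p_monic_mean_order[OF k K A])+
  define \<Gamma> where "\<Gamma> = Abs_fps \<gamma>"
  have one: "(1 - fps_X) * Abs_fps (\<lambda>_. 1::real) = 1"
    by (rule fps_ext) (simp add: algebra_simps)
  have 1: "Abs_fps (\<lambda>n. real p ^ n * monic_mean A n K k) = Abs_fps (\<lambda>_. 1) * \<Gamma>"
    by (rule fps_ext) (simp add: \<gamma>(1) fps_mult_nth \<Gamma>_def atMost_atLeast0)
  have 2: "Abs_fps (\<lambda>n. real p ^ n * monic_mean (insert 0 A) n K k) = Abs_fps (\<lambda>n. eis_mean n K k) * \<Gamma>"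
    by (rule fps_ext) (simp add: \<gamma>(2) fps_mult_nth \<Gamma>_def atMost_atLeast0)
  have "(1 - fps_X) * Abs_fps (\<lambda>n. eis_mean n K k) * Abs_fps (\<lambda>n. real p ^ n * monic_mean A n K k)
    = ((1 - fps_X) * Abs_fps (\<lambda>_. 1)) * (Abs_fps (\<lambda>n. eis_mean n K k) * \<Gamma>)"
    unfolding 1 by (simp only: mult_ac)
  also have "\<dots> = Abs_fps (\<lambda>n. real p ^ n * monic_mean (insert 0 A) n K k)" by (simp only: one 2 mult_1_left)
  finally show ?thesis by (rule sym)
qed

lemma monic_mean_fps:
  assumes k: "k \<ge> 1" and K: "K \<ge> 1" and A: "A \<subseteq> {0..<P}"
  shows "(1 - fps_const (real p) * fps_X) * Abs_fps (\<lambda>n. real p ^ n * monic_mean A n K k)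
    = ((1 - fps_X) * Abs_fps (\<lambda>n. eis_mean n K k)) ^ card A"
proof -
  have "finite A" using A finite_subset by blast
  then show ?thesis using A
  proof (induction A)
    case empty
    \<comment> \<open>With no residue counted every weight is 1, and the geometric series in p t
      accounts for the factor 1 - p t.\<close>
    have "wt {} K k = (\<lambda>_. 1)" by (simp add: wt_def[abs_def] root_classes_def)
    then have "monic_mean {} n K k = 1" for n by (simp add: monic_mean_def mean_one)
    moreover have "(1 - fps_const (real p) * fps_X) * Abs_fps (\<lambda>n. real p ^ n) = 1"
      by (rule fps_ext) (auto simp: algebra_simps power_eq_if)
    ultimately show ?case by simp
  next
    case (insert a A)
    \<comment> \<open>Translation by - a carries a to 0 and the other residues to nonzero ones, as
      \<open>monic_mean_fps_insert_0\<close> demands.\<close>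
    define A0 where "A0 = (\<lambda>x. (x + - a) mod P) ` A"
    have "0 \<notin> A0"
    proof
      assume "0 \<in> A0"
      then obtain x where x: "x \<in> A" "(x - a) mod P = 0" by (auto simp: A0_def)
      then have "x mod P = a mod P" by (simp add: mod_eq_dvd_iff dvd_eq_mod_eq_0)
      moreover have "x mod P = x" "a mod P = a" using insert.prems x(1) by auto
      ultimately show False using x insert.hyps by simp
    qed
    moreover have "A0 \<subseteq> {0..<P}" using P_gt_1 by (auto simp: A0_def)
    ultimately have A0: "A0 \<subseteq> {0<..<P}"
      by (metis atLeastLessThan_iff greaterThanLessThan_iff order_le_less subset_iff)
    have i: "insert 0 A0 = (\<lambda>x. (x + - a) mod P) ` insert a A" by (simp add: A0_def)
    have "monic_mean (insert a A) n K k = monic_mean (insert 0 A0) n K k" "monic_mean A n K k = monic_mean A0 n K k" for n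
      unfolding i unfolding A0_def
      by (rule monic_mean_shift[OF k K insert.prems, symmetric], rule monic_mean_shift[OF k K, symmetric]) (use insert.prems in auto)
    then show ?case using monic_mean_fps_insert_0[OF k K A0] insert
      by (simp add: mult_ac)
  qed
qed

lemma root_classes_UNIV: "root_classes UNIV K k f = root_classes {0..<P} K k f"
  using P_gt_1 by (auto simp: root_classes_def)

lemma monic_mean_fps_UNIV:
  assumes "k \<ge> 1" "K \<ge> 1"
  shows "(1 - fps_const (real p) * fps_X) * Abs_fps (\<lambda>n. real p ^ n * monic_mean UNIV n K k)
    = ((1 - fps_X) * Abs_fps (\<lambda>n. eis_mean n K k)) ^ p"
proof -
  have "monic_mean UNIV n K k = monic_mean {0..<P} n K k" for n by (simp add: monic_mean_def wt_def[abs_def] root_classes_UNIV)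
  then show ?thesis using monic_mean_fps[OF assms order.refl] by simp
qed

end

section \<open>Polynomials with arbitrary leading coefficient\<close>

lemma degree_polys_le:
  assumes "f \<in> polys C" "\<And>i. i > L \<Longrightarrow> C i = {0}"
  shows "degree f \<le> L"
  using assms by (intro degree_le) (auto simp: polys_def)

context prime_weight
begin

text \<open>When the sides C i with i >= r consist of multiples of P, these are the polynomials
  whose reduction has degree exactly s.\<close>

abbreviation degree_coeffs :: "(nat \<Rightarrow> int set) \<Rightarrow> nat \<Rightarrow> nat \<Rightarrow> nat \<Rightarrow> nat \<Rightarrow> int set" where
  "degree_coeffs C k r s \<equiv> \<lambda>i. if i < s then res k else if i = s then units k else if i < r then mults 1 k else C i"

text \<open>The first r coefficients are tested for divisibility by P from the top downwards: a unit
  is first met at s with probability p^(-(r - 1 - s)) (1 - 1/p), and never with probability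
  p^(-r).\<close>

lemma mean_degree_split:
  assumes k: "k \<ge> 1" and r: "r \<le> n"
    and C: "\<And>i. i \<ge> n \<Longrightarrow> C i = {0}" "\<And>i. finite (C i)" "\<And>i. C i \<noteq> {}"
  shows "mean (polys (\<lambda>i. if i < r then res k else C i)) \<psi>
    = (1 / p) ^ r * mean (polys (\<lambda>i. if i < r then mults 1 k else C i)) \<psi>
    + (\<Sum>s<r. (1 / p) ^ (r - 1 - s) * (1 - 1 / p) *
        mean (polys (degree_coeffs C k r s)) \<psi>)"
proof -
  define X where "X t i = (if i < t then res k else if i < r then mults 1 k else C i)" for t i
  define Y where "Y s = mean (polys (degree_coeffs C k r s)) \<psi>" for s
  have "mean (polys (X t)) \<psi> = (1 / p) ^ t * mean (polys (X 0)) \<psi>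
    + (\<Sum>s<t. (1 / p) ^ (t - 1 - s) * (1 - 1 / p) * Y s)" if "t \<le> r" for t using that
  proof (induction t)
    case (Suc t)
    have 1: "(X (Suc t))(t := mults 1 k) = X t" using Suc.prems by (auto simp: X_def fun_eq_iff)
    have "(X (Suc t))(t := units k) = degree_coeffs C k r t" by (auto simp: X_def fun_eq_iff)
    then have 2: "mean (polys ((X (Suc t))(t := units k))) \<psi> = Y t" by (simp add: Y_def)
    have "mean (polys (X (Suc t))) \<psi> = 1 / p * mean (polys ((X (Suc t))(t := mults 1 k))) \<psi>
      + (1 - 1 / p) * mean (polys ((X (Suc t))(t := units k))) \<psi>"
      by (rule mean_split_res[of _ n]) (use k r Suc.prems C in \<open>auto simp: X_def\<close>)
    then have "mean (polys (X (Suc t))) \<psi> = 1 / p * mean (polys (X t)) \<psi> + (1 - 1 / p) * Y t"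
      unfolding 1 2 .
    also have "mean (polys (X t)) \<psi> = (1 / p) ^ t * mean (polys (X 0)) \<psi>
      + (\<Sum>s<t. (1 / p) ^ (t - 1 - s) * (1 - 1 / p) * Y s)" using Suc by simp
    also have "1 / p * \<dots> = (1 / p) ^ Suc t * mean (polys (X 0)) \<psi>
      + (\<Sum>s<t. (1 / p) ^ (Suc t - 1 - s) * (1 - 1 / p) * Y s)"
    proof -
      have "1 / p * ((1 / p) ^ (t - 1 - s) * (1 - 1 / p) * Y s) = (1 / p) ^ (Suc t - 1 - s) * (1 - 1 / p) * Y s"
        if "s < t" for s
      proof -
        have "Suc t - 1 - s = Suc (t - 1 - s)" using that by simp
        then show ?thesis by (simp only: power_Suc mult_ac)
      qed
      then show ?thesis by (simp add: distrib_left sum_distrib_left del: power_one_over cong: sum.cong_simp)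
    qed
    finally show ?case by simp
  qed simp
  from this[of r] have "mean (polys (X r)) \<psi> = (1 / p) ^ r * mean (polys (X 0)) \<psi>
    + (\<Sum>s<r. (1 / p) ^ (r - 1 - s) * (1 - 1 / p) * Y s)" by simp
  moreover have "X r = (\<lambda>i. if i < r then res k else C i)" "X 0 = (\<lambda>i. if i < r then mults 1 k else C i)"
    by (auto simp: X_def fun_eq_iff)
  ultimately show ?thesis by (simp add: Y_def)
qed

lemma mults_Suc_image: "k \<ge> 1 \<Longrightarrow> mults (Suc e) k = (*) P ` mults e (k - 1)"
proof -
  assume "k \<ge> 1"
  then have k: "P ^ k = P * P ^ (k - 1)" by (cases k) auto
  show ?thesis
  proof (intro set_eqI iffI)
    fix x assume x: "x \<in> mults (Suc e) k"
    then obtain y where y: "x = P ^ Suc e * y" by (auto simp: mults_def)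
    have "0 \<le> P ^ e * y" "P ^ e * y < P ^ (k - 1)"
      using x P_gt_1 unfolding y mults_def res_def k by (auto simp: zero_le_mult_iff mult.assoc)
    then show "x \<in> (*) P ` mults e (k - 1)" unfolding y
      by (intro image_eqI[of _ _ "P ^ e * y"]) (auto simp: mults_def res_def)
  next
    fix x assume "x \<in> (*) P ` mults e (k - 1)"
    then show "x \<in> mults (Suc e) k" using P_gt_1 by (auto simp: mults_def res_def k)
  qed
qed

lemma mean_scale:
  assumes "\<And>i. C i = (*) P ` C' i"
  shows "mean (polys C) \<psi> = mean (polys C') (\<lambda>f. \<psi> (smult P f))"
proof -
  have "inj_on (smult P) (polys C')" using P_gt_1 by (auto simp: inj_on_def poly_eq_iff)
  moreover have "smult P ` polys C' = polys C"
  proof (intro set_eqI iffI)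
    fix f assume "f \<in> smult P ` polys C'"
    then show "f \<in> polys C" by (auto simp: polys_def assms)
  next
    fix f assume f: "f \<in> polys C"
    define g where "g = map_poly (\<lambda>x. x div P) f"
    have g: "coeff g i = coeff f i div P" for i by (simp add: g_def coeff_map_poly)
    have *: "coeff g i \<in> C' i \<and> coeff f i = P * coeff g i" for i
    proof -
      obtain y where "y \<in> C' i" "coeff f i = P * y" using f by (auto simp: polys_def assms)
      then show ?thesis using P_gt_1 by (simp add: g)
    qed
    then have "g \<in> polys C'" "f = smult P g" by (auto simp: polys_def intro: poly_eqI)
    then show "f \<in> smult P ` polys C'" by blast
  qed
  ultimately show ?thesis using mean_image[of "smult P" "polys C'" _ \<psi>] by simp
qed

text \<open>Cancelling a factor P costs one unit of the precision k and leaves K alone.\<close>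

lemma root_classes_smult:
  assumes "k \<ge> 1"
  shows "root_classes A K k (smult P f) = root_classes A K (k - 1) f"
proof -
  have "P ^ k dvd P * x \<longleftrightarrow> P ^ (k - 1) dvd x" for x
    using assms P_gt_1 by (cases k) auto
  then show ?thesis by (simp add: root_classes_def)
qed

lemma root_classes_mult_unit_const:
  assumes K: "K \<ge> 1" and h0: "\<not> P dvd coeff h 0" and h: "\<And>i. i > 0 \<Longrightarrow> P dvd coeff h i"
  shows "root_classes A K k (g * h) = root_classes A K k g"
proof (rule root_classes_mult[OF K])
  fix a
  have "P dvd coeff h i - coeff [:coeff h 0:] i" for i using h by (cases i) auto
  then have "P dvd poly h a - poly [:coeff h 0:] a" by (rule poly_dvd_cong)
  then have "P dvd poly h a \<longleftrightarrow> P dvd coeff h 0" by (intro prime_dvd_mod_cong) simp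
  then show "\<not> P dvd poly h a" using h0 by simp
qed

text \<open>The second factor stands for the roots outside Z_p, whose reciprocals are roots of the
  reversal in p Z_p. The product thus counts roots on the projective line; infinity is among them
  only if the leading coefficient is 0, an event of probability 0.\<close>

definition full_mean :: "nat \<Rightarrow> nat \<Rightarrow> nat \<Rightarrow> real" where
  "full_mean n K k = mean (polys (\<lambda>i. if i \<le> n then res k else {0}))
    (\<lambda>f. wt UNIV K k f * wt {0} K k (rev_at n f))"

definition const_units :: "nat \<Rightarrow> nat \<Rightarrow> int poly set" where
  "const_units L k = polys (\<lambda>j. if j = 0 then units k else if j \<le> L then mults 1 k else {0})"

text \<open>Reversal at degree L turns h into a polynomial with unit leading coefficient and all
  others divisible by P. That is a unit times a monic polynomial reducing to x^L, and the unit does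
  not affect roots.\<close>

lemma mean_const_units_rev:
  assumes k: "k \<ge> 1" and K: "K \<ge> 1"
  shows "mean (const_units L k) (\<lambda>h. wt {0} K k (rev_at L h)) = eis_mean L K k"
proof -
  define D where "D j = (if j = 0 then units k else if j \<le> L then mults 1 k else {0})" for j
  define D' where "D' i = (if i < L then mults 1 k else if i = L then units k else {0})" for i
  have deg: "degree f \<le> L" if "f \<in> polys D \<or> f \<in> polys D'" for f
    using that by (elim disjE; elim degree_polys_le) (auto simp: D_def D'_def)
  have D'D: "D' i = D (L - i)" if "i \<le> L" for i using that by (auto simp: D_def D'_def)
  have maps: "rev_at L f \<in> polys D'" if "f \<in> polys D" for f
    unfolding polys_def
  proof (intro CollectI allI)
    fix i
    show "coeff (rev_at L f) i \<in> D' i"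
      using that D'D[of i] by (cases "i \<le> L") (simp_all add: polys_def coeff_rev_at D'_def)
  qed
  have maps': "rev_at L f \<in> polys D" if "f \<in> polys D'" for f
    unfolding polys_def
  proof (intro CollectI allI)
    fix i
    show "coeff (rev_at L f) i \<in> D i"
    proof (cases "i \<le> L")
      case True
      then have "D i = D' (L - i)" using D'D[of "L - i"] by simp
      then show ?thesis using that True by (simp add: polys_def coeff_rev_at)
    qed (simp add: coeff_rev_at D_def)
  qed
  have im: "rev_at L ` polys D = polys D'"
  proof (intro set_eqI iffI)
    fix f assume f: "f \<in> polys D'"
    have "rev_at L (rev_at L f) = f" using deg f by (intro rev_at_rev_at) auto
    then show "f \<in> rev_at L ` polys D" using maps'[OF f] by (metis imageI)
  qed (use maps in auto)
  have inj: "inj_on (rev_at L) (polys D)" using deg rev_at_rev_at by (metis inj_onI)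
  define E where "E j = (if j = 0 then units k else {0})" for j :: nat
  have "mean (polys D) (\<lambda>h. wt {0} K k (rev_at L h)) = mean (polys D') (wt {0} K k)"
    by (rule mean_image[OF inj im])
  also have "D' = (\<lambda>i. if i < L then mults 1 k else E (i - L))" by (auto simp: D'_def E_def fun_eq_iff)
  also have "mean (polys \<dots>) (wt {0} K k) = mean (monics 1 L k) (wt {0} K k) * mean (polys E) (\<lambda>_. 1)"
  proof (rule mean_factor[where L = 0 and e = "\<lambda>_. 0"])
    show "E j \<subseteq> res k" for j using P_gt_1 by (auto simp: E_def units_def res_def)
    fix g h assume "h \<in> polys E"
    then have E: "coeff h j \<in> E j" for j by (simp add: polys_def)
    have "\<not> P dvd coeff h 0" "\<And>i. i > 0 \<Longrightarrow> P dvd coeff h i"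
      using E by (metis E_def CollectD units_def, metis E_def dvd_0_right less_irrefl singletonD)
    then have "root_classes {0} K k (g * h) = root_classes {0} K k g"
      by (rule root_classes_mult_unit_const[OF K])
    then show "wt {0} K k (g * h) = wt {0} K k g * 1" by (simp add: wt_def)
  qed (use k in \<open>auto simp: E_def mono_def wt_redq\<close>)
  also have "mean (polys E) (\<lambda>_. 1) = 1"
    by (intro mean_one finite_polys[of 1] polys_nonempty[of 1])
      (auto simp: E_def units_nonempty[OF k])
  finally show ?thesis by (simp add: const_units_def D_def[abs_def] eis_mean_def)
qed

lemma degree_const_units: "h \<in> const_units L k \<Longrightarrow> degree h \<le> L"
  unfolding const_units_def by (erule degree_polys_le) auto

lemma const_units_coeff:
  assumes "h \<in> const_units L k"
  shows "\<not> P dvd coeff h 0" "\<And>i. i > 0 \<Longrightarrow> P dvd coeff h i"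
proof -
  have c: "coeff h i \<in> (if i = 0 then units k else if i \<le> L then mults 1 k else {0})" for i
    using assms unfolding const_units_def polys_def by blast
  show "\<not> P dvd coeff h 0" using c[of 0] by (simp add: units_def)
  show "P dvd coeff h i" if "i > 0" for i using c[of i] that by (auto simp: mults_def split: if_splits)
qed

lemma monics_coeff_top:
  assumes "g \<in> monics b s k"
  shows "coeff g s = 1" "degree g \<le> s"
proof -
  have c: "coeff g i \<in> (if i < s then mults b k else if i = s then {1} else {0})" for i
    using assms unfolding monics_def polys_def by blast
  show "coeff g s = 1" using c[of s] by simp
  show "degree g \<le> s"
  proof (rule degree_le, clarify)
    fix i assume "i > s"
    then show "coeff g i = 0" using c[of i] by simp
  qed
qed

text \<open>If the reduction is zero, f / P is again uniform, at precision k - 1. Otherwise the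
  reduction has some degree s, and f = g h with g monic of degree s and h a unit constant modulo P.
  Then g has the roots in Z_p, and the reversal of h has those that the reversal of f has in p
  Z_p.\<close>

lemma full_mean_recursion:
  assumes k: "k \<ge> 1" and K: "K \<ge> 1"
  shows "full_mean n K k = (1 / p) ^ Suc n * full_mean n K (k - 1)
    + (\<Sum>s\<le>n. (1 / p) ^ (n - s) * (1 - 1 / p) * (monic_mean UNIV s K k * eis_mean (n - s) K k))"
proof -
  define \<psi> where "\<psi> k f = wt UNIV K k f * wt {0} K k (rev_at n f)" for k f
  have "full_mean n K k = mean (polys (\<lambda>i. if i < Suc n then res k else {0})) (\<psi> k)"
    by (simp add: full_mean_def \<psi>_def[abs_def] less_Suc_eq_le)
  also have "\<dots> = (1 / p) ^ Suc n * mean (polys (\<lambda>i. if i < Suc n then mults 1 k else {0})) (\<psi> k)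
    + (\<Sum>s<Suc n. (1 / p) ^ (Suc n - 1 - s) * (1 - 1 / p) *
        mean (polys (degree_coeffs (\<lambda>_. {0}) k (Suc n) s)) (\<psi> k))"
    by (rule mean_degree_split[where n = "Suc n"]) (use k in auto)
  also have "mean (polys (\<lambda>i. if i < Suc n then mults 1 k else {0})) (\<psi> k)
     = mean (polys (\<lambda>i. if i \<le> n then res (k - 1) else {0})) (\<lambda>f. \<psi> k (smult P f))"
    by (rule mean_scale) (use mults_Suc_image[OF k, of 0] in \<open>auto simp: less_Suc_eq_le\<close>)
  also have "(\<lambda>f. \<psi> k (smult P f)) = \<psi> (k - 1)"
  proof
    fix f
    have "rev_at n (smult P f) = smult P (rev_at n f)" by (auto simp: poly_eq_iff coeff_rev_at)
    then show "\<psi> k (smult P f) = \<psi> (k - 1) f" by (simp add: \<psi>_def wt_def root_classes_smult[OF k])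
  qed
  finally have main: "full_mean n K k = (1 / p) ^ Suc n * full_mean n K (k - 1)
    + (\<Sum>s<Suc n. (1 / p) ^ (Suc n - 1 - s) * (1 - 1 / p) *
        mean (polys (degree_coeffs (\<lambda>_. {0}) k (Suc n) s)) (\<psi> k))"
    by (simp only: full_mean_def \<psi>_def[abs_def])
  have F: "mean (polys (degree_coeffs (\<lambda>_. {0}) k (Suc n) s)) (\<psi> k)
     = monic_mean UNIV s K k * eis_mean (n - s) K k" if "s < Suc n" for s
  proof -
    define D where "D j = (if j = 0 then units k else if j \<le> n - s then mults 1 k else {0})" for j
    have "polys (degree_coeffs (\<lambda>_. {0}) k (Suc n) s)
      = polys (\<lambda>i. if i < s then mults 0 k else D (i - s))"
      using that by (intro arg_cong[of _ _ polys]) (auto simp: D_def fun_eq_iff)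
    also have "mean \<dots> (\<psi> k) = mean (monics 0 s k) (wt UNIV K k) * mean (polys D) (\<lambda>h. wt {0} K k (rev_at (n - s) h))"
    \<comment> \<open>With b = 0 the divisibility comes from h: all its coefficients but the
      constant one are multiples of P.\<close>
    proof (rule mean_factor[where L = "n - s" and e = "\<lambda>j. if j = 0 then 0 else 1"])
      show "D j \<subseteq> res k" for j using P_gt_1 by (auto simp: D_def units_def mults_def res_def)
      show "(x + y) mod P ^ k \<in> D j" if "j < n - s" "x \<in> D j"
        "P ^ (0 + (if Suc j = 0 then 0 else 1)) dvd y" for j x y
        using that units_closed[OF k] mults_closed[OF k] by (auto simp: D_def)
      show "\<psi> k (redq (P ^ k) f) = \<psi> k f" for f
      proof -
        have "root_classes {0} K k (rev_at n (redq (P ^ k) f)) = root_classes {0} K k (rev_at n f)"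
          by (rule root_classes_cong) (use dvd_diff_redq in \<open>auto simp: coeff_rev_at\<close>)
        then show ?thesis by (simp add: \<psi>_def wt_redq) (simp add: wt_def)
      qed
      fix g h assume g: "g \<in> monics 0 s k" and h: "h \<in> polys D"
      then have h: "h \<in> const_units (n - s) k" by (simp add: const_units_def D_def[abs_def])
      have rv: "rev_at n (g * h) = rev_at s g * rev_at (n - s) h"
        using rev_at_mult[OF monics_coeff_top(2)[OF g] degree_const_units[OF h]] \<open>s < Suc n\<close> by simp
      \<comment> \<open>The reversal of g has the leading coefficient 1 of g as its constant term,
        so it has no roots reducing to 0.\<close>
      have "\<not> P dvd coeff (rev_at s g) 0"
        using monics_coeff_top(1)[OF g] P_gt_1 by (simp add: coeff_rev_at)
      then have "root_classes {0} K k (rev_at (n - s) h * rev_at s g) = root_classes {0} K k (rev_at (n - s) h)"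
        by (intro root_classes_mult[OF K] unit_at_0)
      moreover have "root_classes UNIV K k (g * h) = root_classes UNIV K k g"
        by (rule root_classes_mult_unit_const[OF K const_units_coeff[OF h]])
      ultimately show "\<psi> k (g * h) = wt UNIV K k g * wt {0} K k (rev_at (n - s) h)"
        by (simp add: \<psi>_def wt_def rv mult.commute[of "rev_at s g"])
    qed (use k in \<open>auto simp: D_def mono_def mults_def split: if_splits\<close>)
    also have "polys D = const_units (n - s) k" by (simp add: const_units_def D_def[abs_def])
    finally show ?thesis by (simp add: mean_const_units_rev[OF k K] monic_mean_def)
  qed
  show ?thesis unfolding main
    by (simp only: lessThan_Suc_atMost diff_Suc_1) (intro arg_cong2[of _ _ _ _ "(+)"] sum.cong refl, subst F, auto)
qed

end

section \<open>Monic polynomials congruent to a power of x\<close>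

context prime_weight
begin

text \<open>If \<open>f\<close> is distributed as in the model reducing to \<open>x ^ n\<close>, these are the coefficients
  of \<open>p ^ (- r) f (p x)\<close>, conditioned on this polynomial being integral.\<close>

definition scaled_coeffs :: "nat \<Rightarrow> nat \<Rightarrow> nat \<Rightarrow> nat \<Rightarrow> int set" where
  "scaled_coeffs r n k i = (if i < r then res k else if i < n then mults (Suc i - r) k
    else if i = n then {P ^ (n - r)} else {0})"

definition scaled_mean :: "nat \<Rightarrow> nat \<Rightarrow> nat \<Rightarrow> nat \<Rightarrow> real" where
  "scaled_mean r n K k = mean (polys (scaled_coeffs r n k)) (wt UNIV K k)"

text \<open>After n divisions the leading coefficient P^(n - r) has become 1 and the others are
  free, so the recursion ends in the random monic model.\<close>

lemma scaled_mean_n: "scaled_mean n n K k = monic_mean UNIV n K k"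
proof -
  have "scaled_coeffs n n k = (\<lambda>i. if i < n then mults 0 k else if i = n then {1} else {0})"
    by (auto simp: scaled_coeffs_def fun_eq_iff)
  then show ?thesis by (simp add: scaled_mean_def monic_mean_def monics_def)
qed

text \<open>For r < n the coefficients from index r on are multiples of P. Either the reduction
  vanishes, with probability p^(-r), and division by P leads to stage r + 1, or it has a degree s <
  r, and the cofactor of the monic factor of degree s, a unit constant modulo P, has no roots in
  Z_p. The bound k > n makes P^(n - r) one of the residues.\<close>

lemma scaled_mean_recursion:
  assumes k: "k > n" and K: "K \<ge> 1" and r: "1 \<le> r" "r < n"
  shows "scaled_mean r n K k = (1 / p) ^ r * scaled_mean (Suc r) n K (k - 1)
    + (\<Sum>s<r. (1 / p) ^ (r - 1 - s) * (1 - 1 / p) * monic_mean UNIV s K k)"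
proof -
  have k1: "k \<ge> 1" using k by simp
  have Pk: "P ^ (n - r) \<in> res k" using k r P_gt_1 by (simp add: res_def power_strict_increasing)
  define C where "C i = (if i < n then mults (Suc i - r) k else if i = n then {P ^ (n - r)} else {0})" for i
  have scaled_mean_C: "scaled_coeffs r n k = (\<lambda>i. if i < r then res k else C i)"
    using r by (auto simp: scaled_coeffs_def C_def fun_eq_iff)
  have "scaled_mean r n K k = mean (polys (\<lambda>i. if i < r then res k else C i)) (wt UNIV K k)"
    by (simp add: scaled_mean_def scaled_mean_C)
  also have "\<dots> = (1 / p) ^ r * mean (polys (\<lambda>i. if i < r then mults 1 k else C i)) (wt UNIV K k)
    + (\<Sum>s<r. (1 / p) ^ (r - 1 - s) * (1 - 1 / p) *
        mean (polys (degree_coeffs C k r s)) (wt UNIV K k))"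
    by (rule mean_degree_split[where n = "Suc n"]) (use k1 r in \<open>auto simp: C_def\<close>)
  also have "mean (polys (\<lambda>i. if i < r then mults 1 k else C i)) (wt UNIV K k)
    = mean (polys (scaled_coeffs (Suc r) n (k - 1))) (\<lambda>f. wt UNIV K k (smult P f))"
  proof (rule mean_scale)
    fix i
    have 1: "mults (Suc 0) k = (*) P ` res (k - 1)" using mults_Suc_image[OF k1, of 0] by simp
    consider "i < r" | "i = r" | "r < i" "i < n" | "i = n" | "i > n" using r by linarith
    then show "(if i < r then mults 1 k else C i) = (*) P ` scaled_coeffs (Suc r) n (k - 1) i"
    proof cases
      case 3
      then have "Suc i - r = Suc (Suc i - Suc r)" by simp
      then show ?thesis using 3 mults_Suc_image[OF k1, of "Suc i - Suc r"] by (simp add: C_def scaled_coeffs_def)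
    next
      case 4
      have "n - r = Suc (n - Suc r)" using r by simp
      then show ?thesis using 4 r by (simp add: C_def scaled_coeffs_def)
    qed (use 1 r in \<open>auto simp: C_def scaled_coeffs_def\<close>)
  qed
  also have "(\<lambda>f. wt UNIV K k (smult P f)) = wt UNIV K (k - 1)"
    by (simp add: fun_eq_iff wt_def root_classes_smult[OF k1])
  finally have main: "scaled_mean r n K k = (1 / p) ^ r * scaled_mean (Suc r) n K (k - 1)
    + (\<Sum>s<r. (1 / p) ^ (r - 1 - s) * (1 - 1 / p) *
        mean (polys (degree_coeffs C k r s)) (wt UNIV K k))"
    by (simp only: scaled_mean_def)
  have F: "mean (polys (degree_coeffs C k r s)) (wt UNIV K k)
    = monic_mean UNIV s K k" if s: "s < r" for s
  proof -
    define D where "D j = (if j = 0 then units k else if s + j < r then mults 1 k else C (s + j))" for j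
    \<comment> \<open>Lower bounds for valuations: 0 for the unit, 1 for the other coefficients
      below index r, then one more per index, capped at n - r by the leading coefficient P^(n -
      r).\<close>
    define e where "e j = (if j = 0 then 0 else max 1 (min (Suc (s + j) - r) (n - r)))" for j
    have "polys (degree_coeffs C k r s)
      = polys (\<lambda>i. if i < s then mults 0 k else D (i - s))"
      by (intro arg_cong[of _ _ polys]) (auto simp: D_def fun_eq_iff)
    also have "mean \<dots> (wt UNIV K k) = mean (monics 0 s k) (wt UNIV K k) * mean (polys D) (\<lambda>_. 1)"
    proof (rule mean_factor[where L = "n - s" and e = e])
      show "D j \<subseteq> res k" for j
        using Pk P_gt_1 by (auto simp: D_def C_def units_def mults_def res_def)
      show e_dvd: "P ^ e j dvd x" if x: "x \<in> D j" for j x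
      proof -
        consider "j = 0" | "j > 0" "s + j < r" | "j > 0" "s + j \<ge> r" "s + j < n" | "s + j = n" "j > 0" | "s + j > n"
          using r s by linarith
        then show ?thesis
        proof cases
          case 1
          then show ?thesis by (simp add: e_def)
        next
          case 2
          then have "e j = 1" "x \<in> mults 1 k" using x by (auto simp: e_def D_def)
          then show ?thesis by (simp add: mults_def)
        next
          case 3
          then have "e j = Suc (s + j) - r" "x \<in> mults (Suc (s + j) - r) k"
            using x r by (auto simp: e_def D_def C_def)
          then show ?thesis by (simp add: mults_def)
        next
          case 4
          then have "e j = n - r" "x = P ^ (n - r)" using x r by (auto simp: e_def D_def C_def)
          then show ?thesis by simp
        next
          case 5
          then have "x = 0" using x r s by (auto simp: D_def C_def)
          then show ?thesis by simp
        qed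
      qed
      show "mono e" by (rule monoI) (auto simp: e_def)
      show "(x + y) mod P ^ k \<in> D j" if j: "j < n - s" and x: "x \<in> D j" and y: "P ^ (0 + e (Suc j)) dvd y" for j x y
      proof -
        consider "j = 0" | "j > 0" "s + j < r" | "j > 0" "s + j \<ge> r" "s + j < n"
          using j by linarith
        then show ?thesis
        proof cases
          case 1
          have "P ^ 1 dvd P ^ e (Suc j)" by (rule le_imp_power_dvd) (simp add: e_def)
          then have "P dvd y" using y by (metis add_0 dvd_trans power_one_right)
          then show ?thesis using 1 x units_closed[OF k1] by (simp add: D_def)
        next
          case 2
          have "P ^ 1 dvd P ^ e (Suc j)" by (rule le_imp_power_dvd) (simp add: e_def)
          then have "P ^ 1 dvd y" using y by (metis add_0 dvd_trans)
          then show ?thesis using 2 x mults_closed[OF k1] by (simp add: D_def)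
        next
          case 3
          \<comment> \<open>As s + j < n, the exponent prescribed here does not exceed the cap n -
            r.\<close>
          have "P ^ (Suc (s + j) - r) dvd P ^ e (Suc j)"
            using 3 r by (intro le_imp_power_dvd) (auto simp: e_def)
          then have "P ^ (Suc (s + j) - r) dvd y" using y by (metis add_0 dvd_trans)
          moreover have "Suc (s + j) - r \<le> k" using 3 k by simp
          ultimately show ?thesis using 3 x mults_closed by (simp add: D_def C_def)
        qed
      qed
      fix g h assume "h \<in> polys D"
      then have h: "coeff h j \<in> D j" for j by (simp add: polys_def)
      have "\<not> P dvd coeff h 0" using h[of 0] by (simp add: D_def units_def)
      moreover have "P dvd coeff h i" if "i > 0" for i
      proof -
        have "P ^ 1 dvd P ^ e i" by (rule le_imp_power_dvd) (use that in \<open>simp add: e_def\<close>)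
        then show ?thesis using e_dvd[OF h] by (metis dvd_trans power_one_right)
      qed
      ultimately have "root_classes UNIV K k (g * h) = root_classes UNIV K k g"
        by (rule root_classes_mult_unit_const[OF K])
      then show "wt UNIV K k (g * h) = wt UNIV K k g * 1" by (simp add: wt_def)
    next
      show "D j = {0}" if "j > n - s" for j using that r s by (auto simp: D_def C_def)
    qed (use k1 in \<open>auto simp: D_def e_def wt_redq\<close>)
    also have "mean (polys D) (\<lambda>_. 1) = 1"
      by (intro mean_one finite_polys[of "Suc n"] polys_nonempty[of "Suc n"])
        (use r in \<open>auto simp: D_def C_def units_nonempty[OF k1]\<close>)
    finally show ?thesis by (simp add: monic_mean_def)
  qed
  show ?thesis unfolding main
    by (intro arg_cong2[of _ _ _ _ "(+)"] sum.cong refl, subst F, auto)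
qed

text \<open>A root reducing to 0 is P y, and the class of P y modulo P^K is P times the class of y
  modulo P^(K - 1).\<close>

lemma root_classes_contract:
  assumes k: "k \<ge> 1" and K: "K \<ge> 1"
    and f: "\<And>y. P ^ k dvd poly f (P * y) \<longleftrightarrow> P ^ (k - 1) dvd poly g y"
  shows "card (root_classes {0} K k f) = card (root_classes UNIV (K - 1) (k - 1) g)"
proof -
  have PK: "P ^ K = P * P ^ (K - 1)" using K by (cases K) auto
  have "root_classes {0} K k f = (*) P ` root_classes UNIV (K - 1) (k - 1) g"
  proof (intro set_eqI iffI)
    fix r assume "r \<in> root_classes {0} K k f"
    then obtain a where a: "r mod P = 0" "a mod P ^ K = r" "P ^ k dvd poly f a"
      by (auto simp: root_classes_def)
    have "a mod P = r mod P" using a(2) K by (metis dvd_power mod_mod_cancel zero_less_one less_le_trans)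
    then obtain y where y: "a = P * y" using a(1) by auto
    have "r = P * (y mod P ^ (K - 1))" using a(2) unfolding y PK by (simp only: mult_mod_right)
    moreover have "y mod P ^ (K - 1) \<in> root_classes UNIV (K - 1) (k - 1) g"
      using a(3) f[of y] mod_in_res by (auto simp: root_classes_def y)
    ultimately show "r \<in> (*) P ` root_classes UNIV (K - 1) (k - 1) g" by blast
  next
    fix r assume "r \<in> (*) P ` root_classes UNIV (K - 1) (k - 1) g"
    then obtain y where y: "r = P * (y mod P ^ (K - 1))" "P ^ (k - 1) dvd poly g y"
      by (auto simp: root_classes_def)
    have r: "(P * y) mod P ^ K = r" unfolding y(1) PK by (simp only: mult_mod_right)
    then have "r \<in> res K" using mod_in_res by metis
    moreover have "r mod P = 0" using y(1) by simp
    ultimately show "r \<in> root_classes {0} K k f"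
      using r y(2) f[of y] unfolding root_classes_def by blast
  qed
  moreover have "inj_on ((*) P) (root_classes UNIV (K - 1) (k - 1) g)" using P_gt_1 by (auto simp: inj_on_def)
  ultimately show ?thesis by (simp add: card_image)
qed

text \<open>Both sides are images of one box of free coefficients x_i, i < n: these give f with
  coefficients P x_i below the leading 1, and f(P x) / P with coefficients P^i x_i below P^(n - 1).
  The fibres at index i < n have size 1 for \<theta> and p^i for \<eta>, because reduction modulo
  P^(k - 1) forgets the top i digits of x_i.\<close>

lemma eis_mean_eq_scaled_mean:
  assumes n: "n \<ge> 1" and k: "k > n" and K: "K \<ge> 1"
  shows "eis_mean n K k = scaled_mean 1 n (K - 1) (k - 1)"
proof -
  have k1: "k \<ge> 1" using k by simp
  define \<theta> where "\<theta> i x = (if i < n then P * x else x)" for i and x :: int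
  define \<eta> where "\<eta> i x = (if i < n then (P ^ i * x) mod P ^ (k - 1) else P ^ (n - 1) * x)" for i and x :: int
  define C where "C i = (if i < n then res (k - 1) else if i = n then {1} else {0})" for i
  have "mean (polys C) (\<lambda>f. wt {0} K k (poly_upto (Suc n) (\<lambda>i. \<theta> i (coeff f i)))) = eis_mean n K k"
    unfolding eis_mean_def monics_def
  proof (rule mean_polys_map[where m = "\<lambda>_. 1"])
    fix i y assume y: "y \<in> (if i < n then mults 1 k else if i = n then {1} else {0})" and i: "i < Suc n"
    show "card {x \<in> C i. \<theta> i x = y} = 1"
    proof (cases "i < n")
      case True
      then obtain x0 where "x0 \<in> res (k - 1)" "y = P * x0" using y mults_Suc_image[OF k1, of 0] by auto
      then have "{x \<in> C i. \<theta> i x = y} = {x0}" using True P_gt_1 by (auto simp: C_def \<theta>_def)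
      then show ?thesis by simp
    next
      case False
      then have "{x \<in> C i. \<theta> i x = y} = {1}" using y i by (auto simp: C_def \<theta>_def)
      then show ?thesis by simp
    qed
  qed (use mults_Suc_image[OF k1, of 0] in \<open>auto simp: C_def \<theta>_def split: if_splits\<close>)
  moreover have "mean (polys C) (\<lambda>f. wt UNIV (K - 1) (k - 1) (poly_upto (Suc n) (\<lambda>i. \<eta> i (coeff f i))))
      = scaled_mean 1 n (K - 1) (k - 1)"
    unfolding scaled_mean_def
  proof (rule mean_polys_map[where m = "\<lambda>i. if i < n then p ^ i else 1"])
    fix i y assume y: "y \<in> scaled_coeffs 1 n (k - 1) i" and i: "i < Suc n"
    show "card {x \<in> C i. \<eta> i x = y} = (if i < n then p ^ i else 1)"
    proof (cases "i < n")
      case True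
      then have "y \<in> mults i (k - 1)" using y by (auto simp: scaled_coeffs_def split: if_splits)
      then show ?thesis using True k card_fibre[of i "k - 1" y] by (simp add: C_def \<eta>_def)
    next
      case False
      then have "{x \<in> C i. \<eta> i x = y} = {1}" using y i n by (auto simp: C_def \<eta>_def scaled_coeffs_def split: if_splits)
      then show ?thesis using False by simp
    qed
  next
    fix i x assume i: "i < Suc n" and x: "x \<in> C i"
    show "\<eta> i x \<in> scaled_coeffs 1 n (k - 1) i"
    proof (cases "i < n")
      case True
      have "P ^ i dvd P ^ (k - 1)" using True k by (intro le_imp_power_dvd) simp
      then have "(P ^ i * x) mod P ^ (k - 1) \<in> mults i (k - 1)"
        using mod_in_res by (simp add: mults_def dvd_mod_iff)
      then show ?thesis using True by (cases "i = 0") (auto simp: \<eta>_def scaled_coeffs_def mults_def)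
    qed (use i x n in \<open>auto simp: \<eta>_def scaled_coeffs_def C_def\<close>)
  qed (use p_pos n in \<open>auto simp: C_def scaled_coeffs_def\<close>)
  moreover have "wt {0} K k (poly_upto (Suc n) (\<lambda>i. \<theta> i (coeff f i)))
    = wt UNIV (K - 1) (k - 1) (poly_upto (Suc n) (\<lambda>i. \<eta> i (coeff f i)))" (is "wt _ _ _ ?F = wt _ _ _ ?G") for f
  proof -
    \<comment> \<open>This is f(P x) / P before its coefficients are reduced modulo P^(k -
      1).\<close>
    define H where "H = poly_upto (Suc n) (\<lambda>i. if i < n then P ^ i * coeff f i else P ^ (n - 1) * coeff f i)"
    have poly: "poly (poly_upto m c) y = (\<Sum>i<m. c i * y ^ i)" for m c and y :: int
      by (simp add: poly_upto_def poly_sum poly_monom)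
    have "poly ?F (P * y) = P * poly H y" for y
    proof -
      have "\<theta> n (coeff f n) * (P * y) ^ n = P * (P ^ (n - 1) * coeff f n * y ^ n)"
        using n by (cases n) (simp_all add: \<theta>_def power_mult_distrib)
      then show ?thesis
        by (simp add: H_def poly \<theta>_def power_mult_distrib distrib_left sum_distrib_left mult_ac)
    qed
    moreover have "P ^ k dvd P * x \<longleftrightarrow> P ^ (k - 1) dvd x" for x
      using k P_gt_1 by (cases k) auto
    moreover have "P ^ (k - 1) dvd poly H y - poly ?G y" for y
      by (rule poly_dvd_cong) (auto simp: H_def coeff_poly_upto \<eta>_def)
    then have "P ^ (k - 1) dvd poly H y \<longleftrightarrow> P ^ (k - 1) dvd poly ?G y" for y
      by (metis dvd_diff_left_iff dvd_diff_right_iff)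
    ultimately have "P ^ k dvd poly ?F (P * y) \<longleftrightarrow> P ^ (k - 1) dvd poly ?G y" for y by simp
    from root_classes_contract[OF k1 K this] show ?thesis by (simp add: wt_def)
  qed
  ultimately show ?thesis by simp
qed

end

section \<open>Roots in the p-adic integers\<close>

lemma poly_diff_dvd_poly:
  fixes f :: "int poly"
  shows "a - b dvd poly f a - poly f b"
proof (induction f)
  case (pCons c f)
  have "poly (pCons c f) a - poly (pCons c f) b = (a - b) * poly f a + b * (poly f a - poly f b)"
    by (simp add: algebra_simps)
  then show ?case using pCons.IH by (simp add: dvd_add)
qed simp

lemma ptrunc_Suc: "ptrunc p a (Suc k) = ptrunc p a k + int (a k) * int p ^ k"
  by (simp add: ptrunc_def)

lemma ptrunc_0 [simp]: "ptrunc p a 0 = 0" by (simp add: ptrunc_def)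

lemma ptrunc_cong_mod:
  assumes "j \<le> k"
  shows "int p ^ j dvd ptrunc p a k - ptrunc p a j"
  using assms
proof (induction k rule: dec_induct)
  case (step k)
  have "int p ^ j dvd int p ^ k" using step by (simp add: le_imp_power_dvd)
  then have "int p ^ j dvd int (a k) * int p ^ k + (ptrunc p a k - ptrunc p a j)"
    using step.IH by (intro dvd_add dvd_mult)
  then show ?case by (simp add: ptrunc_Suc algebra_simps)
qed simp

context prime_weight
begin

text \<open>\<open>F\<close> stands for a polynomial over Z_p given by integral approximations,
  \<open>F k\<close> being correct modulo P^k.\<close>

definition coherent :: "(nat \<Rightarrow> int poly) \<Rightarrow> bool" where
  "coherent F \<longleftrightarrow> (\<forall>k i. P ^ k dvd coeff (F (Suc k)) i - coeff (F k) i)"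

definition lim_classes :: "int set \<Rightarrow> nat \<Rightarrow> (nat \<Rightarrow> int poly) \<Rightarrow> int set" where
  "lim_classes A K F = (\<Inter>k. root_classes A K k (F k))"

definition padic_roots :: "int set \<Rightarrow> (nat \<Rightarrow> int poly) \<Rightarrow> (nat \<Rightarrow> nat) set" where
  "padic_roots A F = {a. padic_digits p a \<and> int (a 0) \<in> A \<and> (\<forall>k. P ^ k dvd poly (F k) (ptrunc p a k))}"

lemma coherent_le:
  assumes "coherent F" "j \<le> k"
  shows "P ^ j dvd coeff (F k) i - coeff (F j) i"
  using assms(2)
proof (induction k rule: dec_induct)
  case (step k)
  have "P ^ j dvd P ^ k" using step by (simp add: le_imp_power_dvd)
  also have "P ^ k dvd coeff (F (Suc k)) i - coeff (F k) i" using assms(1) by (simp add: coherent_def)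
  finally have "P ^ j dvd (coeff (F (Suc k)) i - coeff (F k) i) + (coeff (F k) i - coeff (F j) i)"
    using step.IH by (rule dvd_add)
  then show ?case by simp
qed simp

lemma coherent_poly_dvd:
  assumes "coherent F" "j \<le> k" "P ^ k dvd poly (F k) a" "P ^ j dvd a - b"
  shows "P ^ j dvd poly (F j) b"
proof -
  have "P ^ j dvd P ^ k" using assms(2) by (simp add: le_imp_power_dvd)
  then have "P ^ j dvd poly (F k) a" using assms(3) by (rule dvd_trans)
  moreover have "P ^ j dvd poly (F k) a - poly (F j) a" by (rule poly_dvd_cong[OF coherent_le[OF assms(1,2)]])
  ultimately have "P ^ j dvd poly (F j) a" by (metis dvd_diff_right_iff)
  moreover have "P ^ j dvd poly (F j) a - poly (F j) b"
    using assms(4) poly_diff_dvd_poly dvd_trans by blast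
  ultimately show ?thesis by (metis dvd_diff_right_iff)
qed

lemma root_classes_coherent:
  assumes "coherent F" "j \<le> k"
  shows "root_classes A K k (F k) \<subseteq> root_classes A K j (F j)"
  using coherent_poly_dvd[OF assms] unfolding root_classes_def by fastforce

text \<open>A decreasing sequence of subsets of the finite set \<open>res K\<close> becomes
  stationary.\<close>

lemma eventually_root_classes:
  assumes "coherent F"
  shows "eventually (\<lambda>k. root_classes A K k (F k) = lim_classes A K F) sequentially"
proof -
  have "eventually (\<lambda>k. r \<in> root_classes A K k (F k) \<longleftrightarrow> r \<in> lim_classes A K F) sequentially" for r
  proof (cases "r \<in> lim_classes A K F")
    case True
    then show ?thesis by (auto simp: lim_classes_def)
  next
    case False
    then obtain j where "r \<notin> root_classes A K j (F j)" by (auto simp: lim_classes_def)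
    then have "r \<notin> root_classes A K k (F k)" if "j \<le> k" for k
      using root_classes_coherent[OF assms that] by blast
    then show ?thesis using False unfolding eventually_sequentially by blast
  qed
  then have "eventually (\<lambda>k. \<forall>r\<in>res K. r \<in> root_classes A K k (F k) \<longleftrightarrow> r \<in> lim_classes A K F) sequentially"
    by (intro eventually_ball_finite) auto
  then show ?thesis
  proof eventually_elim
    case (elim k)
    have "root_classes A K k (F k) \<subseteq> res K" by (rule root_classes_subset)
    moreover have "lim_classes A K F \<subseteq> res K" using root_classes_subset unfolding lim_classes_def by blast
    ultimately show ?case using elim by blast
  qed
qed

text \<open>For k so large that the classes modulo P^(K + 1) have become stationary, a root modulo
  P^k in the class b already lies in one of the limit classes modulo P^(K + 1).\<close>

lemma lim_classes_lift:
  assumes F: "coherent F" and b: "b \<in> lim_classes UNIV K F"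
  shows "\<exists>b'\<in>lim_classes UNIV (Suc K) F. b' mod P ^ K = b"
proof -
  obtain k where k: "root_classes UNIV (Suc K) k (F k) = lim_classes UNIV (Suc K) F"
    using eventually_happens[OF eventually_root_classes[OF F, of UNIV "Suc K"]] by auto
  have "b \<in> root_classes UNIV K k (F k)" using b by (auto simp: lim_classes_def)
  then obtain a where a: "a mod P ^ K = b" "P ^ k dvd poly (F k) a" by (auto simp: root_classes_def)
  then have "a mod P ^ Suc K \<in> root_classes UNIV (Suc K) k (F k)"
    using mod_in_res unfolding root_classes_def by blast
  moreover have "a mod P ^ Suc K mod P ^ K = b" using a(1) by (simp add: mod_mod_cancel)
  ultimately show ?thesis using k by blast
qed

lemma padic_digits_exist:
  assumes "\<And>k. s k \<in> res k" "\<And>k. s (Suc k) mod P ^ k = s k"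
  shows "\<exists>a. padic_digits p a \<and> (\<forall>k. ptrunc p a k = s k)"
proof (intro exI conjI allI)
  define a where "a k = nat (s (Suc k) div P ^ k)" for k
  have pos: "P ^ k > 0" for k using P_gt_1 by simp
  have a: "int (a k) = s (Suc k) div P ^ k" for k
    using assms(1)[of "Suc k"] pos by (simp add: a_def res_def pos_imp_zdiv_nonneg_iff)
  show "padic_digits p a" unfolding padic_digits_def
  proof
    fix k
    have "s (Suc k) div P ^ k < P"
    proof (rule ccontr)
      assume "\<not> s (Suc k) div P ^ k < P"
      then have "P * P ^ k \<le> s (Suc k) div P ^ k * P ^ k" using pos by (intro mult_right_mono) auto
      also have "\<dots> \<le> s (Suc k)"
        using div_mult_mod_eq[of "s (Suc k)" "P ^ k"] pos_mod_sign[OF pos, of "s (Suc k)" k] by linarith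
      finally show False using assms(1)[of "Suc k"] by (simp add: res_def)
    qed
    then show "a k < p" using a[of k] by linarith
  qed
  show "ptrunc p a k = s k" for k
  proof (induction k)
    case 0
    show ?case using assms(1)[of 0] by (simp add: res_def)
  next
    case (Suc k)
    then show ?case using assms(2)[of k] a[of k] mod_div_mult_eq[of "s (Suc k)" "P ^ k"]
      by (simp add: ptrunc_Suc)
  qed
qed

lemma ptrunc_in_res: "padic_digits p a \<Longrightarrow> ptrunc p a k \<in> res k"
proof (induction k)
  case (Suc k)
  have "int (a k) \<le> P - 1" using Suc.prems by (simp add: padic_digits_def)
  then have "int (a k) * P ^ k \<le> (P - 1) * P ^ k" using P_gt_1 by (intro mult_right_mono) auto
  then show ?case using Suc by (simp add: ptrunc_Suc res_def algebra_simps)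
qed (simp add: res_def)

lemma ptrunc_mod: "padic_digits p a \<Longrightarrow> j \<le> k \<Longrightarrow> ptrunc p a k mod P ^ j = ptrunc p a j"
  using ptrunc_cong_mod[of j k p a] ptrunc_in_res[of a j]
  by (auto simp: mod_eq_dvd_iff[symmetric] res_def)

lemma ptrunc_mod_P: "padic_digits p a \<Longrightarrow> k \<ge> 1 \<Longrightarrow> ptrunc p a k mod P = int (a 0)"
  using ptrunc_mod[of a 1 k] by (simp add: ptrunc_Suc)

lemma ptrunc_inject:
  assumes "padic_digits p a" "padic_digits p b" "\<And>k. ptrunc p a k = ptrunc p b k"
  shows "a = b"
proof
  fix k
  have "int (a k) * P ^ k = int (b k) * P ^ k"
    using assms(3)[of "Suc k"] assms(3)[of k] by (simp add: ptrunc_Suc)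
  then show "a k = b k" using P_gt_1 by simp
qed

text \<open>Lifting a limit class again and again gives a tower of classes, hence a p-adic integer;
  it is a root because each stage contains roots modulo the corresponding power of P.\<close>

lemma padic_roots_image:
  assumes F: "coherent F" and K: "K \<ge> 1"
  shows "(\<lambda>a. ptrunc p a K) ` padic_roots A F = lim_classes A K F"
proof (intro set_eqI iffI)
  fix r assume "r \<in> (\<lambda>a. ptrunc p a K) ` padic_roots A F"
  then obtain a where a: "padic_digits p a" "int (a 0) \<in> A" "\<And>k. P ^ k dvd poly (F k) (ptrunc p a k)"
    and r: "r = ptrunc p a K" by (auto simp: padic_roots_def)
  show "r \<in> lim_classes A K F" unfolding lim_classes_def
  proof
    fix k
    have "P ^ k dvd poly (F k) (ptrunc p a (max k K))"
      by (rule coherent_poly_dvd[OF F, where k = "max k K" and a = "ptrunc p a (max k K)"]) (use a(3) in auto)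
    moreover have "ptrunc p a (max k K) mod P ^ K = r" using ptrunc_mod[OF a(1)] r by simp
    moreover have "r mod P \<in> A" using ptrunc_mod_P[OF a(1) K] a(2) r by simp
    moreover have "r \<in> res K" using ptrunc_in_res[OF a(1)] r by simp
    ultimately show "r \<in> root_classes A K k (F k)" unfolding root_classes_def by blast
  qed
next
  fix r assume r: "r \<in> lim_classes A K F"
  then have rU: "r \<in> lim_classes UNIV K F" by (auto simp: lim_classes_def root_classes_def)
  have "\<exists>b. \<forall>n. (b n \<in> lim_classes UNIV (K + n) F \<and> (n = 0 \<longrightarrow> b n = r)) \<and> b (Suc n) mod P ^ (K + n) = b n"
    by (rule dependent_nat_choice) (use rU lim_classes_lift[OF F] in auto)
  then obtain b where b: "\<And>n. b n \<in> lim_classes UNIV (K + n) F" "b 0 = r" "\<And>n. b (Suc n) mod P ^ (K + n) = b n"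
    by blast
  \<comment> \<open>The tower b starts at the modulus P^K. Reducing b n from P^(K + n) to P^n makes
    it start at the modulus 1, as \<open>padic_digits_exist\<close> expects.\<close>
  define s where "s n = b n mod P ^ n" for n
  have cancel: "x mod P ^ j mod P ^ i = x mod P ^ i" if "i \<le> j" for x i j
    using that by (simp add: mod_mod_cancel le_imp_power_dvd)
  have "s (Suc n) mod P ^ n = s n" for n
  proof -
    have "s (Suc n) mod P ^ n = b (Suc n) mod P ^ (K + n) mod P ^ n"
      by (simp only: s_def cancel[of n "Suc n"] cancel[of n "K + n"] le_add2 le_SucI order.refl)
    then show ?thesis by (simp add: b(3) s_def)
  qed
  then obtain a where a: "padic_digits p a" "\<And>k. ptrunc p a k = s k"
    using padic_digits_exist[of s] mod_in_res by (auto simp: s_def)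
  have bK: "b n mod P ^ K = r" for n
  proof (induction n)
    case 0
    show ?case using rU b(2) by (auto simp: lim_classes_def root_classes_def res_def)
  next
    case (Suc n)
    have "b (Suc n) mod P ^ K = b (Suc n) mod P ^ (K + n) mod P ^ K" by (simp only: cancel[of K "K + n"] le_add1)
    then show ?case using Suc by (simp add: b(3))
  qed
  then have rK: "ptrunc p a K = r" by (simp add: a(2) s_def)
  have "P ^ k dvd poly (F k) (ptrunc p a k)" for k
  proof -
    have "b k \<in> root_classes UNIV (K + k) k (F k)" using b(1)[of k] by (auto simp: lim_classes_def)
    then obtain x where x: "x mod P ^ (K + k) = b k" "P ^ k dvd poly (F k) x" by (auto simp: root_classes_def)
    have "x mod P ^ k = s k" using x(1) cancel[of k "K + k" x] by (simp add: s_def)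
    then have "P ^ k dvd x - ptrunc p a k" unfolding a(2) by (metis dvd_minus_mod)
    then show ?thesis using coherent_poly_dvd[OF F order.refl x(2)] by simp
  qed
  moreover have "int (a 0) \<in> A"
  proof -
    have "r \<in> root_classes A K 0 (F 0)" using r by (auto simp: lim_classes_def)
    then show ?thesis using ptrunc_mod_P[OF a(1) K] rK by (simp add: root_classes_def)
  qed
  ultimately show "r \<in> (\<lambda>a. ptrunc p a K) ` padic_roots A F"
    using a(1) rK unfolding padic_roots_def by blast
qed

section \<open>Bounds for the number of roots\<close>

lemma coeff_dvd_of_roots:
  assumes "degree f \<le> n" "finite S" "card S > n"
    and "\<And>x y. x \<in> S \<Longrightarrow> y \<in> S \<Longrightarrow> x \<noteq> y \<Longrightarrow> \<not> P ^ K dvd x - y"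
    and "\<And>x. x \<in> S \<Longrightarrow> P ^ k dvd poly f x"
  shows "[:P ^ (k - n * K):] dvd f"
  using assms
proof (induction n arbitrary: f S k)
  case 0
  then obtain c where f: "f = [:c:]" by (meson degree_eq_zeroE le_zero_eq)
  obtain x where "x \<in> S" using 0 by fastforce
  then show ?case using 0(5) f by fastforce
next
  case (Suc n)
  obtain x where x: "x \<in> S" using Suc.prems by fastforce
  define g where "g = synthetic_div f x"
  have f: "f = [:- x, 1:] * g + [:poly f x:]" using synthetic_div_correct'[of x f] by (simp add: g_def)
  have "[:P ^ (k - K - n * K):] dvd g"
  proof (rule Suc.IH)
    show "degree g \<le> n" using Suc.prems(1) by (simp add: g_def degree_synthetic_div)
    show "finite (S - {x})" "card (S - {x}) > n" using Suc.prems x by auto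
    show "\<not> P ^ K dvd y - y'" if "y \<in> S - {x}" "y' \<in> S - {x}" "y \<noteq> y'" for y y'
      using Suc.prems(4) that by blast
    fix y assume y: "y \<in> S - {x}"
    have "P ^ k dvd poly f y - poly f x" using Suc.prems(5) x y by (intro dvd_diff) auto
    moreover have "poly f y - poly f x = (y - x) * poly g y" by (subst f) (simp add: algebra_simps)
    ultimately have 1: "P ^ k dvd (y - x) * poly g y" by simp
    show "P ^ (k - K) dvd poly g y"
    proof (cases "K \<le> k")
      case True
      \<comment> \<open>The two exponents have to add up to k + 1 for P^k to split: P^K divides y -
        x, or P^(k - K + 1) divides the value of g.\<close>
      then have "K + Suc (k - K) = Suc k" by simp
      then have "P ^ K dvd y - x \<or> P ^ Suc (k - K) dvd poly g y"
        by (rule prime_elem_power_dvd_cases[OF 1]) (rule prime_imp_prime_elem[OF prime_P])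
      then have "P ^ Suc (k - K) dvd poly g y" using Suc.prems(4) x y by blast
      then show ?thesis by (simp add: dvd_mult_right)
    qed simp
  qed
  then have "[:P ^ (k - Suc n * K):] dvd g" by (simp add: diff_diff_left)
  moreover have "[:P ^ (k - Suc n * K):] dvd [:poly f x:]"
    using Suc.prems(5)[OF x] by (simp add: power_le_dvd)
  ultimately show ?case by (subst f) (rule dvd_add[OF dvd_mult])
qed

definition padic_zero :: "(nat \<Rightarrow> int poly) \<Rightarrow> bool" where
  "padic_zero F \<longleftrightarrow> (\<forall>k i. P ^ k dvd coeff (F k) i)"

text \<open>By \<open>coeff_dvd_of_roots\<close> each root that is split off costs at most K powers
  of P. So for k = k0 + n K, more than n roots separated modulo P^K would make \<open>F k\<close>
  vanish modulo P^k0, against the choice of k0. The bound is independent of K, as dominated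
  convergence in K requires.\<close>

lemma card_lim_classes_le:
  assumes F: "coherent F" "\<And>k. degree (F k) \<le> n" "\<not> padic_zero F"
  shows "card (lim_classes A K F) \<le> n"
proof (rule ccontr)
  assume gt: "\<not> ?thesis"
  obtain k0 i where k0: "\<not> P ^ k0 dvd coeff (F k0) i" using F(3) by (auto simp: padic_zero_def)
  define k where "k = k0 + n * K"
  have sub: "lim_classes A K F \<subseteq> root_classes A K k (F k)" by (auto simp: lim_classes_def)
  have "\<exists>a. a mod P ^ K = r \<and> P ^ k dvd poly (F k) a" if "r \<in> lim_classes A K F" for r
    using sub that by (auto simp: root_classes_def)
  then obtain a where a: "\<And>r. r \<in> lim_classes A K F \<Longrightarrow> a r mod P ^ K = r \<and> P ^ k dvd poly (F k) (a r)"
    by metis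
  have fin: "finite (lim_classes A K F)" by (rule finite_subset[OF sub finite_root_classes])
  have inj: "inj_on a (lim_classes A K F)" using a by (metis inj_onI)
  have "[:P ^ (k - n * K):] dvd F k"
  proof (rule coeff_dvd_of_roots[where S = "a ` lim_classes A K F"])
    show "card (a ` lim_classes A K F) > n" using gt inj by (simp add: card_image)
    show "\<not> P ^ K dvd x - y" if "x \<in> a ` lim_classes A K F" "y \<in> a ` lim_classes A K F" "x \<noteq> y" for x y
      using that a by (auto simp: mod_eq_dvd_iff[symmetric])
  qed (use F(2) fin a in auto)
  then have "P ^ k0 dvd coeff (F k) i" by (simp add: k_def const_poly_dvd_iff)
  then have "P ^ k0 dvd coeff (F k0) i"
    using coherent_le[OF F(1), of k0 k i] by (simp add: k_def) (metis dvd_diff_right_iff)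
  then show False using k0 by simp
qed

lemma eventually_inj_ptrunc:
  assumes "finite R" "\<And>a. a \<in> R \<Longrightarrow> padic_digits p a"
  shows "eventually (\<lambda>K. inj_on (\<lambda>a. ptrunc p a K) R) sequentially"
proof -
  have *: "eventually (\<lambda>K. ptrunc p a K = ptrunc p b K \<longrightarrow> a = b) sequentially" if ab: "a \<in> R" "b \<in> R" for a b
  proof (cases "a = b")
    case False
    then obtain j where j: "ptrunc p a j \<noteq> ptrunc p b j" using ptrunc_inject assms(2) ab by blast
    have "ptrunc p a K \<noteq> ptrunc p b K" if "j \<le> K" for K
      using j that ptrunc_mod assms(2) ab by metis
    then show ?thesis unfolding eventually_sequentially by blast
  qed simp
  then have "eventually (\<lambda>K. \<forall>a\<in>R. \<forall>b\<in>R. ptrunc p a K = ptrunc p b K \<longrightarrow> a = b) sequentially"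
    by (intro eventually_ball_finite assms(1) ballI *)
  then show ?thesis by (simp add: inj_on_def)
qed

text \<open>Finitely many roots are separated modulo P^K for large K and then inject into the limit
  classes. So every finite set of roots has at most n elements, which excludes infinitely many
  roots.\<close>

lemma card_padic_roots:
  assumes F: "coherent F" "\<And>k. degree (F k) \<le> n" "\<not> padic_zero F"
  shows "finite (padic_roots A F)" "card (padic_roots A F) \<le> n"
    and "eventually (\<lambda>K. card (lim_classes A K F) = card (padic_roots A F)) sequentially"
proof -
  have dig: "a \<in> padic_roots A F \<Longrightarrow> padic_digits p a" for a by (simp add: padic_roots_def)
  have le: "card R \<le> n" if R: "finite R" "R \<subseteq> padic_roots A F" for R
  proof -
    have "eventually (\<lambda>K. inj_on (\<lambda>a. ptrunc p a K) R \<and> K \<ge> 1) sequentially"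
      using eventually_inj_ptrunc[OF R(1)] dig R(2) by (intro eventually_conj eventually_ge_at_top) blast
    then obtain K where K: "inj_on (\<lambda>a. ptrunc p a K) R" "K \<ge> 1"
      using eventually_happens by fastforce
    have "lim_classes A K F \<subseteq> root_classes A K 0 (F 0)" by (auto simp: lim_classes_def)
    then have fin: "finite (lim_classes A K F)" by (rule finite_subset) simp
    have "card R \<le> card (lim_classes A K F)"
      using card_inj_on_le[OF K(1) _ fin] padic_roots_image[OF F(1) K(2), of A] R(2) by blast
    then show ?thesis using card_lim_classes_le[OF F] le_trans by blast
  qed
  show fin: "finite (padic_roots A F)"
  proof (rule ccontr)
    assume "infinite (padic_roots A F)"
    then obtain R where "finite R" "card R = Suc n" "R \<subseteq> padic_roots A F"
      using infinite_arbitrarily_large by blast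
    then show False using le by fastforce
  qed
  show "card (padic_roots A F) \<le> n" using le[OF fin] by simp
  have "eventually (\<lambda>K. inj_on (\<lambda>a. ptrunc p a K) (padic_roots A F) \<and> K \<ge> 1) sequentially"
    using eventually_inj_ptrunc[OF fin] dig by (intro eventually_conj eventually_ge_at_top) blast
  then show "eventually (\<lambda>K. card (lim_classes A K F) = card (padic_roots A F)) sequentially"
  proof eventually_elim
    case (elim K)
    then show ?case using padic_roots_image[OF F(1), of K A] card_image by metis
  qed
qed

end

section \<open>Haar distributed coefficients\<close>

context prime_weight
begin

abbreviation M :: "(nat \<times> nat \<Rightarrow> nat) measure" where "M \<equiv> digit_measure p"

abbreviation digit_pmf :: "nat pmf" where "digit_pmf \<equiv> pmf_of_set {0..<p}"

lemma product_prob_space_digits: "product_prob_space (\<lambda>_. measure_pmf digit_pmf)"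
  by unfold_locales

lemma prob_space_M: "prob_space M"
  unfolding digit_measure_def by (rule prob_space_PiM) (rule prob_space_measure_pmf)

lemma space_M [simp]: "space M = UNIV"
  by (simp add: digit_measure_def space_PiM)

lemma sets_M_component: "{w. w x \<in> A} \<in> sets M"
  using sets_Collect_single[of x UNIV A "\<lambda>_. measure_pmf digit_pmf"]
  by (simp add: digit_measure_def space_PiM)

lemma sets_M_cylinder:
  assumes "finite J"
  shows "{w. \<forall>x\<in>J. w x = v x} \<in> sets M"
proof -
  have "{w \<in> space M. w x \<in> {v x}} \<in> sets M" for x
    using sets_M_component[of x "{v x}"] by simp
  then have "{w \<in> space M. \<forall>x\<in>J. w x \<in> {v x}} \<in> sets M"
    by (intro sets.sets_Collect_finite_All assms)
  then show ?thesis by simp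
qed

text \<open>A function of finitely many digits is constant on cylinders, of which there are only
  countably many, so each preimage is a countable union of them.\<close>

lemma measurable_finite_dim:
  assumes J: "finite J" and h: "\<And>w w'. (\<And>x. x \<in> J \<Longrightarrow> w x = w' x) \<Longrightarrow> h w = h w'"
  shows "h \<in> measurable M (count_space UNIV)"
proof (rule measurableI)
  fix A
  have "h -` A \<inter> space M = (\<Union>v\<in>{v \<in> PiE J (\<lambda>_. UNIV). h v \<in> A}. {w. \<forall>x\<in>J. w x = v x})"
  proof (intro set_eqI iffI)
    fix w assume "w \<in> h -` A \<inter> space M"
    moreover have "h w = h (restrict w J)" by (rule h) simp
    ultimately show "w \<in> (\<Union>v\<in>{v \<in> PiE J (\<lambda>_. UNIV). h v \<in> A}. {w. \<forall>x\<in>J. w x = v x})"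
      by (intro UN_I[of "restrict w J"]) auto
  next
    fix w assume "w \<in> (\<Union>v\<in>{v \<in> PiE J (\<lambda>_. UNIV). h v \<in> A}. {w. \<forall>x\<in>J. w x = v x})"
    then obtain v where "h v \<in> A" "\<And>x. x \<in> J \<Longrightarrow> w x = v x" by auto
    then show "w \<in> h -` A \<inter> space M" using h[of w v] by simp
  qed
  moreover have "countable {v \<in> PiE J (\<lambda>_. UNIV :: nat set). h v \<in> A}"
    by (rule countable_subset[of _ "PiE J (\<lambda>_. UNIV)"]) (auto intro: countable_PiE J)
  ultimately show "h -` A \<inter> space M \<in> sets M"
    using sets_M_cylinder[OF J] by (auto intro!: sets.countable_UN')
qed simp

text \<open>Points of the sample space are arbitrary families of natural numbers; only off a null
  set are they p-adic digits.\<close>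

lemma AE_digits: "AE w in M. \<forall>x. w x < p"
proof -
  have "AE w in M. w x < p" for x
    unfolding digit_measure_def
  proof (rule AE_PiM_component)
    show "AE d in measure_pmf digit_pmf. d < p"
      using p_pos by (auto simp: AE_measure_pmf_iff set_pmf_of_set)
  qed (auto intro: prob_space_measure_pmf)
  then show ?thesis by (simp add: AE_all_countable)
qed

lemma prob_cylinder:
  assumes J: "finite J" and v: "\<And>x. x \<in> J \<Longrightarrow> v x < p"
  shows "measure M {w. \<forall>x\<in>J. w x = v x} = (1 / p) ^ card J"
proof -
  interpret product_prob_space "\<lambda>_. measure_pmf digit_pmf" "UNIV :: (nat \<times> nat) set"
    by (rule product_prob_space_digits)
  have "emeasure M {w \<in> space M. \<forall>x\<in>J. w x \<in> {v x}} = (\<Prod>x\<in>J. emeasure (measure_pmf digit_pmf) {v x})"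
    unfolding digit_measure_def by (rule emeasure_PiM_Collect) (use J in auto)
  also have "\<dots> = (\<Prod>x\<in>J. ennreal (1 / p))"
    using v p_pos by (intro prod.cong refl) (simp add: emeasure_pmf_single pmf_of_set indicator_def)
  also have "\<dots> = ennreal ((1 / p) ^ card J)" by (simp add: ennreal_power)
  finally show ?thesis by (simp add: measure_def)
qed

abbreviation res_polys :: "nat \<Rightarrow> nat \<Rightarrow> int poly set" where
  "res_polys n k \<equiv> polys (\<lambda>i. if i < n then res k else {0})"

definition haar_poly :: "nat \<Rightarrow> nat \<Rightarrow> (nat \<times> nat \<Rightarrow> nat) \<Rightarrow> int poly" where
  "haar_poly n k w = poly_upto n (\<lambda>i. ptrunc p (coef_full w i) k)"

lemma measurable_ptrunc_finite_dim:
  assumes "\<And>w w'. (\<And>i. i < n \<Longrightarrow> ptrunc p (coef_full w i) k = ptrunc p (coef_full w' i) k) \<Longrightarrow> h w = h w'"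
  shows "h \<in> measurable M (count_space UNIV)"
proof (rule measurable_finite_dim[of "{..<n} \<times> {..<k}"])
  fix w w' :: "nat \<times> nat \<Rightarrow> nat"
  assume eq: "\<And>x. x \<in> {..<n} \<times> {..<k} \<Longrightarrow> w x = w' x"
  show "h w = h w'"
    by (rule assms) (use eq in \<open>simp add: ptrunc_def coef_full_def\<close>)
qed simp

lemma haar_poly_eqD: "haar_poly n k w = f \<Longrightarrow> i < n \<Longrightarrow> ptrunc p (coef_full w i) k = coeff f i"
  by (auto simp: haar_poly_def coeff_poly_upto)

lemma measurable_haar_poly [measurable]: "haar_poly n k \<in> measurable M (count_space UNIV)"
  by (rule measurable_ptrunc_finite_dim[of n k]) (simp add: haar_poly_def poly_upto_def)

lemma ptrunc_eq_iff:
  assumes "padic_digits p a" "padic_digits p b"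
  shows "ptrunc p a k = ptrunc p b k \<longleftrightarrow> (\<forall>j<k. a j = b j)"
proof
  assume eq: "ptrunc p a k = ptrunc p b k"
  show "\<forall>j<k. a j = b j"
  proof (intro allI impI)
    fix j assume "j < k"
    then have "ptrunc p a (Suc j) = ptrunc p b (Suc j)" "ptrunc p a j = ptrunc p b j"
      using eq ptrunc_mod[OF assms(1)] ptrunc_mod[OF assms(2)] by (metis Suc_leI, metis less_imp_le)
    then show "a j = b j" using P_gt_1 by (simp add: ptrunc_Suc)
  qed
qed (simp add: ptrunc_def)

text \<open>Prescribing n coefficients modulo P^k prescribes n k digits. The two events are compared
  almost surely, since truncations determine digits that are below p.\<close>

lemma prob_haar_poly:
  assumes f: "f \<in> res_polys n k"
  shows "measure M {w. haar_poly n k w = f} = (1 / p) ^ (n * k)"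
proof -
  have c: "coeff f i \<in> (if i < n then res k else {0})" for i using f by (simp add: polys_def)
  have "\<exists>a. padic_digits p a \<and> ptrunc p a k = coeff f i" if "i < n" for i
  proof -
    have "\<exists>a. padic_digits p a \<and> (\<forall>j. ptrunc p a j = coeff f i mod P ^ j)"
      by (rule padic_digits_exist) (auto simp: mod_in_res mod_mod_cancel)
    moreover have "coeff f i mod P ^ k = coeff f i" using c[of i] that by (simp add: res_def)
    ultimately show ?thesis by metis
  qed
  then obtain dg where dg: "\<And>i. i < n \<Longrightarrow> padic_digits p (dg i) \<and> ptrunc p (dg i) k = coeff f i" by metis
  let ?C = "{w. \<forall>x\<in>{..<n} \<times> {..<k}. w x = dg (fst x) (snd x)}"
  have "measure M {w. haar_poly n k w = f} = measure M ?C"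
  proof (rule measure_eq_AE)
    show "AE w in M. w \<in> {w. haar_poly n k w = f} \<longleftrightarrow> w \<in> ?C"
      using AE_digits
    proof eventually_elim
      case (elim w)
      have pd: "padic_digits p (coef_full w i)" for i using elim by (simp add: padic_digits_def coef_full_def)
      have "haar_poly n k w = f \<longleftrightarrow> (\<forall>i<n. ptrunc p (coef_full w i) k = ptrunc p (dg i) k)"
      proof
        assume "haar_poly n k w = f"
        then show "\<forall>i<n. ptrunc p (coef_full w i) k = ptrunc p (dg i) k" using haar_poly_eqD dg by metis
      next
        assume "\<forall>i<n. ptrunc p (coef_full w i) k = ptrunc p (dg i) k"
        then show "haar_poly n k w = f"
          using dg c by (intro poly_eqI) (force simp: haar_poly_def coeff_poly_upto)
      qed
      also have "\<dots> \<longleftrightarrow> (\<forall>i<n. \<forall>j<k. coef_full w i j = dg i j)"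
        using ptrunc_eq_iff[OF pd] dg by blast
      also have "\<dots> \<longleftrightarrow> w \<in> ?C" by (auto simp: coef_full_def)
      finally show ?case by simp
    qed
    show "{w. haar_poly n k w = f} \<in> sets M"
      using measurable_sets[OF measurable_haar_poly, of "{f}" n k] by (simp add: vimage_def)
    show "?C \<in> sets M" by (rule sets_M_cylinder) simp
  qed
  also have "\<dots> = (1 / p) ^ card ({..<n} \<times> {..<k})"
    by (rule prob_cylinder) (use dg in \<open>auto simp: padic_digits_def\<close>)
  finally show ?thesis by (simp add: card_cartesian_product)
qed

text \<open>The bridge from integration to counting: the truncated random polynomial is uniform on
  its box.\<close>

lemma expectation_haar_poly:
  "(\<integral>w. \<psi> (haar_poly n k w) \<partial>M) = mean (res_polys n k) (\<psi> :: int poly \<Rightarrow> real)"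
proof -
  interpret prob_space M by (rule prob_space_M)
  define B where "B = res_polys n k"
  have fin: "finite B" unfolding B_def by (rule finite_polys[of n]) auto
  have meas: "{w. haar_poly n k w = f} \<in> sets M" for f
    using measurable_sets[OF measurable_haar_poly, of "{f}" n k] by (simp add: vimage_def)
  have "(\<integral>w. \<psi> (haar_poly n k w) \<partial>M) = (\<integral>w. (\<Sum>f\<in>B. \<psi> f * indicator {w. haar_poly n k w = f} w) \<partial>M)"
  proof (rule integral_cong_AE)
    show "AE w in M. \<psi> (haar_poly n k w) = (\<Sum>f\<in>B. \<psi> f * indicator {w. haar_poly n k w = f} w)"
      using AE_digits
    proof eventually_elim
      case (elim w)
      have "haar_poly n k w \<in> B"
        using elim by (auto simp: B_def polys_def haar_poly_def coeff_poly_upto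
            intro!: ptrunc_in_res simp: padic_digits_def coef_full_def)
      then show ?case using fin by (simp add: indicator_def sum.delta' if_distrib cong: if_cong)
    qed
    show "(\<lambda>w. \<psi> (haar_poly n k w)) \<in> borel_measurable M"
      by (rule measurable_compose[OF measurable_haar_poly]) simp
    show "(\<lambda>w. \<Sum>f\<in>B. \<psi> f * indicator {w. haar_poly n k w = f} w) \<in> borel_measurable M"
      using meas by (intro borel_measurable_sum borel_measurable_times) auto
  qed
  also have "\<dots> = (\<Sum>f\<in>B. \<integral>w. \<psi> f * indicator {w. haar_poly n k w = f} w \<partial>M)"
    using meas by (intro Bochner_Integration.integral_sum) (auto intro!: integrable_mult_right integrable_real_indicator simp: emeasure_eq_measure)
  also have "\<dots> = (\<Sum>f\<in>B. \<psi> f * (1 / p) ^ (n * k))"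
    using prob_haar_poly by (intro sum.cong refl) (simp add: B_def)
  also have "\<dots> = mean B \<psi>"
  proof -
    have "card B = (\<Prod>i<n. card (if i < n then res k else {0}))" unfolding B_def by (rule card_polys) simp
    then have "card B = p ^ (n * k)" by (simp add: card_res power_mult[symmetric] mult.commute)
    then show ?thesis by (simp add: mean_def sum_divide_distrib power_one_over)
  qed
  finally show ?thesis by (simp add: B_def)
qed

end

section \<open>Roots in the p-adic numbers\<close>

context prime_weight
begin

definition coef_poly :: "nat \<Rightarrow> (nat \<Rightarrow> nat \<Rightarrow> nat) \<Rightarrow> nat \<Rightarrow> int poly" where
  "coef_poly n c k = poly_upto (Suc n) (\<lambda>i. ptrunc p (c i) k)"

lemma coherent_coef_poly: "coherent (coef_poly n c)"
  by (auto simp: coherent_def coef_poly_def coeff_poly_upto ptrunc_Suc)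

lemma coherent_rev_at: "coherent F \<Longrightarrow> coherent (\<lambda>k. rev_at n (F k))"
  by (simp add: coherent_def coeff_rev_at)

lemma degree_rev_at: "degree (rev_at n f) \<le> n"
  by (rule degree_le) (simp add: coeff_rev_at)

lemma degree_coef_poly: "degree (coef_poly n c k) \<le> n"
  by (rule degree_le) (simp add: coef_poly_def coeff_poly_upto)

lemma padic_zero_rev_at:
  assumes "\<not> padic_zero (coef_poly n c)"
  shows "\<not> padic_zero (\<lambda>k. rev_at n (coef_poly n c k))"
proof
  assume *: "padic_zero (\<lambda>k. rev_at n (coef_poly n c k))"
  have "P ^ k dvd coeff (coef_poly n c k) i" for k i
  proof (cases "i \<le> n")
    case True
    then have "coeff (coef_poly n c k) i = coeff (rev_at n (coef_poly n c k)) (n - i)" by (simp add: coeff_rev_at)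
    then show ?thesis using * by (simp add: padic_zero_def)
  qed (simp add: coef_poly_def coeff_poly_upto)
  then show False using assms by (simp add: padic_zero_def)
qed

lemma poly_poly_upto: "poly (poly_upto n c) x = (\<Sum>i<n. c i * x ^ i)"
  by (simp add: poly_upto_def poly_sum poly_monom)

lemma qp_root_0_iff: "qp_root p n c a 0 \<longleftrightarrow> (\<forall>k. P ^ k dvd poly (coef_poly n c k) (ptrunc p a k))"
  by (simp add: qp_root_def coef_poly_def poly_poly_upto dvd_eq_mod_eq_0 lessThan_Suc_atMost)

text \<open>The root \<open>a / p ^ e\<close> outside \<open>Z_p\<close> corresponds to the root \<open>y = p ^ e / a\<close> of the reversed polynomial.\<close>

definition inverse_rel :: "(nat \<Rightarrow> nat) \<Rightarrow> nat \<Rightarrow> (nat \<Rightarrow> nat) \<Rightarrow> bool" where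
  "inverse_rel a e y \<longleftrightarrow> (\<forall>k. P ^ k dvd ptrunc p y k * ptrunc p a k - P ^ e)"

lemma inverse_relD: "inverse_rel a e y \<Longrightarrow> P ^ k dvd ptrunc p y k * ptrunc p a k - P ^ e"
  by (simp add: inverse_rel_def)

text \<open>\<open>ptrunc p a 0\<close> is 0 even for a unit a, hence the case distinction on
  j.\<close>

lemma coprime_ptrunc:
  assumes "padic_digits p a" "a 0 \<noteq> 0" and that: "k = 0 \<or> j \<ge> 1"
  shows "coprime (P ^ k) (ptrunc p a j)"
proof (cases "k = 0")
  case False
  then have "ptrunc p a j mod P = int (a 0)" using that ptrunc_mod_P[OF assms(1)] by simp
  then have "\<not> P dvd ptrunc p a j" using assms by (simp add: dvd_eq_mod_eq_0)
  then show ?thesis using prime_P prime_imp_coprime by (intro coprime_power_left_iff[THEN iffD2]) blast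
qed simp

text \<open>Modulo P^k the unit a has an inverse x by Bezout, and P^e x solves the congruence.
  Solutions at consecutive levels agree because a can be cancelled, so they are the truncations of
  one p-adic integer.\<close>

lemma inverse_rel_exists:
  assumes a: "padic_digits p a" "a 0 \<noteq> 0"
  shows "\<exists>y. padic_digits p y \<and> inverse_rel a e y"
proof -
  have "\<exists>s. s \<in> res k \<and> P ^ k dvd s * ptrunc p a k - P ^ e" for k
  proof -
    have "coprime (ptrunc p a k) (P ^ k)" using coprime_ptrunc[OF a, of k k] by (simp add: coprime_commute) auto
    then obtain x v where "x * ptrunc p a k + v * P ^ k = 1"
      using bezout_int[of "ptrunc p a k" "P ^ k"] by auto
    then have "x * ptrunc p a k - 1 = - v * P ^ k" by simp
    then have "P ^ k dvd x * ptrunc p a k - 1" by simp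
    then have "P ^ k dvd P ^ e * (x * ptrunc p a k - 1)" by (rule dvd_mult)
    then have 1: "P ^ k dvd (P ^ e * x) * ptrunc p a k - P ^ e" by (simp add: algebra_simps)
    have "P ^ k dvd (P ^ e * x - (P ^ e * x) mod P ^ k) * ptrunc p a k" by (simp add: dvd_minus_mod)
    with 1 have "P ^ k dvd ((P ^ e * x) * ptrunc p a k - P ^ e) - (P ^ e * x - (P ^ e * x) mod P ^ k) * ptrunc p a k"
      by (rule dvd_diff)
    then have "P ^ k dvd ((P ^ e * x) mod P ^ k) * ptrunc p a k - P ^ e" by (simp add: algebra_simps)
    then show ?thesis using mod_in_res by blast
  qed
  then obtain s where s: "\<And>k. s k \<in> res k" "\<And>k. P ^ k dvd s k * ptrunc p a k - P ^ e" by metis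
  have "s (Suc k) mod P ^ k = s k" for k
  proof -
    have "P ^ k dvd P ^ Suc k" by (simp add: le_imp_power_dvd)
    then have 1: "P ^ k dvd s (Suc k) * ptrunc p a (Suc k) - P ^ e" using s(2)[of "Suc k"] by (rule dvd_trans)
    have "s (Suc k) * ptrunc p a (Suc k) - P ^ e - (s k * ptrunc p a k - P ^ e)
      = (s (Suc k) - s k) * ptrunc p a k + P ^ k * (s (Suc k) * int (a k))"
      by (simp add: ptrunc_Suc algebra_simps)
    moreover have "P ^ k dvd s (Suc k) * ptrunc p a (Suc k) - P ^ e - (s k * ptrunc p a k - P ^ e)"
      by (rule dvd_diff[OF 1 s(2)])
    ultimately have "P ^ k dvd (s (Suc k) - s k) * ptrunc p a k" by (metis dvd_add_left_iff dvd_triv_left)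
    moreover have "coprime (P ^ k) (ptrunc p a k)" using coprime_ptrunc[OF a, of k k] by (cases k) auto
    ultimately have "P ^ k dvd s (Suc k) - s k" by (simp add: coprime_dvd_mult_left_iff)
    then show ?thesis using s(1)[of k] by (simp add: mod_eq_dvd_iff[symmetric] res_def)
  qed
  then obtain y where "padic_digits p y" "\<And>k. ptrunc p y k = s k" using padic_digits_exist[of s] s(1) by blast
  then show ?thesis using s(2) by (auto simp: inverse_rel_def)
qed

lemma inverse_rel_unique_right:
  assumes a: "padic_digits p a" "a 0 \<noteq> 0" and y: "padic_digits p y" "padic_digits p y'"
    and rel: "inverse_rel a e y" "inverse_rel a e y'"
  shows "y = y'"
proof (rule ptrunc_inject[OF y])
  fix k
  have "P ^ k dvd (ptrunc p y k * ptrunc p a k - P ^ e) - (ptrunc p y' k * ptrunc p a k - P ^ e)"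
    by (rule dvd_diff[OF inverse_relD[OF rel(1)] inverse_relD[OF rel(2)]])
  then have "P ^ k dvd (ptrunc p y k - ptrunc p y' k) * ptrunc p a k" by (simp add: algebra_simps)
  moreover have "coprime (P ^ k) (ptrunc p a k)" using coprime_ptrunc[OF a, of k k] by (cases k) auto
  ultimately have "P ^ k dvd ptrunc p y k - ptrunc p y' k" by (simp add: coprime_dvd_mult_left_iff)
  then show "ptrunc p y k = ptrunc p y' k" using res_eqI ptrunc_in_res y by blast
qed

text \<open>Eliminating y gives a' P^e = a P^e' modulo every P^k. As a and a' are units, the
  valuations give e = e', and then P^e cancels.\<close>

lemma inverse_rel_unique_left:
  assumes a: "padic_digits p a" "a 0 \<noteq> 0" and a': "padic_digits p a'" "a' 0 \<noteq> 0"
    and rel: "inverse_rel a e y" "inverse_rel a' e' y"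
  shows "a = a' \<and> e = e'"
proof -
  have key: "P ^ k dvd ptrunc p a' k * P ^ e - ptrunc p a k * P ^ e'"
    if "inverse_rel a e y" "inverse_rel a' e' y" for a a' e e' k
  proof -
    have "P ^ k dvd ptrunc p a k * (ptrunc p y k * ptrunc p a' k - P ^ e')
        - ptrunc p a' k * (ptrunc p y k * ptrunc p a k - P ^ e)"
      by (rule dvd_diff[OF dvd_mult[OF inverse_relD[OF that(2)]] dvd_mult[OF inverse_relD[OF that(1)]]])
    then show ?thesis by (simp add: algebra_simps)
  qed
  have le: "e' \<le> e" if a': "padic_digits p a'" "a' 0 \<noteq> 0"
    and rel: "inverse_rel a e y" "inverse_rel a' e' y" for a a' e e'
  proof (rule ccontr)
    assume "\<not> e' \<le> e"
    then have "P ^ Suc e dvd ptrunc p a (Suc e) * P ^ e'" by (intro dvd_mult le_imp_power_dvd) simp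
    then have "P ^ Suc e dvd ptrunc p a' (Suc e) * P ^ e" using key[OF rel, of "Suc e"] by (simp add: dvd_diff_left_iff)
    then have "P dvd ptrunc p a' (Suc e)" using P_gt_1 by simp
    then show False using ptrunc_mod_P[OF a'(1), of "Suc e"] a'(2) by (simp add: dvd_eq_mod_eq_0)
  qed
  have e: "e = e'" using le[OF a' rel] le[OF a rel(2,1)] by simp
  \<comment> \<open>Cancelling P^e costs e digits, so level e + k is used to compare k of
    them.\<close>
  have "ptrunc p a k = ptrunc p a' k" for k
  proof -
    have "P ^ e * P ^ k dvd P ^ e * (ptrunc p a' (e + k) - ptrunc p a (e + k))"
      using key[OF rel, of "e + k"] e by (simp add: power_add algebra_simps)
    then have "P ^ k dvd ptrunc p a' (e + k) - ptrunc p a (e + k)" using P_gt_1 by simp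
    then have "ptrunc p a' (e + k) mod P ^ k = ptrunc p a (e + k) mod P ^ k" by (simp add: mod_eq_dvd_iff)
    then show ?thesis using ptrunc_mod[OF a(1)] ptrunc_mod[OF a'(1)] by simp
  qed
  then show ?thesis using ptrunc_inject[OF a(1) a'(1)] e by simp
qed

text \<open>Multiplying the reversed polynomial at y by a^n turns its terms into c_i a^i (y a)^(n -
  i), where y a is P^e up to multiples of P^k; the unit a^n does not affect divisibility.\<close>

lemma inverse_rel_root_iff:
  assumes a: "padic_digits p a" "a 0 \<noteq> 0" and rel: "inverse_rel a e y"
  shows "qp_root p n c a e \<longleftrightarrow> (\<forall>k. P ^ k dvd poly (rev_at n (coef_poly n c k)) (ptrunc p y k))"
proof -
  have "(\<Sum>i\<le>n. ptrunc p (c i) k * ptrunc p a k ^ i * P ^ (e * (n - i))) mod P ^ k = 0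
    \<longleftrightarrow> P ^ k dvd poly (rev_at n (coef_poly n c k)) (ptrunc p y k)" for k
  proof -
    define A Y where "A = ptrunc p a k" and "Y = ptrunc p y k"
    define S where "S = (\<Sum>i\<le>n. ptrunc p (c i) k * A ^ i * P ^ (e * (n - i)))"
    have "poly (rev_at n (coef_poly n c k)) Y = (\<Sum>i\<le>n. ptrunc p (c (n - i)) k * Y ^ i)"
      by (simp add: rev_at_def poly_poly_upto lessThan_Suc_atMost coef_poly_def coeff_poly_upto less_Suc_eq_le)
    also have "\<dots> = (\<Sum>i\<le>n. ptrunc p (c i) k * Y ^ (n - i))"
      by (rule sum.reindex_bij_witness[of _ "\<lambda>i. n - i" "\<lambda>i. n - i"]) auto
    finally have "A ^ n * poly (rev_at n (coef_poly n c k)) Y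
      = (\<Sum>i\<le>n. A ^ n * (ptrunc p (c i) k * Y ^ (n - i)))" by (simp add: sum_distrib_left)
    also have "\<dots> = (\<Sum>i\<le>n. ptrunc p (c i) k * A ^ i * (Y * A) ^ (n - i))"
    proof (intro sum.cong refl)
      fix i assume "i \<in> {..n}"
      then have "A ^ n = A ^ i * A ^ (n - i)" by (simp flip: power_add)
      then show "A ^ n * (ptrunc p (c i) k * Y ^ (n - i)) = ptrunc p (c i) k * A ^ i * (Y * A) ^ (n - i)"
        by (simp add: power_mult_distrib mult_ac)
    qed
    finally have eq: "A ^ n * poly (rev_at n (coef_poly n c k)) Y
      = (\<Sum>i\<le>n. ptrunc p (c i) k * A ^ i * (Y * A) ^ (n - i))" .
    have "P ^ k dvd (Y * A) ^ m - P ^ (e * m)" for m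
    proof -
      have "P ^ k dvd Y * A - P ^ e" using rel by (simp add: inverse_rel_def A_def Y_def)
      also have "Y * A - P ^ e dvd (Y * A) ^ m - (P ^ e) ^ m"
        using poly_diff_dvd_poly[of "Y * A" "P ^ e" "monom 1 m"] by (simp add: poly_monom)
      finally show ?thesis by (simp add: power_mult)
    qed
    then have "P ^ k dvd (\<Sum>i\<le>n. ptrunc p (c i) k * A ^ i * ((Y * A) ^ (n - i) - P ^ (e * (n - i))))"
      by (intro dvd_sum dvd_mult)
    also have "\<dots> = A ^ n * poly (rev_at n (coef_poly n c k)) Y - S"
      by (simp only: eq S_def sum_subtractf right_diff_distrib)
    finally have "P ^ k dvd S \<longleftrightarrow> P ^ k dvd A ^ n * poly (rev_at n (coef_poly n c k)) Y"
      by (metis dvd_diff_left_iff dvd_diff_right_iff)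
    also have "coprime (P ^ k) (A ^ n)"
      using coprime_ptrunc[OF a, of k k] unfolding A_def by (cases k) auto
    then have "P ^ k dvd A ^ n * poly (rev_at n (coef_poly n c k)) Y \<longleftrightarrow> P ^ k dvd poly (rev_at n (coef_poly n c k)) Y"
      by (simp add: coprime_dvd_mult_right_iff)
    finally show ?thesis by (simp add: S_def A_def Y_def dvd_eq_mod_eq_0)
  qed
  then show ?thesis by (simp add: qp_root_def)
qed

definition roots_outside :: "nat \<Rightarrow> (nat \<Rightarrow> nat \<Rightarrow> nat) \<Rightarrow> ((nat \<Rightarrow> nat) \<times> nat) set" where
  "roots_outside n c = {(a, e). e \<ge> 1 \<and> padic_digits p a \<and> a 0 \<noteq> 0 \<and> qp_root p n c a e}"

text \<open>For e >= 1 the number y = p^e / a is nonzero and reduces to 0. Conversely a nonzero y in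
  p Z_p has a valuation e >= 1 and a unit part b, and a is the inverse of b. The zero sequence
  stands for infinity and is removed.\<close>

lemma card_roots_outside:
  fixes n c
  defines "R \<equiv> padic_roots {0} (\<lambda>k. rev_at n (coef_poly n c k)) - {\<lambda>_. 0}"
  shows "\<exists>\<phi>. bij_betw \<phi> (roots_outside n c) R"
proof -
  have ex_y: "\<exists>y\<in>R. inverse_rel a e y" if "(a, e) \<in> roots_outside n c" for a e
  proof -
    have a: "e \<ge> 1" "padic_digits p a" "a 0 \<noteq> 0" "qp_root p n c a e" using that by (auto simp: roots_outside_def)
    obtain y where y: "padic_digits p y" "inverse_rel a e y" using inverse_rel_exists a by blast
    have "y 0 = 0"
    proof -
      have "P dvd ptrunc p y 1 * ptrunc p a 1 - P ^ e" using y(2) unfolding inverse_rel_def by (metis power_one_right)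
      moreover have "P dvd P ^ e" using a(1) by simp
      ultimately have "P dvd ptrunc p y 1 * ptrunc p a 1" by (simp add: dvd_diff_left_iff)
      moreover have "coprime P (ptrunc p a 1)" using coprime_ptrunc[OF a(2,3), of 1 1] by simp
      ultimately have "P dvd ptrunc p y 1" by (simp add: coprime_dvd_mult_left_iff)
      then show ?thesis using ptrunc_mod_P[OF y(1), of 1] by (simp add: dvd_eq_mod_eq_0)
    qed
    moreover have "y \<noteq> (\<lambda>_. 0)"
    proof
      assume "y = (\<lambda>_. 0)"
      then have "ptrunc p y (Suc e) = 0" by (simp add: ptrunc_def)
      then have "P ^ Suc e dvd P ^ e" using y(2) unfolding inverse_rel_def
        by (metis diff_0 dvd_minus_iff mult_zero_left)
      then have "P ^ Suc e \<le> P ^ e" using P_gt_1 by (intro zdvd_imp_le) auto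
      then show False using P_gt_1 by simp
    qed
    ultimately have "y \<in> R"
      using y a inverse_rel_root_iff[OF a(2,3) y(2)] by (simp add: R_def padic_roots_def)
    then show ?thesis using y by blast
  qed
  have ex_a: "\<exists>x\<in>roots_outside n c. inverse_rel (fst x) (snd x) y" if y: "y \<in> R" for y
  proof -
    have y': "padic_digits p y" "y 0 = 0" "y \<noteq> (\<lambda>_. 0)" using y by (auto simp: R_def padic_roots_def)
    define e where "e = (LEAST j. y j \<noteq> 0)"
    have "\<exists>j. y j \<noteq> 0" using y'(3) by (auto simp: fun_eq_iff)
    then have ye: "y e \<noteq> 0" unfolding e_def by (rule LeastI_ex)
    have yl: "y j = 0" if "j < e" for j using not_less_Least that unfolding e_def by blast
    have e1: "e \<ge> 1" using ye y'(2) by (cases e) auto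
    define b where "b j = y (j + e)" for j
    have b: "padic_digits p b" "b 0 \<noteq> 0" using y'(1) ye by (auto simp: padic_digits_def b_def)
    have y0: "ptrunc p y e = 0" using yl by (simp add: ptrunc_def)
    have yb: "ptrunc p y (e + k) = P ^ e * ptrunc p b k" for k
      by (induction k) (simp_all add: y0 ptrunc_Suc b_def power_add algebra_simps)
    obtain a where a: "padic_digits p a" "inverse_rel b 0 a" using inverse_rel_exists[OF b] by blast
    have a0: "a 0 \<noteq> 0"
    proof
      assume "a 0 = 0"
      then have "ptrunc p a 1 = 0" by (simp add: ptrunc_Suc)
      then have "P ^ 1 dvd 0 * ptrunc p b 1 - P ^ 0" using a(2) unfolding inverse_rel_def by metis
      then show False using P_gt_1 by simp
    qed
    have rel: "inverse_rel a e y" unfolding inverse_rel_def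
    proof
      fix k
      have 1: "P ^ k dvd ptrunc p a k * ptrunc p b k - 1" using a(2) unfolding inverse_rel_def by (metis power_0)
      have 2: "P ^ k dvd P ^ e * ptrunc p b k - ptrunc p y k"
        using ptrunc_cong_mod[of k "e + k" p y] by (simp add: yb)
      have "P ^ k dvd P ^ e * (ptrunc p a k * ptrunc p b k - 1) - (P ^ e * ptrunc p b k - ptrunc p y k) * ptrunc p a k"
        by (rule dvd_diff[OF dvd_mult[OF 1] dvd_mult2[OF 2]])
      then show "P ^ k dvd ptrunc p y k * ptrunc p a k - P ^ e" by (simp add: algebra_simps)
    qed
    then have "(a, e) \<in> roots_outside n c"
      using a a0 e1 y inverse_rel_root_iff[OF a(1) a0 rel] by (simp add: roots_outside_def R_def padic_roots_def)
    then show ?thesis using rel by force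
  qed
  \<comment> \<open>The choice is forced by \<open>inverse_rel_unique_right\<close>, which is what
    gives surjectivity.\<close>
  define \<phi> where "\<phi> x = (SOME y. y \<in> R \<and> inverse_rel (fst x) (snd x) y)" for x
  have \<phi>: "\<phi> x \<in> R \<and> inverse_rel (fst x) (snd x) (\<phi> x)" if "x \<in> roots_outside n c" for x
  proof -
    have "\<exists>y. y \<in> R \<and> inverse_rel (fst x) (snd x) y" using ex_y[of "fst x" "snd x"] that by auto
    then show ?thesis unfolding \<phi>_def by (rule someI_ex)
  qed
  have dig: "padic_digits p (fst x) \<and> fst x 0 \<noteq> 0" if "x \<in> roots_outside n c" for x
    using that by (auto simp: roots_outside_def)
  have digR: "padic_digits p y" if "y \<in> R" for y using that by (simp add: R_def padic_roots_def)
  have "bij_betw \<phi> (roots_outside n c) R"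
  proof (rule bij_betw_imageI)
    show "inj_on \<phi> (roots_outside n c)"
    proof (rule inj_onI)
      fix x x' assume x: "x \<in> roots_outside n c" "x' \<in> roots_outside n c" "\<phi> x = \<phi> x'"
      then have "fst x = fst x' \<and> snd x = snd x'"
        using inverse_rel_unique_left \<phi> dig by metis
      then show "x = x'" by (simp add: prod_eq_iff)
    qed
    show "\<phi> ` roots_outside n c = R"
    proof (intro set_eqI iffI)
      fix y assume y: "y \<in> R"
      obtain x where x: "x \<in> roots_outside n c" "inverse_rel (fst x) (snd x) y" using ex_a[OF y] by blast
      have "y = \<phi> x" using inverse_rel_unique_right x \<phi>[OF x(1)] dig[OF x(1)] digR y by blast
      then show "y \<in> \<phi> ` roots_outside n c" using x(1) by blast
    qed (use \<phi> in auto)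
  qed
  then show ?thesis by blast
qed

lemma qp_roots_split: "qp_roots p n c = (\<lambda>a. (a, 0)) ` padic_roots UNIV (coef_poly n c) \<union> roots_outside n c"
proof (intro set_eqI iffI)
  fix x assume x: "x \<in> qp_roots p n c"
  then show "x \<in> (\<lambda>a. (a, 0)) ` padic_roots UNIV (coef_poly n c) \<union> roots_outside n c"
  proof (cases "snd x = 0")
    case True
    then have "fst x \<in> padic_roots UNIV (coef_poly n c)"
      using x by (auto simp: qp_roots_def padic_roots_def qp_root_0_iff)
    then show ?thesis using True by (cases x) auto
  qed (auto simp: qp_roots_def roots_outside_def)
qed (auto simp: qp_roots_def padic_roots_def qp_root_0_iff roots_outside_def)

text \<open>The reversed polynomial vanishes at 0 exactly when the leading coefficient is 0. This
  root at infinity is the extra 1 on the left.\<close>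

lemma num_roots_full:
  assumes nz: "\<not> padic_zero (coef_poly n c)"
  shows "num_roots p n c + (if \<forall>k. P ^ k dvd ptrunc p (c n) k then 1 else 0)
    = card (padic_roots UNIV (coef_poly n c)) + card (padic_roots {0} (\<lambda>k. rev_at n (coef_poly n c k)))"
proof -
  define R where "R = padic_roots {0} (\<lambda>k. rev_at n (coef_poly n c k))"
  have fin1: "finite (padic_roots UNIV (coef_poly n c))"
    by (rule card_padic_roots[OF coherent_coef_poly degree_coef_poly nz])
  have nz': "\<not> padic_zero (\<lambda>k. rev_at n (coef_poly n c k))"
    using nz by (rule padic_zero_rev_at)
  have fin2: "finite R" unfolding R_def
    by (rule card_padic_roots[OF coherent_rev_at[OF coherent_coef_poly] degree_rev_at nz'])
  obtain \<phi> where \<phi>: "bij_betw \<phi> (roots_outside n c) (R - {\<lambda>_. 0})"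
    using card_roots_outside unfolding R_def by blast
  then have fin3: "finite (roots_outside n c)" and card3: "card (roots_outside n c) = card (R - {\<lambda>_. 0})"
    using bij_betw_finite bij_betw_same_card fin2 by blast+
  have "num_roots p n c = card ((\<lambda>a. (a, 0::nat)) ` padic_roots UNIV (coef_poly n c)) + card (roots_outside n c)"
    unfolding num_roots_def qp_roots_split
    by (rule card_Un_disjoint) (use fin1 fin3 in \<open>auto simp: roots_outside_def\<close>)
  also have "card ((\<lambda>a. (a, 0::nat)) ` padic_roots UNIV (coef_poly n c)) = card (padic_roots UNIV (coef_poly n c))"
    by (rule card_image) (simp add: inj_on_def)
  finally have 1: "num_roots p n c = card (padic_roots UNIV (coef_poly n c)) + card (R - {\<lambda>_. 0})" by (simp add: card3)
  have "(\<lambda>_. 0) \<in> R \<longleftrightarrow> (\<forall>k. P ^ k dvd ptrunc p (c n) k)"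
  proof -
    have "ptrunc p (\<lambda>_. 0) k = 0" for k by (simp add: ptrunc_def)
    moreover have "poly f 0 = coeff f 0" for f :: "int poly" by (simp add: poly_0_coeff_0)
    ultimately show ?thesis using p_pos
      by (simp add: R_def padic_roots_def padic_digits_def coeff_rev_at coef_poly_def coeff_poly_upto)
  qed
  then have "card R = card (R - {\<lambda>_. 0}) + (if \<forall>k. P ^ k dvd ptrunc p (c n) k then 1 else 0)"
    using card_Suc_Diff1[OF fin2, of "\<lambda>_. 0"] by (auto simp del: card_Diff_insert)
  then show ?thesis using 1 by (simp add: R_def)
qed

text \<open>Every canonical pair is a root of the zero polynomial, whichever digit sequences
  represent it. So \<open>num_roots\<close> is constant, and thereby measurable, on this exceptional
  event.\<close>

lemma num_roots_zero:
  assumes "padic_zero (coef_poly n c)" "padic_zero (coef_poly n c')"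
  shows "num_roots p n c = num_roots p n c'"
proof -
  have "qp_roots p n c = {(a, e). padic_digits p a \<and> (e = 0 \<or> a 0 \<noteq> 0)}"
    if "padic_zero (coef_poly n c)" for c
  proof -
    have "P ^ k dvd ptrunc p (c i) k" if "i \<le> n" for i k
      using \<open>padic_zero (coef_poly n c)\<close> that
      by (auto simp: padic_zero_def coef_poly_def coeff_poly_upto dest!: spec[of _ k] spec[of _ i] split: if_splits)
    then have "P ^ k dvd (\<Sum>i\<le>n. ptrunc p (c i) k * ptrunc p a k ^ i * P ^ (e * (n - i)))" for a e k
      by (intro dvd_sum dvd_mult2) auto
    then show ?thesis by (simp add: qp_roots_def qp_root_def dvd_eq_mod_eq_0)
  qed
  then show ?thesis using assms by (simp add: num_roots_def)
qed

lemma ptrunc_padic_one: "ptrunc p padic_one k = (if k = 0 then 0 else 1)"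
  by (induction k) (auto simp: ptrunc_Suc padic_one_def)

end

section \<open>Passage to the limit\<close>

text \<open>The order matters: k tends to infinity before K. Asking for the inner limit at large K
  only admits identities that hold from some K on.\<close>

definition lim2 :: "(nat \<Rightarrow> nat \<Rightarrow> real) \<Rightarrow> real \<Rightarrow> bool" where
  "lim2 f L \<longleftrightarrow> (\<exists>g. (\<forall>\<^sub>F K in sequentially. f K \<longlonglongrightarrow> g K) \<and> g \<longlonglongrightarrow> L)"

lemma lim2_unique:
  assumes "lim2 f L" "lim2 f L'"
  shows "L = L'"
proof -
  obtain g g' where g: "\<forall>\<^sub>F K in sequentially. f K \<longlonglongrightarrow> g K" "g \<longlonglongrightarrow> L"
    and g': "\<forall>\<^sub>F K in sequentially. f K \<longlonglongrightarrow> g' K" "g' \<longlonglongrightarrow> L'"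
    using assms by (auto simp: lim2_def)
  have "\<forall>\<^sub>F K in sequentially. g K = g' K"
    using g(1) g'(1) by eventually_elim (rule LIMSEQ_unique)
  then have "g' \<longlonglongrightarrow> L" using g(2) tendsto_cong by blast
  then show ?thesis using g'(2) LIMSEQ_unique by blast
qed

lemma lim2_cong:
  assumes "\<forall>\<^sub>F K in sequentially. \<forall>\<^sub>F k in sequentially. f K k = f' K k" "lim2 f L"
  shows "lim2 f' L"
proof -
  obtain g where g: "\<forall>\<^sub>F K in sequentially. f K \<longlonglongrightarrow> g K" "g \<longlonglongrightarrow> L"
    using assms(2) by (auto simp: lim2_def)
  have "\<forall>\<^sub>F K in sequentially. f' K \<longlonglongrightarrow> g K"
    using assms(1) g(1) by eventually_elim (use tendsto_cong in blast)
  then show ?thesis using g(2) by (auto simp: lim2_def)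
qed

lemma lim2_cong_ge:
  assumes "\<And>K k. K \<ge> K0 \<Longrightarrow> k \<ge> k0 \<Longrightarrow> f K k = f' K k" "lim2 f L"
  shows "lim2 f' L"
  by (rule lim2_cong[OF _ assms(2)]) (use assms(1) in \<open>auto simp: eventually_sequentially\<close>)

lemma lim2_const: "lim2 (\<lambda>_ _. c) c"
  unfolding lim2_def by (intro exI[of _ "\<lambda>_. c"]) simp

lemma lim2_binop:
  assumes "lim2 f L" "lim2 f' L'"
    and op: "\<And>a b x y. a \<longlonglongrightarrow> x \<Longrightarrow> b \<longlonglongrightarrow> y \<Longrightarrow> (\<lambda>n::nat. op (a n) (b n)) \<longlonglongrightarrow> (op x y :: real)"
  shows "lim2 (\<lambda>K k. op (f K k) (f' K k)) (op L L')"
proof -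
  obtain g g' where g: "\<forall>\<^sub>F K in sequentially. f K \<longlonglongrightarrow> g K" "g \<longlonglongrightarrow> L"
    and g': "\<forall>\<^sub>F K in sequentially. f' K \<longlonglongrightarrow> g' K" "g' \<longlonglongrightarrow> L'"
    using assms by (auto simp: lim2_def)
  have "\<forall>\<^sub>F K in sequentially. (\<lambda>k. op (f K k) (f' K k)) \<longlonglongrightarrow> op (g K) (g' K)"
    using g(1) g'(1) by eventually_elim (rule op)
  then show ?thesis unfolding lim2_def
    by (intro exI[of _ "\<lambda>K. op (g K) (g' K)"] conjI op g(2) g'(2))
qed

lemma lim2_add: "lim2 f L \<Longrightarrow> lim2 f' L' \<Longrightarrow> lim2 (\<lambda>K k. f K k + f' K k) (L + L')"
  by (rule lim2_binop[where op = "(+)"]) (assumption | rule tendsto_add)+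

lemma lim2_mult: "lim2 f L \<Longrightarrow> lim2 f' L' \<Longrightarrow> lim2 (\<lambda>K k. f K k * f' K k) (L * L')"
  by (rule lim2_binop[where op = "(*)"]) (assumption | rule tendsto_mult)+

lemma lim2_cmult: "lim2 f L \<Longrightarrow> lim2 (\<lambda>K k. c * f K k) (c * L)"
  by (rule lim2_mult[OF lim2_const])

lemma lim2_sum:
  "(\<And>i. i \<in> I \<Longrightarrow> lim2 (f i) (L i)) \<Longrightarrow> lim2 (\<lambda>K k. \<Sum>i\<in>I. f i K k) (\<Sum>i\<in>I. L i)"
proof (induction I rule: infinite_finite_induct)
  case (insert x I)
  then show ?case using lim2_add[of "f x" "L x"] by simp
qed (simp_all add: lim2_const)

lemma lim2_pred_right: "lim2 f L \<Longrightarrow> lim2 (\<lambda>K k. f K (k - 1)) L"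
  unfolding lim2_def
proof (elim exE conjE)
  fix g assume g: "\<forall>\<^sub>F K in sequentially. f K \<longlonglongrightarrow> g K" "g \<longlonglongrightarrow> L"
  have "\<forall>\<^sub>F K in sequentially. (\<lambda>k. f K (k - 1)) \<longlonglongrightarrow> g K"
    using g(1)
  proof eventually_elim
    case (elim K)
    show ?case by (rule LIMSEQ_imp_Suc) (simp add: elim)
  qed
  then show "\<exists>g. (\<forall>\<^sub>F K in sequentially. (\<lambda>k. f K (k - 1)) \<longlonglongrightarrow> g K) \<and> g \<longlonglongrightarrow> L" using g(2) by blast
qed

lemma lim2_pred_left: "lim2 f L \<Longrightarrow> lim2 (\<lambda>K k. f (K - 1) k) L"
  unfolding lim2_def
proof (elim exE conjE)
  fix g assume g: "\<forall>\<^sub>F K in sequentially. f K \<longlonglongrightarrow> g K" "g \<longlonglongrightarrow> L"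
  have "\<forall>\<^sub>F K in sequentially. f (Suc K - 1) \<longlonglongrightarrow> g (Suc K - 1)" using g(1) by simp
  then have "\<forall>\<^sub>F K in sequentially. f (K - 1) \<longlonglongrightarrow> g (K - 1)"
    by (subst (asm) eventually_sequentially_Suc)
  moreover have "(\<lambda>K. g (K - 1)) \<longlonglongrightarrow> L" by (rule LIMSEQ_imp_Suc) (simp add: g(2))
  ultimately show "\<exists>h. (\<forall>\<^sub>F K in sequentially. f (K - 1) \<longlonglongrightarrow> h K) \<and> h \<longlonglongrightarrow> L"
    by (intro exI[of _ "\<lambda>K. g (K - 1)"] conjI)
qed

context prime_weight
begin

section \<open>Expectations in the three models as means over boxes\<close>

lemma root_classes_monics_1:
  assumes k: "k \<ge> 1" and K: "K \<ge> 1" and f: "f \<in> monics 1 n k"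
  shows "root_classes UNIV K k f = root_classes {0} K k f"
proof -
  have "a mod P ^ K mod P = 0" if "P ^ k dvd poly f a" for a
  proof -
    have "P dvd P ^ k" using k by simp
    then have "P dvd poly f a" using that by (rule dvd_trans)
    then have "P dvd a ^ n" using prime_dvd_mod_cong[OF monics_mod[OF f]] by blast
    then have "P dvd a" using prime_P prime_dvd_power by blast
    moreover have "P dvd P ^ K" using K by simp
    ultimately show ?thesis by (simp add: mod_mod_cancel)
  qed
  then show ?thesis by (auto simp: root_classes_def)
qed

lemma expectation_monic:
  assumes k: "k \<ge> 1"
  shows "(\<integral>w. wt UNIV K k (coef_poly n (coef_monic n w) k) \<partial>M) = monic_mean UNIV n K k"
proof -
  define \<theta> where "\<theta> i x = (if i < n then x else 1)" for i and x :: int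
  have "coef_poly n (coef_monic n w) k = poly_upto (Suc n) (\<lambda>i. \<theta> i (coeff (haar_poly n k w) i))" for w
    using k by (intro poly_eqI)
      (auto simp: coef_poly_def coeff_poly_upto haar_poly_def \<theta>_def coef_monic_def coef_full_def ptrunc_padic_one)
  then have "(\<integral>w. wt UNIV K k (coef_poly n (coef_monic n w) k) \<partial>M)
    = mean (res_polys n k) (\<lambda>f. wt UNIV K k (poly_upto (Suc n) (\<lambda>i. \<theta> i (coeff f i))))"
    using expectation_haar_poly[of "\<lambda>f. wt UNIV K k (poly_upto (Suc n) (\<lambda>i. \<theta> i (coeff f i)))" n k] by simp
  also have "\<dots> = mean (monics 0 n k) (wt UNIV K k)" unfolding monics_def
  proof (rule mean_polys_map[where m = "\<lambda>_. 1"])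
    fix i y assume "i < Suc n" and y: "y \<in> (if i < n then mults 0 k else if i = n then {1} else {0})"
    then have "{x \<in> (if i < n then res k else {0}). \<theta> i x = y} = (if i < n then {y} else {0})"
      by (auto simp: \<theta>_def split: if_splits)
    then show "card {x \<in> (if i < n then res k else {0}). \<theta> i x = y} = 1" by simp
  qed (auto simp: \<theta>_def split: if_splits)
  finally show ?thesis by (simp add: monic_mean_def)
qed

lemma ptrunc_shift: "ptrunc p (\<lambda>j. if j = 0 then 0 else a (j - 1)) (Suc k) = P * ptrunc p a k"
  by (induction k) (simp_all add: ptrunc_Suc algebra_simps)

text \<open>P times a Haar element involves k - 1 digits modulo P^k, while \<open>haar_poly\<close>
  supplies k of them; the top digit is lost in the reduction, which makes the map \<theta> p-to-one
  below index n.\<close>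

lemma expectation_eis:
  assumes k: "k \<ge> 1" and K: "K \<ge> 1"
  shows "(\<integral>w. wt UNIV K k (coef_poly n (coef_eis n w) k) \<partial>M) = eis_mean n K k"
proof -
  define \<theta> where "\<theta> i x = (if i < n then (P ^ 1 * x) mod P ^ k else 1)" for i and x :: int
  have "wt UNIV K k (coef_poly n (coef_eis n w) k)
    = wt UNIV K k (poly_upto (Suc n) (\<lambda>i. \<theta> i (coeff (haar_poly n k w) i)))" for w
  proof -
    have "P ^ k dvd coeff (coef_poly n (coef_eis n w) k) i
        - coeff (poly_upto (Suc n) (\<lambda>i. \<theta> i (coeff (haar_poly n k w) i))) i" for i
    proof (cases "i < n")
      case True
      define a where "a = coef_full w i"
      obtain j where j: "k = Suc j" using k by (cases k) auto
      have "coef_eis n w i = (\<lambda>j. if j = 0 then 0 else a (j - 1))"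
        using True by (auto simp: coef_eis_def a_def coef_full_def fun_eq_iff)
      then have "ptrunc p (coef_eis n w i) k = P * ptrunc p a j" using ptrunc_shift by (simp add: j)
      then have 1: "coeff (coef_poly n (coef_eis n w) k) i = P * ptrunc p a j"
        using True by (simp add: coef_poly_def coeff_poly_upto)
      have "P * ptrunc p a k - P * ptrunc p a j = P ^ k * int (a j)" by (simp add: j ptrunc_Suc algebra_simps)
      then have "P ^ k dvd P * ptrunc p a k - P * ptrunc p a j" by simp
      then have "P ^ k dvd P * ptrunc p a j - P * ptrunc p a k" by (simp add: dvd_diff_commute)
      moreover have "P ^ k dvd P * ptrunc p a k - (P * ptrunc p a k) mod P ^ k" by (rule dvd_minus_mod)
      ultimately have "P ^ k dvd (P * ptrunc p a j - P * ptrunc p a k) + (P * ptrunc p a k - (P * ptrunc p a k) mod P ^ k)"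
        by (rule dvd_add)
      then have "P ^ k dvd P * ptrunc p a j - (P * ptrunc p a k) mod P ^ k" by simp
      then show ?thesis using True 1 by (simp add: coeff_poly_upto haar_poly_def \<theta>_def a_def)
    next
      case False
      then show ?thesis using k
        by (auto simp: coef_poly_def coeff_poly_upto \<theta>_def coef_eis_def ptrunc_padic_one)
    qed
    then show ?thesis unfolding wt_def by (subst root_classes_cong) auto
  qed
  then have "(\<integral>w. wt UNIV K k (coef_poly n (coef_eis n w) k) \<partial>M)
    = mean (res_polys n k) (\<lambda>f. wt UNIV K k (poly_upto (Suc n) (\<lambda>i. \<theta> i (coeff f i))))"
    using expectation_haar_poly[of "\<lambda>f. wt UNIV K k (poly_upto (Suc n) (\<lambda>i. \<theta> i (coeff f i)))" n k] by simp
  also have "\<dots> = mean (monics 1 n k) (wt UNIV K k)" unfolding monics_def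
  proof (rule mean_polys_map[where m = "\<lambda>i. if i < n then p ^ 1 else 1"])
    fix i y assume i: "i < Suc n" and y: "y \<in> (if i < n then mults 1 k else if i = n then {1} else {0})"
    show "card {x \<in> (if i < n then res k else {0}). \<theta> i x = y} = (if i < n then p ^ 1 else 1)"
    proof (cases "i < n")
      case True
      then show ?thesis using card_fibre[OF k, of y] y by (simp add: \<theta>_def)
    next
      case False
      then have "{x \<in> (if i < n then res k else {0}). \<theta> i x = y} = {0}"
        using y i by (auto simp: \<theta>_def split: if_splits)
      then show ?thesis using False by simp
    qed
  next
    fix i x assume "i < Suc n" "x \<in> (if i < n then res k else {0})"
    moreover have "P dvd P ^ k" using k by simp
    ultimately show "\<theta> i x \<in> (if i < n then mults 1 k else if i = n then {1} else {0})"
      using mod_in_res by (auto simp: \<theta>_def mults_def dvd_mod_iff)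
  qed (use p_pos in auto)
  also have "\<dots> = eis_mean n K k" unfolding eis_mean_def
    by (rule mean_cong) (simp add: wt_def root_classes_monics_1[OF k K])
  finally show ?thesis .
qed

lemma coef_poly_full: "coef_poly n (coef_full w) k = haar_poly (Suc n) k w"
  by (simp add: coef_poly_def haar_poly_def)

lemma expectation_full:
  "(\<integral>w. wt UNIV K k (coef_poly n (coef_full w) k) * wt {0} K k (rev_at n (coef_poly n (coef_full w) k)) \<partial>M) = full_mean n K k"
  unfolding coef_poly_full full_mean_def
  using expectation_haar_poly[of "\<lambda>f. wt UNIV K k f * wt {0} K k (rev_at n f)" "Suc n" k]
  by (simp add: less_Suc_eq_le)

text \<open>The reversal of a monic polynomial has constant term 1 and hence no root reducing to 0:
  monic polynomials have no roots outside Z_p. Thus the monic models can use the same limit lemma as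
  the full one.\<close>

lemma wt_rev_monic:
  assumes k: "k \<ge> 1" and c: "c n = padic_one" and K: "K \<ge> 1"
  shows "wt {0} K k (rev_at n (coef_poly n c k)) = 1"
proof -
  define f where "f = rev_at n (coef_poly n c k)"
  have f0: "\<not> P dvd coeff f 0" unfolding f_def
    using k P_gt_1 by (simp add: coeff_rev_at coef_poly_def coeff_poly_upto c ptrunc_padic_one)
  have "r \<notin> root_classes {0} K k f" for r
  proof
    assume "r \<in> root_classes {0} K k f"
    then obtain a where a: "r mod P = 0" "a mod P ^ K = r" "P ^ k dvd poly f a" by (auto simp: root_classes_def)
    have "a mod P ^ K mod P = a mod P" using K by (simp add: mod_mod_cancel)
    then have "a mod P = 0" using a(1,2) by simp
    moreover have "P dvd P ^ k" using k by simp
    then have "P dvd poly f a" using a(3) by (rule dvd_trans)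
    ultimately show False using unit_at_0[OF f0, of a] by simp
  qed
  then have "root_classes {0} K k f = {}" by blast
  then show ?thesis by (simp add: wt_def f_def)
qed

lemma measurable_coef_poly_monic [measurable]:
  "(\<lambda>w. coef_poly n (coef_monic n w) k) \<in> measurable M (count_space UNIV)"
  by (rule measurable_finite_dim[of "{..n} \<times> {..<k}"])
    (auto simp: coef_poly_def coef_monic_def poly_upto_def ptrunc_def intro!: sum.cong arg_cong2[of _ _ _ _ monom])

lemma measurable_coef_poly_eis [measurable]:
  "(\<lambda>w. coef_poly n (coef_eis n w) k) \<in> measurable M (count_space UNIV)"
  by (rule measurable_finite_dim[of "{..n} \<times> {..<k}"])
    (auto simp: coef_poly_def coef_eis_def poly_upto_def ptrunc_def intro!: sum.cong arg_cong2[of _ _ _ _ monom])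

lemma measurable_coef_poly_full [measurable]:
  "(\<lambda>w. coef_poly n (coef_full w) k) \<in> measurable M (count_space UNIV)"
  unfolding coef_poly_full by (rule measurable_haar_poly)

definition top_zero :: "nat \<Rightarrow> (nat \<Rightarrow> nat \<Rightarrow> nat) \<Rightarrow> bool" where
  "top_zero n c \<longleftrightarrow> (\<forall>k. P ^ k dvd ptrunc p (c n) k)"

lemma padic_zero_top_zero: "padic_zero (coef_poly n c) \<Longrightarrow> top_zero n c"
  unfolding padic_zero_def top_zero_def
proof
  fix k assume "\<forall>k i. P ^ k dvd coeff (coef_poly n c k) i"
  then have "P ^ k dvd coeff (coef_poly n c k) n" by blast
  then show "P ^ k dvd ptrunc p (c n) k" by (simp add: coef_poly_def coeff_poly_upto)
qed

text \<open>With digits below p, divisibility by all powers of p forces every digit to be 0, and the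
  first k digits vanish with probability p^(-k).\<close>

lemma AE_not_top_zero_full: "AE w in M. \<not> top_zero n (coef_full w)"
proof -
  interpret prob_space M by (rule prob_space_M)
  define Z :: "nat \<Rightarrow> (nat \<times> nat \<Rightarrow> nat) set" where "Z k = {w. \<forall>x\<in>{n} \<times> {..<k}. w x = 0}" for k
  have Zs: "Z k \<in> sets M" for k unfolding Z_def by (rule sets_M_cylinder) simp
  have Zp: "prob (Z k) = (1 / p) ^ k" for k
    unfolding Z_def using prob_cylinder[of "{n} \<times> {..<k}" "\<lambda>_. 0"] p_pos by (simp add: card_cartesian_product)
  have "prob (\<Inter>k. Z k) = 0"
  proof -
    have "prob (\<Inter>k. Z k) \<le> (1 / p) ^ k" for k
      unfolding Zp[symmetric] using Zs by (intro finite_measure_mono) auto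
    moreover have "(\<lambda>k. (1 / real p) ^ k) \<longlonglongrightarrow> 0"
      using P_gt_1 by (intro LIMSEQ_realpow_zero) auto
    ultimately have "prob (\<Inter>k. Z k) \<le> 0" by (intro LIMSEQ_le_const) auto
    then show ?thesis by (simp add: measure_le_0_iff)
  qed
  moreover have "(\<Inter>k. Z k) \<in> sets M" using Zs by auto
  ultimately have "AE w in M. w \<notin> (\<Inter>k. Z k)" by (simp add: prob_eq_0)
  then show ?thesis using AE_digits
  proof eventually_elim
    case (elim w)
    then obtain k where "w \<notin> Z k" by auto
    then obtain j where j: "w (n, j) \<noteq> 0" by (auto simp: Z_def)
    define a where "a = coef_full w n"
    have a: "padic_digits p a" using elim(2) by (simp add: padic_digits_def a_def coef_full_def)
    show ?case
    proof
      assume "top_zero n (coef_full w)"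
      then have "P ^ k dvd ptrunc p a k" for k by (simp add: top_zero_def a_def)
      then have "ptrunc p a k = 0" for k
        using ptrunc_in_res[OF a, of k] by (simp add: res_def) (metis mod_pos_pos_trivial dvd_eq_mod_eq_0)
      then have "ptrunc p a (Suc j) = 0" "ptrunc p a j = 0" by auto
      then show False using j P_gt_1 by (simp add: ptrunc_Suc a_def coef_full_def)
    qed
  qed
qed

lemma not_top_zero_monic: "c n = padic_one \<Longrightarrow> \<not> top_zero n c"
proof
  assume c: "c n = padic_one" and "top_zero n c"
  then have "P ^ 1 dvd ptrunc p (c n) 1" unfolding top_zero_def by blast
  then show False using P_gt_1 by (simp add: c ptrunc_padic_one)
qed

section \<open>Convergence of root counts for a general random polynomial\<close>

context
  fixes c :: "(nat \<times> nat \<Rightarrow> nat) \<Rightarrow> nat \<Rightarrow> nat \<Rightarrow> nat" and n :: nat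
  assumes meas_c: "\<And>k. (\<lambda>w. coef_poly n (c w) k) \<in> measurable M (count_space UNIV)"
begin

definition root_class_count :: "nat \<Rightarrow> nat \<Rightarrow> (nat \<times> nat \<Rightarrow> nat) \<Rightarrow> nat" where
  "root_class_count K k w = card (root_classes UNIV K k (coef_poly n (c w) k))
    + card (root_classes {0} K k (rev_at n (coef_poly n (c w) k)))"

definition lim_class_count :: "nat \<Rightarrow> (nat \<times> nat \<Rightarrow> nat) \<Rightarrow> nat" where
  "lim_class_count K w = card (lim_classes UNIV K (coef_poly n (c w)))
    + card (lim_classes {0} K (\<lambda>k. rev_at n (coef_poly n (c w) k)))"

lemma sets_coef_poly: "{w. Q (coef_poly n (c w) k)} \<in> sets M"
  using measurable_sets[OF meas_c, of "{f. Q f}" k] by (simp add: vimage_def)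

lemma sets_top_zero: "{w. top_zero n (c w)} \<in> sets M"
proof -
  have "{w. top_zero n (c w)} = (\<Inter>k. {w. P ^ k dvd coeff (coef_poly n (c w) k) n})"
    by (auto simp: top_zero_def coef_poly_def coeff_poly_upto)
  then show ?thesis using sets_coef_poly by auto
qed

lemma sets_padic_zero: "{w. padic_zero (coef_poly n (c w))} \<in> sets M"
proof -
  have "{w. padic_zero (coef_poly n (c w))} = (\<Inter>k. {w. \<forall>i. P ^ k dvd coeff (coef_poly n (c w) k) i})"
    by (auto simp: padic_zero_def)
  then show ?thesis using sets_coef_poly by auto
qed

lemma measurable_root_class_count: "root_class_count K k \<in> measurable M (count_space UNIV)"
proof -
  have "(\<lambda>f. card (root_classes UNIV K k f) + card (root_classes {0} K k (rev_at n f)))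
    \<in> measurable (count_space UNIV) (count_space UNIV)" by simp
  from measurable_compose[OF meas_c this, of k] show ?thesis unfolding root_class_count_def[abs_def] .
qed

lemma root_class_count_eventually_lim_class_count: "eventually (\<lambda>k. root_class_count K k w = lim_class_count K w) sequentially"
  using eventually_root_classes[OF coherent_coef_poly[of n "c w"], of UNIV K]
    eventually_root_classes[OF coherent_rev_at[OF coherent_coef_poly[of n "c w"]], of "{0}" K n]
  by eventually_elim (simp add: root_class_count_def lim_class_count_def)

lemma lim_class_count_eventually_num_roots:
  assumes "\<not> padic_zero (coef_poly n (c w))"
  shows "eventually (\<lambda>K. lim_class_count K w = num_roots p n (c w) + (if top_zero n (c w) then 1 else 0)) sequentially"
proof -
  note nz = padic_zero_rev_at[OF assms]
  show ?thesis
    using card_padic_roots(3)[OF coherent_coef_poly degree_coef_poly assms, of UNIV]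
      card_padic_roots(3)[OF coherent_rev_at[OF coherent_coef_poly] degree_rev_at nz, of "{0}"]
    by eventually_elim (simp add: lim_class_count_def num_roots_full[OF assms] top_zero_def)
qed

lemma lim_class_count_le:
  assumes "\<not> padic_zero (coef_poly n (c w))"
  shows "lim_class_count K w \<le> 2 * n"
proof -
  note nz = padic_zero_rev_at[OF assms]
  show ?thesis
    using card_lim_classes_le[OF coherent_coef_poly degree_coef_poly assms, of UNIV K]
      card_lim_classes_le[OF coherent_rev_at[OF coherent_coef_poly] degree_rev_at nz, of "{0}" K]
    by (simp add: lim_class_count_def)
qed

lemma num_roots_le:
  assumes "\<not> padic_zero (coef_poly n (c w))"
  shows "num_roots p n (c w) \<le> 2 * n"
  using eventually_happens[OF lim_class_count_eventually_num_roots[OF assms]] lim_class_count_le[OF assms]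
  by (metis add_leE sequentially_bot)

lemma borel_measurable_lim_class_count: "(\<lambda>w. h (lim_class_count K w) :: real) \<in> borel_measurable M"
proof (rule borel_measurable_LIMSEQ_real)
  show "(\<lambda>k. h (root_class_count K k w)) \<longlonglongrightarrow> h (lim_class_count K w)" for w
    by (rule tendsto_eventually) (use root_class_count_eventually_lim_class_count[of K w] in \<open>auto elim: eventually_mono\<close>)
  show "(\<lambda>w. h (root_class_count K k w)) \<in> borel_measurable M" for k
    by (rule measurable_compose[OF measurable_root_class_count]) simp
qed

text \<open>Off the zero polynomials \<open>lim_class_count\<close> eventually equals the number of
  roots plus one for a root at infinity. The corrected counts converge at every point, not only
  almost everywhere.\<close>

lemma borel_measurable_num_roots: "(\<lambda>w. h (num_roots p n (c w)) :: real) \<in> borel_measurable M"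
proof (rule borel_measurable_LIMSEQ_real)
  \<comment> \<open>The common value of \<open>num_roots\<close> at all sample points with zero
    polynomial; if there are none, \<kappa> is never taken.\<close>
  define \<kappa> where "\<kappa> = num_roots p n (c (SOME w. padic_zero (coef_poly n (c w))))"
  define s where "s K w = (if w \<in> {w. padic_zero (coef_poly n (c w))} then h \<kappa>
    else if w \<in> {w. top_zero n (c w)} then h (lim_class_count K w - 1) else h (lim_class_count K w))" for K w
  show "s K \<in> borel_measurable M" for K
    unfolding s_def[abs_def]
    by (intro measurable_If_set borel_measurable_lim_class_count) (use sets_top_zero sets_padic_zero in auto)
  show "(\<lambda>K. s K w) \<longlonglongrightarrow> h (num_roots p n (c w))" for w
  proof (cases "padic_zero (coef_poly n (c w))")
    case True
    then have "padic_zero (coef_poly n (c (SOME w. padic_zero (coef_poly n (c w)))))"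
      by (rule someI[where P = "\<lambda>w. padic_zero (coef_poly n (c w))"])
    then have "\<kappa> = num_roots p n (c w)" unfolding \<kappa>_def by (rule num_roots_zero[OF _ True])
    then show ?thesis using True by (simp add: s_def)
  next
    case False
    have "\<forall>\<^sub>F K in sequentially. s K w = h (num_roots p n (c w))"
      using lim_class_count_eventually_num_roots[OF False] by eventually_elim (use False in \<open>auto simp: s_def\<close>)
    then show ?thesis by (rule tendsto_eventually)
  qed
qed

text \<open>Binomial expansion of z^X around 1. The range 2 * n reflects that at most n roots are
  counted in Z_p and at most n for the reversal; this crude bound suffices to get a polynomial in z
  - 1.\<close>

lemma num_roots_expansion:
  assumes top: "AE w in M. \<not> top_zero n (c w)"
  shows "(\<integral>w. z ^ num_roots p n (c w) \<partial>M)
    = (\<Sum>d\<le>2 * n. (\<integral>w. real (num_roots p n (c w) choose d) \<partial>M) * (z - 1) ^ d)"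
proof -
  interpret prob_space M by (rule prob_space_M)
  have nz: "AE w in M. \<not> padic_zero (coef_poly n (c w))"
    using top by eventually_elim (use padic_zero_top_zero in blast)
  have int: "integrable M (\<lambda>w. real (num_roots p n (c w) choose d))" for d
  proof (rule integrable_const_bound)
    show "AE w in M. norm (real (num_roots p n (c w) choose d)) \<le> real (2 ^ (2 * n))"
      using nz
    proof eventually_elim
      case (elim w)
      have "num_roots p n (c w) choose d \<le> 2 ^ num_roots p n (c w)" by (rule binomial_le_pow2)
      also have "\<dots> \<le> 2 ^ (2 * n)" using num_roots_le[OF elim] by (intro power_increasing) auto
      finally show ?case by simp
    qed
    show "(\<lambda>w. real (num_roots p n (c w) choose d)) \<in> borel_measurable M" by (rule borel_measurable_num_roots)
  qed
  have "(\<integral>w. z ^ num_roots p n (c w) \<partial>M) = (\<integral>w. (\<Sum>d\<le>2 * n. real (num_roots p n (c w) choose d) * (z - 1) ^ d) \<partial>M)"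
  proof (rule integral_cong_AE)
    show "AE w in M. z ^ num_roots p n (c w) = (\<Sum>d\<le>2 * n. real (num_roots p n (c w) choose d) * (z - 1) ^ d)"
      using nz
    proof eventually_elim
      case (elim w)
      define N where "N = num_roots p n (c w)"
      have "z ^ N = (\<Sum>d\<le>N. real (N choose d) * (z - 1) ^ d)"
        using binomial_ring[of "z - 1" 1 N] by simp
      also have "\<dots> = (\<Sum>d\<le>2 * n. real (N choose d) * (z - 1) ^ d)"
        using num_roots_le[OF elim] by (intro sum.mono_neutral_left) (auto simp: N_def)
      finally show ?case by (simp add: N_def)
    qed
  qed (rule borel_measurable_num_roots)+
  also have "\<dots> = (\<Sum>d\<le>2 * n. \<integral>w. real (num_roots p n (c w) choose d) * (z - 1) ^ d \<partial>M)"
    using int by (intro Bochner_Integration.integral_sum integrable_mult_left)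
  finally show ?thesis by simp
qed

lemma expectation_choose_eq_0:
  assumes top: "AE w in M. \<not> top_zero n (c w)" and d: "d > 2 * n"
  shows "(\<integral>w. real (num_roots p n (c w) choose d) \<partial>M) = 0"
proof (rule integral_eq_zero_AE)
  show "AE w in M. real (num_roots p n (c w) choose d) = 0"
    using top
  proof eventually_elim
    case (elim w)
    then have "num_roots p n (c w) < d" using num_roots_le padic_zero_top_zero d by fastforce
    then show ?case by simp
  qed
qed

text \<open>Dominated convergence twice. For fixed K each of the two counts is at most p^K, the
  number of classes; for growing K the bound 2 * n holds almost surely. As z is an arbitrary real
  number, the dominating constants are powers of max 1 |z|.\<close>

lemma lim2_num_roots:
  assumes top: "AE w in M. \<not> top_zero n (c w)"
  shows "lim2 (\<lambda>K k. \<integral>w. wt UNIV K k (coef_poly n (c w) k) * wt {0} K k (rev_at n (coef_poly n (c w) k)) \<partial>M)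
    (\<integral>w. z ^ num_roots p n (c w) \<partial>M)"
proof -
  interpret prob_space M by (rule prob_space_M)
  have nz: "AE w in M. \<not> padic_zero (coef_poly n (c w))"
    using top by eventually_elim (use padic_zero_top_zero in blast)
  have bound: "norm (z ^ m) \<le> max 1 \<bar>z\<bar> ^ N" if "m \<le> N" for m N
  proof -
    have "norm (z ^ m) \<le> max 1 \<bar>z\<bar> ^ m" by (simp add: power_abs) (intro power_mono, auto)
    also have "\<dots> \<le> max 1 \<bar>z\<bar> ^ N" using that by (intro power_increasing) auto
    finally show ?thesis .
  qed
  have wt_root_class_count: "wt UNIV K k (coef_poly n (c w) k) * wt {0} K k (rev_at n (coef_poly n (c w) k)) = z ^ root_class_count K k w" for K k w
    by (simp add: wt_def root_class_count_def power_add)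
  have "(\<lambda>k. \<integral>w. z ^ root_class_count K k w \<partial>M) \<longlonglongrightarrow> (\<integral>w. z ^ lim_class_count K w \<partial>M)" for K
  proof (rule integral_dominated_convergence[where w = "\<lambda>_. max 1 \<bar>z\<bar> ^ (p ^ K + p ^ K)"])
    show "(\<lambda>w. z ^ lim_class_count K w) \<in> borel_measurable M" by (rule borel_measurable_lim_class_count)
    show "(\<lambda>w. z ^ root_class_count K k w) \<in> borel_measurable M" for k
      by (rule measurable_compose[OF measurable_root_class_count]) simp
    show "AE w in M. (\<lambda>k. z ^ root_class_count K k w) \<longlonglongrightarrow> z ^ lim_class_count K w"
    proof (intro AE_I2 tendsto_eventually)
      fix w
      show "\<forall>\<^sub>F k in sequentially. z ^ root_class_count K k w = z ^ lim_class_count K w"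
        using root_class_count_eventually_lim_class_count[of K w] by eventually_elim simp
    qed
    show "AE w in M. norm (z ^ root_class_count K k w) \<le> max 1 \<bar>z\<bar> ^ (p ^ K + p ^ K)" for k
    proof (intro AE_I2 bound)
      fix w
      have "card (root_classes A K k f) \<le> p ^ K" for A f
        using card_mono[OF finite_res root_classes_subset] by (simp add: card_res)
      then show "root_class_count K k w \<le> p ^ K + p ^ K" unfolding root_class_count_def by (intro add_mono)
    qed
  qed simp
  moreover have "(\<lambda>K. \<integral>w. z ^ lim_class_count K w \<partial>M) \<longlonglongrightarrow> (\<integral>w. z ^ num_roots p n (c w) \<partial>M)"
  proof (rule integral_dominated_convergence[where w = "\<lambda>_. max 1 \<bar>z\<bar> ^ (2 * n)"])
    show "(\<lambda>w. z ^ lim_class_count K w) \<in> borel_measurable M" for K by (rule borel_measurable_lim_class_count)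
    show "(\<lambda>w. z ^ num_roots p n (c w)) \<in> borel_measurable M" by (rule borel_measurable_num_roots)
    show "AE w in M. (\<lambda>K. z ^ lim_class_count K w) \<longlonglongrightarrow> z ^ num_roots p n (c w)"
      using top nz
    proof eventually_elim
      case (elim w)
      show ?case
        by (rule tendsto_eventually)
          (use lim_class_count_eventually_num_roots[OF elim(2)] elim(1) in \<open>auto elim: eventually_mono\<close>)
    qed
    show "AE w in M. norm (z ^ lim_class_count K w) \<le> max 1 \<bar>z\<bar> ^ (2 * n)" for K
      using nz by eventually_elim (use lim_class_count_le bound in blast)
  qed simp
  ultimately show ?thesis unfolding lim2_def wt_root_class_count by (intro exI[of _ "\<lambda>K. \<integral>w. z ^ lim_class_count K w \<partial>M"]) simp
qed

end

lemma AE_not_top_zero_monic: "AE w in M. \<not> top_zero n (coef_monic n w)"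
  by (intro AE_I2 not_top_zero_monic) (simp add: coef_monic_def)

lemma AE_not_top_zero_eis: "AE w in M. \<not> top_zero n (coef_eis n w)"
  by (intro AE_I2 not_top_zero_monic) (simp add: coef_eis_def)

lemma alpha_eq_0: "d > 2 * n \<Longrightarrow> alpha p n d = 0"
  unfolding alpha_def by (rule expectation_choose_eq_0[OF measurable_coef_poly_monic AE_not_top_zero_monic])

lemma beta_eq_0: "d > 2 * n \<Longrightarrow> beta p n d = 0"
  unfolding beta_def by (rule expectation_choose_eq_0[OF measurable_coef_poly_eis AE_not_top_zero_eis])

lemma rho_eq_0: "d > 2 * n \<Longrightarrow> rho p n d = 0"
  unfolding rho_def by (rule expectation_choose_eq_0[OF measurable_coef_poly_full AE_not_top_zero_full])

lemma lim2_monic_mean: "lim2 (monic_mean UNIV n) (\<Sum>d\<le>2 * n. alpha p n d * (z - 1) ^ d)"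
proof -
  note top = AE_not_top_zero_monic
  have "monic_mean UNIV n K k = (\<integral>w. wt UNIV K k (coef_poly n (coef_monic n w) k)
      * wt {0} K k (rev_at n (coef_poly n (coef_monic n w) k)) \<partial>M)" if "K \<ge> 1" "k \<ge> 1" for K k
    using that by (simp add: expectation_monic[symmetric] wt_rev_monic coef_monic_def)
  from lim2_cong_ge[OF this[symmetric] lim2_num_roots[OF measurable_coef_poly_monic top]]
  show ?thesis unfolding num_roots_expansion[OF measurable_coef_poly_monic top] alpha_def by simp
qed

lemma lim2_eis_mean: "lim2 (eis_mean n) (\<Sum>d\<le>2 * n. beta p n d * (z - 1) ^ d)"
proof -
  note top = AE_not_top_zero_eis
  have "eis_mean n K k = (\<integral>w. wt UNIV K k (coef_poly n (coef_eis n w) k)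
      * wt {0} K k (rev_at n (coef_poly n (coef_eis n w) k)) \<partial>M)" if "K \<ge> 1" "k \<ge> 1" for K k
    using that by (simp add: expectation_eis[symmetric] wt_rev_monic coef_eis_def)
  from lim2_cong_ge[OF this[symmetric] lim2_num_roots[OF measurable_coef_poly_eis top]]
  show ?thesis unfolding num_roots_expansion[OF measurable_coef_poly_eis top] beta_def by simp
qed

lemma lim2_full_mean: "lim2 (full_mean n) (\<Sum>d\<le>2 * n. rho p n d * (z - 1) ^ d)"
  using lim2_num_roots[OF measurable_coef_poly_full AE_not_top_zero_full, of n]
  unfolding num_roots_expansion[OF measurable_coef_poly_full AE_not_top_zero_full] rho_def expectation_full
  by simp

end

section \<open>Generating functions\<close>

definition fps_lim2 :: "(nat \<Rightarrow> nat \<Rightarrow> real fps) \<Rightarrow> real fps \<Rightarrow> bool" where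
  "fps_lim2 F L \<longleftrightarrow> (\<forall>m. lim2 (\<lambda>K k. fps_nth (F K k) m) (fps_nth L m))"

lemma fps_lim2_const: "fps_lim2 (\<lambda>_ _. F) F"
  by (simp add: fps_lim2_def lim2_const)

lemma fps_lim2_mult:
  "fps_lim2 F L \<Longrightarrow> fps_lim2 G L' \<Longrightarrow> fps_lim2 (\<lambda>K k. F K k * G K k) (L * L')"
  by (simp add: fps_lim2_def fps_mult_nth lim2_sum lim2_mult)

lemma fps_lim2_power: "fps_lim2 F L \<Longrightarrow> fps_lim2 (\<lambda>K k. F K k ^ m) (L ^ m)"
  by (induction m) (auto intro: fps_lim2_const fps_lim2_mult)

lemma fps_lim2_Abs: "(\<And>n. lim2 (f n) (a n)) \<Longrightarrow> fps_lim2 (\<lambda>K k. Abs_fps (\<lambda>n. f n K k)) (Abs_fps a)"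
  by (simp add: fps_lim2_def)

lemma fps_lim2_unique:
  assumes "\<And>K k. K \<ge> K0 \<Longrightarrow> k \<ge> k0 \<Longrightarrow> F K k = G K k" "fps_lim2 F L" "fps_lim2 G L'"
  shows "L = L'"
proof (rule fps_ext)
  fix m
  have "lim2 (\<lambda>K k. fps_nth (G K k) m) (fps_nth L m)"
    by (rule lim2_cong_ge[of K0 k0 "\<lambda>K k. fps_nth (F K k) m"])
      (simp add: assms(1), use assms(2) in \<open>simp add: fps_lim2_def\<close>)
  then show "fps_nth L m = fps_nth L' m" using assms(3) lim2_unique by (auto simp: fps_lim2_def)
qed

context prime_weight
begin

definition a_lim :: "nat \<Rightarrow> real" where "a_lim n = (\<Sum>d\<le>2 * n. alpha p n d * (z - 1) ^ d)"

definition b_lim :: "nat \<Rightarrow> real" where "b_lim n = (\<Sum>d\<le>2 * n. beta p n d * (z - 1) ^ d)"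

definition r_lim :: "nat \<Rightarrow> real" where "r_lim n = (\<Sum>d\<le>2 * n. rho p n d * (z - 1) ^ d)"

lemma lims: "lim2 (monic_mean UNIV n) (a_lim n)" "lim2 (eis_mean n) (b_lim n)" "lim2 (full_mean n) (r_lim n)"
  unfolding a_lim_def b_lim_def r_lim_def by (rule lim2_monic_mean lim2_eis_mean lim2_full_mean)+

lemma a_lim_fps:
  "(1 - fps_const (real p) * fps_X) * Abs_fps (\<lambda>n. real p ^ n * a_lim n) = ((1 - fps_X) * Abs_fps b_lim) ^ p"
proof (rule fps_lim2_unique[OF monic_mean_fps_UNIV])
  show "fps_lim2 (\<lambda>K k. (1 - fps_const (real p) * fps_X) * Abs_fps (\<lambda>n. real p ^ n * monic_mean UNIV n K k))
     ((1 - fps_const (real p) * fps_X) * Abs_fps (\<lambda>n. real p ^ n * a_lim n))"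
    by (intro fps_lim2_mult fps_lim2_const fps_lim2_Abs lim2_cmult lims)
  show "fps_lim2 (\<lambda>K k. ((1 - fps_X) * Abs_fps (\<lambda>n. eis_mean n K k)) ^ p) (((1 - fps_X) * Abs_fps b_lim) ^ p)"
    by (intro fps_lim2_power fps_lim2_mult fps_lim2_const fps_lim2_Abs lims)
qed auto

text \<open>Both k - 1 and k tend to infinity, so \<open>full_mean_recursion\<close> becomes a
  linear equation for \<open>r_lim n\<close>, solved by means of p^(n+1) - 1 = (p - 1) (p^n + ... +
  1).\<close>

lemma r_lim_eq: "(\<Sum>j\<le>n. real p ^ j) * r_lim n = (\<Sum>s\<le>n. real p ^ s * a_lim s * b_lim (n - s))"
proof -
  define T where "T = (\<Sum>s\<le>n. (1 / p) ^ (n - s) * (1 - 1 / p) * (a_lim s * b_lim (n - s)))"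
  have "lim2 (\<lambda>K k. (1 / p) ^ Suc n * full_mean n K (k - 1)
    + (\<Sum>s\<le>n. (1 / p) ^ (n - s) * (1 - 1 / p) * (monic_mean UNIV s K k * eis_mean (n - s) K k)))
    ((1 / p) ^ Suc n * r_lim n + T)"
    unfolding T_def by (intro lim2_add lim2_cmult lim2_sum lim2_mult lim2_pred_right lims)
  then have "lim2 (full_mean n) ((1 / p) ^ Suc n * r_lim n + T)"
    by (rule lim2_cong_ge[of 1 1, rotated]) (use full_mean_recursion in simp)
  then have r: "r_lim n = (1 / p) ^ Suc n * r_lim n + T" using lims(3) lim2_unique by blast
  have p1: "real p > 1" using P_gt_1 by simp
  have inv: "real p ^ m * (1 / real p) ^ m = 1" for m using p1 by (simp flip: power_mult_distrib)
  have "real p ^ Suc n * r_lim n = real p ^ Suc n * ((1 / p) ^ Suc n * r_lim n + T)" using r by simp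
  also have "\<dots> = (real p ^ Suc n * (1 / p) ^ Suc n) * r_lim n + real p ^ Suc n * T"
    by (simp only: distrib_left mult.assoc)
  finally have "real p ^ Suc n * r_lim n = r_lim n + real p ^ Suc n * T" by (simp only: inv mult_1_left)
  then have "(real p ^ Suc n - 1) * r_lim n = real p ^ Suc n * T" by (simp add: left_diff_distrib)
  also have "real p ^ Suc n * T = (\<Sum>s\<le>n. (real p - 1) * (real p ^ s * a_lim s * b_lim (n - s)))"
    unfolding T_def sum_distrib_left
  proof (intro sum.cong refl)
    fix s assume "s \<in> {..n}"
    then have "real p ^ Suc n = real p * real p ^ s * real p ^ (n - s)" by (simp flip: power_add)
    then have "real p ^ Suc n * ((1 / p) ^ (n - s) * (1 - 1 / p) * (a_lim s * b_lim (n - s)))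
      = (real p * (1 - 1 / p)) * (real p ^ (n - s) * (1 / p) ^ (n - s)) * (real p ^ s * a_lim s * b_lim (n - s))"
      by (simp only: mult_ac)
    moreover have "real p * (1 - 1 / p) = real p - 1" using p1 by (simp add: right_diff_distrib)
    ultimately show "real p ^ Suc n * ((1 / p) ^ (n - s) * (1 - 1 / p) * (a_lim s * b_lim (n - s)))
      = (real p - 1) * (real p ^ s * a_lim s * b_lim (n - s))"
      by (simp only: inv mult_1_right)
  qed
  also have "\<dots> = (real p - 1) * (\<Sum>s\<le>n. real p ^ s * a_lim s * b_lim (n - s))"
    by (simp add: sum_distrib_left)
  also have "real p ^ Suc n - 1 = (real p - 1) * (\<Sum>j\<le>n. real p ^ j)"
    using power_diff_1_eq[of "real p" "Suc n"] by (simp add: lessThan_Suc_atMost)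
  finally show ?thesis using p1 by simp
qed

text \<open>The share of the expectation due to a nonzero reduction after r divisions, s being its
  degree.\<close>

definition s_lim :: "nat \<Rightarrow> real" where
  "s_lim r = (\<Sum>s<r. (1 / p) ^ (r - 1 - s) * (1 - 1 / p) * a_lim s)"

text \<open>In the limit the recursion reads X_r = p^(-r) X_(r+1) + s_lim r. Because binom(r+1,2) =
  r + binom(r,2), division by p^binom(r,2) makes it telescope, from r = n downwards.\<close>

lemma lim2_scaled_mean:
  assumes "1 \<le> r" "r \<le> n"
  shows "lim2 (scaled_mean r n) (real p ^ (r choose 2) *
    (a_lim n / real p ^ (n choose 2) + (\<Sum>t\<in>{r..<n}. s_lim t / real p ^ (t choose 2))))"
  using assms(2,1)
proof (induction r rule: inc_induct)
  case base
  have "scaled_mean n n = monic_mean UNIV n" using scaled_mean_n by (simp add: fun_eq_iff)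
  then show ?case using lims(1) p_pos by simp
next
  case (step r)
  define Y where "Y r = (\<Sum>t\<in>{r..<n}. s_lim t / real p ^ (t choose 2))" for r
  define X where "X r = real p ^ (r choose 2) * (a_lim n / real p ^ (n choose 2) + Y r)" for r
  have "lim2 (scaled_mean (Suc r) n) (X (Suc r))" using step by (simp add: X_def Y_def)
  then have "lim2 (\<lambda>K k. (1 / p) ^ r * scaled_mean (Suc r) n K (k - 1)
    + (\<Sum>s<r. (1 / p) ^ (r - 1 - s) * (1 - 1 / p) * monic_mean UNIV s K k)) ((1 / p) ^ r * X (Suc r) + s_lim r)"
    unfolding s_lim_def by (intro lim2_add lim2_cmult lim2_sum lim2_mult lim2_pred_right lims)
  then have "lim2 (scaled_mean r n) ((1 / p) ^ r * X (Suc r) + s_lim r)"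
    by (rule lim2_cong_ge[of 1 "Suc n", rotated]) (use scaled_mean_recursion step in simp)
  moreover have "(1 / p) ^ r * X (Suc r) + s_lim r = X r"
  proof -
    have "Suc r choose 2 = r + (r choose 2)" by (simp add: numeral_2_eq_2)
    moreover have "Y r = s_lim r / real p ^ (r choose 2) + Y (Suc r)"
      unfolding Y_def using step by (simp add: sum.atLeast_Suc_lessThan)
    ultimately show ?thesis using p_pos by (simp add: X_def power_add power_one_over distrib_left)
  qed
  ultimately show ?case by (simp add: X_def Y_def)
qed

lemma b_lim_eq:
  "b_lim n = a_lim n / real p ^ (n choose 2) + (\<Sum>t<n. s_lim t / real p ^ (t choose 2))"
proof (cases "n = 0")
  case True
  \<comment> \<open>Degree 0 is separate, since the constant 1 cannot be divided by p; both monic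
    models coincide there.\<close>
  have "monic_mean UNIV 0 K k = eis_mean 0 K k" if "K \<ge> 1" "k \<ge> 1" for K k
  proof -
    have "monics 0 0 k = monics 1 0 k" by (simp add: monics_def)
    then show ?thesis unfolding monic_mean_def eis_mean_def
      by (simp only:) (rule mean_cong, simp add: wt_def root_classes_monics_1[OF that(2,1)])
  qed
  then have "lim2 (eis_mean 0) (a_lim 0)" by (intro lim2_cong_ge[OF _ lims(1)]) auto
  then have "a_lim 0 = b_lim 0" using lims(2) by (rule lim2_unique)
  then show ?thesis using True by (simp add: numeral_2_eq_2)
next
  case False
  then have n: "n \<ge> 1" by simp
  define X where "X = a_lim n / real p ^ (n choose 2) + (\<Sum>t\<in>{1..<n}. s_lim t / real p ^ (t choose 2))"
  have "lim2 (scaled_mean 1 n) X" using lim2_scaled_mean[OF order.refl n] by (simp add: X_def numeral_2_eq_2)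
  then have "lim2 (\<lambda>K k. scaled_mean 1 n (K - 1) (k - 1)) X" by (intro lim2_pred_left[OF lim2_pred_right])
  then have "lim2 (eis_mean n) X"
    by (rule lim2_cong_ge[of 1 "Suc n", rotated]) (use eis_mean_eq_scaled_mean[OF n] in simp)
  then have "b_lim n = X" using lims(2) lim2_unique by blast
  \<comment> \<open>The sum may start at 0 because \<open>s_lim 0\<close> is an empty sum.\<close>
  moreover have "{..<n} = insert 0 {1..<n}" using n by auto
  ultimately show ?thesis by (simp add: X_def s_lim_def)
qed

end

section \<open>Series in t whose coefficients are polynomials in u\<close>

definition fps_eval :: "real \<Rightarrow> real poly fps \<Rightarrow> real fps" where
  "fps_eval x F = Abs_fps (\<lambda>n. poly (fps_nth F n) x)"

lemma fps_eval_mult: "fps_eval x (F * G) = fps_eval x F * fps_eval x G"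
  by (rule fps_ext) (simp add: fps_eval_def fps_mult_nth poly_sum)

lemma fps_eval_1: "fps_eval x 1 = 1"
  by (rule fps_ext) (simp add: fps_eval_def)

lemma fps_eval_power: "fps_eval x (F ^ m) = fps_eval x F ^ m"
  by (induction m) (simp_all add: fps_eval_1 fps_eval_mult)

text \<open>Real polynomials with equal values everywhere coincide, so identities proved for each
  real z become identities in u.\<close>

lemma fps_eval_eqI:
  assumes "\<And>x. fps_eval x F = fps_eval x G"
  shows "F = G"
proof (rule fps_ext)
  fix n
  have "poly (fps_nth F n) x = poly (fps_nth G n) x" for x
    using arg_cong[OF assms[of x], of "\<lambda>H. fps_nth H n"] by (simp add: fps_eval_def)
  then show "fps_nth F n = fps_nth G n" by (simp add: fun_eq_iff flip: poly_eq_poly_eq_iff)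
qed

text \<open>Series in t over polynomials in u become series in u over series in t. The first form
  can be evaluated at a real u, the second is that of the theorem.\<close>

definition fps_swap :: "real poly fps \<Rightarrow> real fps fps" where
  "fps_swap F = Abs_fps (\<lambda>d. Abs_fps (\<lambda>n. coeff (fps_nth F n) d))"

lemma fps_swap_mult: "fps_swap (F * G) = fps_swap F * fps_swap G"
proof (intro fps_ext)
  fix d n
  have "fps_nth (fps_nth (fps_swap (F * G)) d) n
    = (\<Sum>i=0..n. \<Sum>j=0..d. coeff (fps_nth F i) j * coeff (fps_nth G (n - i)) (d - j))"
    by (simp add: fps_swap_def fps_mult_nth coeff_sum coeff_mult atMost_atLeast0)
  also have "\<dots> = (\<Sum>j=0..d. \<Sum>i=0..n. coeff (fps_nth F i) j * coeff (fps_nth G (n - i)) (d - j))"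
    by (rule sum.swap)
  also have "\<dots> = fps_nth (fps_nth (fps_swap F * fps_swap G) d) n"
    by (simp add: fps_swap_def fps_mult_nth fps_sum_nth)
  finally show "fps_nth (fps_nth (fps_swap (F * G)) d) n = fps_nth (fps_nth (fps_swap F * fps_swap G) d) n" .
qed

lemma fps_swap_1: "fps_swap 1 = 1"
  by (intro fps_ext) (simp add: fps_swap_def)

lemma fps_swap_power: "fps_swap (F ^ m) = fps_swap F ^ m"
  by (induction m) (simp_all add: fps_swap_1 fps_swap_mult)

definition fps_lift :: "real fps \<Rightarrow> real poly fps" where
  "fps_lift G = Abs_fps (\<lambda>n. [:fps_nth G n:])"

lemma fps_swap_lift: "fps_nth (fps_swap (fps_lift G * F)) d = G * fps_nth (fps_swap F) d"
  by (rule fps_ext) (simp add: fps_swap_def fps_lift_def fps_mult_nth coeff_sum)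

lemma fps_eval_lift: "fps_eval x (fps_lift G) = G"
  by (rule fps_ext) (simp add: fps_eval_def fps_lift_def)

definition gen_poly :: "(nat \<Rightarrow> nat \<Rightarrow> real) \<Rightarrow> nat \<Rightarrow> real poly" where
  "gen_poly f n = (\<Sum>d\<le>2 * n. monom (f n d) d)"

lemma poly_gen_poly: "poly (gen_poly f n) x = (\<Sum>d\<le>2 * n. f n d * x ^ d)"
  by (simp add: gen_poly_def poly_sum poly_monom)

abbreviation alpha_fps :: "nat \<Rightarrow> real poly fps" where
  "alpha_fps p \<equiv> Abs_fps (\<lambda>n. smult (real p ^ n) (gen_poly (alpha p) n))"

abbreviation rho_fps :: "nat \<Rightarrow> real poly fps" where
  "rho_fps p \<equiv> Abs_fps (\<lambda>n. smult (\<Sum>j\<le>n. real p ^ j) (gen_poly (rho p) n))"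

lemma coeff_gen_poly:
  assumes "\<And>n d. d > 2 * n \<Longrightarrow> f n d = 0"
  shows "coeff (gen_poly f n) d = f n d"
proof -
  have "coeff (gen_poly f n) d = (\<Sum>i\<le>2 * n. if i = d then f n i else 0)"
    by (simp add: gen_poly_def coeff_sum)
  then show ?thesis using assms[of n d] by (simp add: sum.delta)
qed

lemma fps_scale_Agf: "fps_scale c (Agf p d) = (1 - fps_const c * fps_X) * Abs_fps (\<lambda>n. c ^ n * alpha p n d)"
proof (rule fps_ext)
  fix n
  show "fps_nth (fps_scale c (Agf p d)) n = fps_nth ((1 - fps_const c * fps_X) * Abs_fps (\<lambda>n. c ^ n * alpha p n d)) n"
    by (cases n) (simp_all add: fps_scale_def Agf_def left_diff_distrib right_diff_distrib mult.assoc)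
qed

section \<open>The identities for the generating functions\<close>

context
  fixes p :: nat
  assumes prime_p: "prime p"
begin

lemma prime_weightI: "prime_weight p" by unfold_locales (rule prime_p)

lemma coeff_gen_alpha: "coeff (gen_poly (alpha p) n) d = alpha p n d"
  by (rule coeff_gen_poly) (rule prime_weight.alpha_eq_0[OF prime_weightI])

lemma coeff_gen_beta: "coeff (gen_poly (beta p) n) d = beta p n d"
  by (rule coeff_gen_poly) (rule prime_weight.beta_eq_0[OF prime_weightI])

lemma coeff_gen_rho: "coeff (gen_poly (rho p) n) d = rho p n d"
  by (rule coeff_gen_poly) (rule prime_weight.rho_eq_0[OF prime_weightI])

lemma a_lim_gen: "prime_weight.a_lim p (x + 1) n = poly (gen_poly (alpha p) n) x"
  by (simp add: prime_weight.a_lim_def[OF prime_weightI] poly_gen_poly)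

lemma b_lim_gen: "prime_weight.b_lim p (x + 1) n = poly (gen_poly (beta p) n) x"
  by (simp add: prime_weight.b_lim_def[OF prime_weightI] poly_gen_poly)

lemma r_lim_gen: "prime_weight.r_lim p (x + 1) n = poly (gen_poly (rho p) n) x"
  by (simp add: prime_weight.r_lim_def[OF prime_weightI] poly_gen_poly)

lemma alpha_beta_poly_fps:
  "fps_lift (1 - fps_const (real p) * fps_X) * alpha_fps p
    = (fps_lift (1 - fps_X) * Abs_fps (gen_poly (beta p))) ^ p"
proof (rule fps_eval_eqI)
  fix x
  have 1: "fps_eval x (alpha_fps p)
    = Abs_fps (\<lambda>n. real p ^ n * prime_weight.a_lim p (x + 1) n)"
    by (simp add: fps_eval_def a_lim_gen)
  have 2: "fps_eval x (Abs_fps (gen_poly (beta p))) = Abs_fps (prime_weight.b_lim p (x + 1))"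
    by (rule fps_ext) (simp add: fps_eval_def b_lim_gen)
  show "fps_eval x (fps_lift (1 - fps_const (real p) * fps_X) * alpha_fps p)
    = fps_eval x ((fps_lift (1 - fps_X) * Abs_fps (gen_poly (beta p))) ^ p)"
    unfolding fps_eval_mult fps_eval_power fps_eval_lift 1 2
    by (rule prime_weight.a_lim_fps[OF prime_weightI])
qed

lemma rho_poly_fps:
  "rho_fps p
    = alpha_fps p * Abs_fps (gen_poly (beta p))"
proof (rule fps_eval_eqI, rule fps_ext)
  fix x n
  show "fps_nth (fps_eval x (rho_fps p)) n
    = fps_nth (fps_eval x (alpha_fps p * Abs_fps (gen_poly (beta p)))) n"
    using prime_weight.r_lim_eq[OF prime_weightI, of n "x + 1"]
    unfolding fps_eval_mult
    by (simp add: fps_eval_def fps_mult_nth a_lim_gen b_lim_gen r_lim_gen atMost_atLeast0)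
qed

lemma fps_swap_alpha:
  "fps_swap (fps_lift (1 - fps_const (real p) * fps_X) * alpha_fps p)
    = Abs_fps (\<lambda>d. fps_scale (real p) (Agf p d))"
  by (rule fps_ext) (simp add: fps_swap_lift fps_scale_Agf, simp add: fps_swap_def coeff_gen_alpha)

lemma fps_swap_beta:
  "fps_swap (fps_lift (1 - fps_X) * Abs_fps (gen_poly (beta p))) = Abs_fps (Bgf p)"
  by (rule fps_ext) (simp add: fps_swap_lift Bgf_def, simp add: fps_swap_def coeff_gen_beta)

lemma fps_swap_rho:
  "fps_swap (fps_lift (1 - fps_X) * (fps_lift (1 - fps_const (real p) * fps_X) *
      rho_fps p)) = Abs_fps (Rgf p)"
  by (rule fps_ext) (simp add: fps_swap_lift Rgf_def mult.assoc, simp add: fps_swap_def coeff_gen_rho)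

lemma alpha_beta_fps: "Abs_fps (\<lambda>d. fps_scale (real p) (Agf p d)) = Abs_fps (Bgf p) ^ p"
  using arg_cong[OF alpha_beta_poly_fps, of fps_swap]
  unfolding fps_swap_power fps_swap_alpha fps_swap_beta .

lemma Rgf_fps: "Abs_fps (Rgf p) = Abs_fps (\<lambda>d. fps_scale (real p) (Agf p d)) * Abs_fps (Bgf p)"
  unfolding fps_swap_rho[symmetric] fps_swap_alpha[symmetric] fps_swap_beta[symmetric]
    fps_swap_mult[symmetric] rho_poly_fps
  by (simp only: mult_ac)

text \<open>\<open>b_lim_eq\<close> is linear in the limits and holds for every z, so it holds for
  the coefficient of each power of u.\<close>

lemma beta_eq_alpha:
  "beta p n d = alpha p n d / real p ^ (n choose 2)
    + (\<Sum>t<n. (\<Sum>s<t. (1 / p) ^ (t - 1 - s) * (1 - 1 / p) * alpha p s d) / real p ^ (t choose 2))"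
proof -
  define H where "H = smult (1 / real p ^ (n choose 2)) (gen_poly (alpha p) n)
    + (\<Sum>t<n. smult (1 / real p ^ (t choose 2))
        (\<Sum>s<t. smult ((1 / p) ^ (t - 1 - s) * (1 - 1 / p)) (gen_poly (alpha p) s)))"
  have "poly (gen_poly (beta p) n) x = poly H x" for x
    using prime_weight.b_lim_eq[OF prime_weightI, of "x + 1" n]
    by (simp add: H_def poly_sum b_lim_gen a_lim_gen prime_weight.s_lim_def[OF prime_weightI])
  then have "gen_poly (beta p) n = H" by (simp add: fun_eq_iff flip: poly_eq_poly_eq_iff)
  then have "beta p n d = coeff H d" by (simp add: coeff_gen_beta[symmetric])
  then show ?thesis by (simp add: H_def coeff_sum coeff_gen_alpha)
qed

text \<open>In the difference of consecutive \<beta> all but one S term cancels. Since S (t + 1) = S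
  t / p + (1 - 1/p) x t, subtracting p^(-(n - 1)) times the preceding difference, which is the
  effect of t B_d(t/p), removes that term too.\<close>

lemma Bgf_eq_Phi:
  "Bgf p d - fps_X * fps_scale (1 / real p) (Bgf p d) = Phi p (Agf p d - fps_X * fps_scale (real p) (Agf p d))"
proof (rule fps_ext)
  fix n
  define x where "x n = alpha p n d" for n
  define y where "y n = beta p n d" for n
  define S where "S t = (\<Sum>s<t. (1 / p) ^ (t - 1 - s) * (1 - 1 / p) * x s)" for t
  have p0: "real p > 0" using prime_p by (simp add: prime_gt_0_nat)
  have y: "y n = x n / real p ^ (n choose 2) + (\<Sum>t<n. S t / real p ^ (t choose 2))" for n
    unfolding x_def y_def S_def by (rule beta_eq_alpha)
  have S_Suc: "S (Suc t) = S t / p + (1 - 1 / p) * x t" for t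
  proof -
    have "(\<Sum>s<t. (1 / p) ^ (Suc t - 1 - s) * (1 - 1 / p) * x s) = (\<Sum>s<t. (1 / p) * ((1 / p) ^ (t - 1 - s) * (1 - 1 / p) * x s))"
    proof (intro sum.cong refl)
      fix s assume "s \<in> {..<t}"
      then have "Suc t - 1 - s = Suc (t - 1 - s)" by auto
      then show "(1 / p) ^ (Suc t - 1 - s) * (1 - 1 / p) * x s = (1 / p) * ((1 / p) ^ (t - 1 - s) * (1 - 1 / p) * x s)"
        by (simp only: power_Suc mult.assoc)
    qed
    then show ?thesis by (simp add: S_def sum_divide_distrib)
  qed
  have B: "fps_nth (Bgf p d) m = y m - (if m = 0 then 0 else y (m - 1))"
    and A: "fps_nth (Agf p d) m = x m - (if m = 0 then 0 else x (m - 1))" for m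
    by (auto simp: Bgf_def Agf_def x_def y_def left_diff_distrib)
  \<comment> \<open>The factors 1 - t and t together reach two coefficients back, so degrees 0 and 1
    are separate.\<close>
  consider "n = 0" | "n = 1" | m where "n = Suc (Suc m)" by (metis One_nat_def not0_implies_Suc)
  then show "fps_nth (Bgf p d - fps_X * fps_scale (1 / real p) (Bgf p d)) n
    = fps_nth (Phi p (Agf p d - fps_X * fps_scale (real p) (Agf p d))) n"
  proof cases
    case (3 m)
    define q c where "q = real p ^ (m choose 2)" and "c = real p ^ m"
    have qc: "q > 0" "c > 0" using p0 by (auto simp: q_def c_def)
    have e1: "real p ^ (Suc m choose 2) = q * c"
      by (simp add: q_def c_def numeral_2_eq_2 power_add)
    have e2: "real p ^ (Suc (Suc m) choose 2) = q * c * c * p"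
      by (simp add: q_def c_def numeral_2_eq_2 power_add)
    have y1: "y (Suc m) - y m = x (Suc m) / (q * c) - x m / q + S m / q"
      unfolding y[of "Suc m"] y[of m] by (simp add: e1 q_def[symmetric])
    have y2: "y (Suc (Suc m)) - y (Suc m) = x (Suc (Suc m)) / (q * c * c * p) - x (Suc m) / (q * c) + S (Suc m) / (q * c)"
      unfolding y[of "Suc (Suc m)"] y[of "Suc m"] by (simp add: e1 e2)
    have "fps_nth (Bgf p d - fps_X * fps_scale (1 / real p) (Bgf p d)) n
      = (y (Suc (Suc m)) - y (Suc m)) - 1 / (p * c) * (y (Suc m) - y m)"
      by (simp add: 3 B fps_scale_def c_def power_one_over)
    also have "\<dots> = (x (Suc (Suc m)) - x (Suc m) - p * c * (x (Suc m) - x m)) / (q * c * c * p)"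
      unfolding y1 y2 S_Suc using p0 qc by (simp add: field_simps)
    also have "\<dots> = fps_nth (Phi p (Agf p d - fps_X * fps_scale (real p) (Agf p d))) n"
      by (simp add: 3 A fps_scale_def Phi_def e2 c_def)
    finally show ?thesis .
  qed (simp_all add: B A fps_scale_def Phi_def y S_def numeral_2_eq_2)
qed

end

theorem theorem1p1:
  fixes p :: nat
  assumes "prime p"
  shows "Abs_fps (\<lambda>d. fps_scale (real p) (Agf p d)) = Abs_fps (\<lambda>d. Bgf p d) ^ p
    \<and> Abs_fps (\<lambda>d. Rgf p d) = Abs_fps (\<lambda>d. fps_scale (real p) (Agf p d)) * Abs_fps (\<lambda>d. Bgf p d)
    \<and> Abs_fps (\<lambda>d. Rgf p d) = Abs_fps (\<lambda>d. Bgf p d) ^ (p + 1)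
    \<and> (\<forall>d. Bgf p d - fps_X * fps_scale (1 / real p) (Bgf p d)
           = Phi p (Agf p d - fps_X * fps_scale (real p) (Agf p d)))"
  using alpha_beta_fps[OF assms] Rgf_fps[OF assms] Bgf_eq_Phi[OF assms]
  by (simp add: mult.commute)

end
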